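(* Let $k$ be a field of characteristic zero and let $B$ be a normal affine $k$-domain with $\dim_kB=2$ and $B^*=k^*$. If $B$ admits a nontrivial $SL_2(k)$-action, then $B$ is equivariantly isomorphic to either $k[F_d]$ for some $d\ge 1$, or to $S_\lambda(k)$ or $Q_\lambda(k)$ for some $\lambda\in k^*$. Among these rings (that is, among $k[F_d]$, $d\ge 1$, and $S_\lambda(k)$, $Q_\lambda(k)$, $\lambda\in k^*$), the unique factorization domains are $k[F_1]\cong k^{[2]}$ and $S_\lambda(k)$ for $\lambda\in k^*$ such that $\sqrt{-\lambda}\notin k$.
   Context: An affine $k$-domain is an integral domain containing $k$ that is finitely generated as a $k$-algebra; $\dim_kB$ is its dimension, $B^*$ its group of units, and $k^{[n]}$ the polynomial ring in $n$ variables over $k$. ${\rm LND}(B)$ is the set of locally nilpotent derivations of $B$ (each element is killed by some power of the derivation). A pair $(D,U)\in{\rm LND}(B)^2$ is a fundamental pair for $B$ if (1) $[D,[D,U]]=-2D$ and $[U,[D,U]]=2U$; and (2) $B=\sum_{d\in\mathbb{Z}}B_d$ where $B_d=\ker([D,U]-dI)$. It is nontrivial unless $D=U=0$. A nontrivial algebraic $SL_2(k)$-action on an affine $k$-domain $B$ is equivalent to a nontrivial fundamental pair $(D,U)$ for $B$; the one-parameter unipotent subgroups $\{\exp(tD)\mid t\in k\}$ and $\{\exp(sU)\mid s\in k\}$ generate the action. An isomorphism is equivariant if it is compatible with the $SL_2(k)$-actions (equivalently, intertwines the fundamental pairs). The rings and their actions: - $k[F_d]$, $d\ge 1$: let $k[y,z]\cong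 k^{[2]}$ carry the fundamental pair $(y\partial_z, z\partial_y)$, let $F_d\subset k[y,z]$ be the $k$-vector space of homogeneous forms of degree $d$, and let $k[F_d]$ be the $k$-subalgebra generated by $F_d$, with the restricted pair. - $S_\lambda(k)$, $\lambda\in k^*$: let $k[x_0,x_1,x_2]\cong k^{[3]}$ carry the fundamental pair $(x_0\partial_{x_1}+x_1\partial_{x_2},\; 2x_1\partial_{x_0}+2x_2\partial_{x_1})$, and let $S_\lambda(k)=k[x_0,x_1,x_2]/(2x_0x_2-x_1^2-\lambda)$ with the induced pair. Let $\pi_\lambda:k[x_0,x_1,x_2]\to S_\lambda(k)$ be the quotient map. - $Q_\lambda(k)$, $\lambda\in k^*$: $Q_\lambda(k)=\pi_\lambda(k[W_2])\subset S_\lambda(k)$, where $W_2\subset k[x_0,x_1,x_2]$ is the vector space of quadratic forms and $k[W_2]$ is the $k$-subalgebra it generates, with the restricted pair. *)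

theory Defs
  imports
    "HOL-Algebra.QuotRing"
    "HOL-Algebra.Generated_Rings"
    "HOL-Algebra.Ring_Divisibility"
    "HOL-Library.Extended_Nat"
    "HOL-Computational_Algebra.Polynomial_Factorial"
begin

section \<open>Algebras over a field given as a type\<close>

definition class_ring :: "'a::comm_ring_1 ring" where
  "class_ring = \<lparr>carrier = UNIV, monoid.mult = (*), one = 1, zero = 0, add = (+)\<rparr>"

text \<open>The ring structure of a type together with a scalar multiplication; it is a
  $k$-algebra if \<open>algebra class_ring (alg_of scale)\<close> holds.\<close>

definition alg_of :: "('k \<Rightarrow> 'b \<Rightarrow> 'b) \<Rightarrow> ('k, 'b::comm_ring_1) module" where
  "alg_of scale =
     \<lparr>carrier = UNIV, monoid.mult = (*), one = 1, zero = 0, add = (+), module.smult = scale\<rparr>"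

text \<open>For a domain \<open>A\<close> over a field, $k$ is identified with the scalar multiples of $1$.\<close>

definition scalars :: "('k, 'b) module \<Rightarrow> 'b set" where
  "scalars A = {c \<odot>\<^bsub>A\<^esub> \<one>\<^bsub>A\<^esub> |c. True}"

definition generated_subalgebra :: "('k, 'b) module \<Rightarrow> 'b set \<Rightarrow> 'b set" where
  "generated_subalgebra A S = generate_ring A (scalars A \<union> S)"

definition affine_domain :: "('k::field, 'b) module \<Rightarrow> bool" where
  "affine_domain A \<longleftrightarrow> algebra class_ring A \<and> domain A \<and>
     (\<exists>S. finite S \<and> S \<subseteq> carrier A \<and> generated_subalgebra A S = carrier A)"

definition krull_dim :: "('b, 'm) ring_scheme \<Rightarrow> enat" where
  "krull_dim R = (SUP n \<in> {n. \<exists>P :: nat \<Rightarrow> 'b set.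
     (\<forall>i\<le>n. primeideal (P i) R) \<and> (\<forall>i<n. P i \<subset> P (Suc i))}. enat n)"

text \<open>Integrally closed in the field of fractions.\<close>

definition normal_domain :: "'b::idom itself \<Rightarrow> bool" where
  "normal_domain _ \<longleftrightarrow>
     (\<forall>x :: 'b fract.
        (\<exists>p :: 'b poly. lead_coeff p = 1 \<and> poly (map_poly to_fract p) x = 0)
          \<longrightarrow> x \<in> range to_fract)"

definition alg_iso :: "('k, 'a) module \<Rightarrow> ('k, 'b) module \<Rightarrow> ('a \<Rightarrow> 'b) set" where
  "alg_iso A B = {\<phi> \<in> ring_iso A B. \<forall>c. \<forall>x\<in>carrier A. \<phi> (c \<odot>\<^bsub>A\<^esub> x) = c \<odot>\<^bsub>B\<^esub> \<phi> x}"


section \<open>Fundamental pairs\<close>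

definition LND :: "('k \<Rightarrow> 'b \<Rightarrow> 'b) \<Rightarrow> ('b::comm_ring_1 \<Rightarrow> 'b) set" where
  "LND scale = {D.
     (\<forall>x y. D (x + y) = D x + D y) \<and> (\<forall>c x. D (scale c x) = scale c (D x)) \<and>
     (\<forall>x y. D (x * y) = D x * y + x * D y) \<and>
     (\<forall>x. \<exists>n. (D ^^ n) x = 0)}"

definition bracket :: "('b::ab_group_add \<Rightarrow> 'b) \<Rightarrow> ('b \<Rightarrow> 'b) \<Rightarrow> 'b \<Rightarrow> 'b" where
  "bracket D U = (\<lambda>x. D (U x) - U (D x))"

definition weight_space :: "('b::comm_ring_1 \<Rightarrow> 'b) \<Rightarrow> ('b \<Rightarrow> 'b) \<Rightarrow> int \<Rightarrow> 'b set" where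
  "weight_space D U d = {x. bracket D U x - of_int d * x = 0}"

definition fundamental_pair ::
  "('k \<Rightarrow> 'b \<Rightarrow> 'b) \<Rightarrow> ('b::comm_ring_1 \<Rightarrow> 'b) \<Rightarrow> ('b \<Rightarrow> 'b) \<Rightarrow> bool" where
  "fundamental_pair scale D U \<longleftrightarrow>
     D \<in> LND scale \<and> U \<in> LND scale \<and>
     (\<forall>x. bracket D (bracket D U) x = - 2 * D x) \<and>
     (\<forall>x. bracket U (bracket D U) x = 2 * U x) \<and>
     (\<forall>x. \<exists>I g. finite I \<and> (\<forall>d\<in>I. g d \<in> weight_space D U d) \<and> x = (\<Sum>d\<in>I. g d))"

definition nontrivial_pair :: "('b::zero \<Rightarrow> 'b) \<Rightarrow> ('b \<Rightarrow> 'b) \<Rightarrow> bool" where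
  "nontrivial_pair D U \<longleftrightarrow> \<not> (D = (\<lambda>_. 0) \<and> U = (\<lambda>_. 0))"

text \<open>The tuples \<open>(A, D, U)\<close> and \<open>(A', D', U')\<close> are isomorphic by a $k$-algebra isomorphism
  intertwining the pairs. Only the values of the operators on the carriers matter.\<close>

definition equivariantly_isomorphic ::
  "('k, 'a) module \<times> ('a \<Rightarrow> 'a) \<times> ('a \<Rightarrow> 'a) \<Rightarrow>
   ('k, 'b) module \<times> ('b \<Rightarrow> 'b) \<times> ('b \<Rightarrow> 'b) \<Rightarrow> bool" where
  "equivariantly_isomorphic = (\<lambda>(A, D, U) (A', D', U').
     \<exists>\<phi>\<in>alg_iso A A'. \<forall>x\<in>carrier A. \<phi> (D x) = D' (\<phi> x) \<and> \<phi> (U x) = U' (\<phi> x))"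


section \<open>The rings $k[F_d]$\<close>

text \<open>$k[y,z]$ is \<open>'k poly poly\<close>, where $y$ is the inner and $z$ the outer variable.\<close>

definition poly2 :: "('k::field, 'k poly poly) module" where
  "poly2 = alg_of (\<lambda>c. Polynomial.smult [:c:])"

definition var_y :: "'k::field poly poly" where "var_y = [:[:0, 1:]:]"
definition var_z :: "'k::field poly poly" where "var_z = [:0, 1:]"

definition D2 :: "'k::field poly poly \<Rightarrow> 'k poly poly" where
  "D2 p = var_y * pderiv p"

definition U2 :: "'k::field poly poly \<Rightarrow> 'k poly poly" where
  "U2 p = var_z * map_poly pderiv p"

definition forms2 :: "nat \<Rightarrow> 'k::field poly poly set" where
  "forms2 d = {p. \<forall>i j. Polynomial.coeff (Polynomial.coeff p j) i \<noteq> 0 \<longrightarrow> i + j = d}"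

definition kF :: "nat \<Rightarrow> ('k::field, 'k poly poly) module" where
  "kF d = poly2\<lparr>carrier := generated_subalgebra poly2 (forms2 d)\<rparr>"


section \<open>The rings $S_\lambda$ and $Q_\lambda$\<close>

text \<open>$k[x_0,x_1,x_2]$ is \<open>'k poly poly poly\<close>, where $x_0$ is the innermost and
  $x_2$ the outermost variable.\<close>

definition poly3 :: "('k::field, 'k poly poly poly) module" where
  "poly3 = alg_of (\<lambda>c. Polynomial.smult [:[:c:]:])"

definition x0 :: "'k::field poly poly poly" where "x0 = [:[:[:0, 1:]:]:]"
definition x1 :: "'k::field poly poly poly" where "x1 = [:[:0, 1:]:]"
definition x2 :: "'k::field poly poly poly" where "x2 = [:0, 1:]"

definition D3 :: "'k::field poly poly poly \<Rightarrow> 'k poly poly poly" where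
  "D3 p = x0 * map_poly pderiv p + x1 * pderiv p"

definition U3 :: "'k::field poly poly poly \<Rightarrow> 'k poly poly poly" where
  "U3 p = 2 * x1 * map_poly (map_poly pderiv) p + 2 * x2 * map_poly pderiv p"

definition forms3 :: "nat \<Rightarrow> 'k::field poly poly poly set" where
  "forms3 d = {p. \<forall>i j l.
     Polynomial.coeff (Polynomial.coeff (Polynomial.coeff p l) j) i \<noteq> 0 \<longrightarrow> i + j + l = d}"

text \<open>The operator on the cosets of \<open>I\<close> induced by an additive operator \<open>f\<close> with
  \<open>f ` I \<subseteq> I\<close>: the coset of \<open>p\<close> is sent to the coset of \<open>f p\<close>, all the sets in
  the union being equal.\<close>

definition induced :: "('b, 'm) ring_scheme \<Rightarrow> 'b set \<Rightarrow> ('b \<Rightarrow> 'b) \<Rightarrow> 'b set \<Rightarrow> 'b set" where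
  "induced R I f C = (\<Union>p\<in>C. I +>\<^bsub>R\<^esub> f p)"

definition quotient_algebra :: "('k, 'b) module \<Rightarrow> 'b set \<Rightarrow> ('k, 'b set) module" where
  "quotient_algebra A I =
     ring.extend (A Quot I) (module.fields (\<lambda>c. induced A I (\<lambda>p. c \<odot>\<^bsub>A\<^esub> p)))"

definition S_ideal :: "'k::field \<Rightarrow> 'k poly poly poly set" where
  "S_ideal lam = genideal poly3 {2 * x0 * x2 - x1\<^sup>2 - [:[:[:lam:]:]:]}"

definition S_alg :: "'k::field \<Rightarrow> ('k, 'k poly poly poly set) module" where
  "S_alg lam = quotient_algebra poly3 (S_ideal lam)"

definition S_D :: "'k::field \<Rightarrow> 'k poly poly poly set \<Rightarrow> 'k poly poly poly set" where
  "S_D lam = induced poly3 (S_ideal lam) D3"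

definition S_U :: "'k::field \<Rightarrow> 'k poly poly poly set \<Rightarrow> 'k poly poly poly set" where
  "S_U lam = induced poly3 (S_ideal lam) U3"

definition S_proj :: "'k::field \<Rightarrow> 'k poly poly poly \<Rightarrow> 'k poly poly poly set" where
  "S_proj lam p = S_ideal lam +>\<^bsub>poly3\<^esub> p"

definition Q_alg :: "'k::field \<Rightarrow> ('k, 'k poly poly poly set) module" where
  "Q_alg lam = (S_alg lam)\<lparr>carrier := S_proj lam ` generated_subalgebra poly3 (forms3 2)\<rparr>"

end

theory Submission
  imports Defs "Berlekamp_Zassenhaus.Unique_Factorization_Poly"
begin

text \<open>
  The invariants of the action are the scalars: a nonconstant invariant, a highest weight vector \<open>v\<close> of positive
  weight and \<open>U v\<close> would be algebraically independent, which is impossible in dimension 2. Then highest weight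
  vectors of equal positive weight are proportional, by normality, so \<open>ker D\<close> is \<open>k[w]\<close> for a highest weight vector
  \<open>w\<close> of minimal positive weight \<open>d\<close>. With \<open>U w = d * x\<close>, the element \<open>w * U x - (d - 1) * x\<^sup>2\<close> is a highest weight
  vector of weight \<open>2 * d - 4\<close>, so it equals \<open>nu * w ^ e\<close> with \<open>d * e = 2 * d - 4\<close> unless it is zero. Hence
  \<open>D\<close> and \<open>U\<close> are determined on \<open>k[w, 1/w, x]\<close> by \<open>d\<close> and \<open>nu\<close>, and comparing submodules generated by highest
  weight vectors inside \<open>k(y, z)\<close> identifies the surface with \<open>k[F_d]\<close> if \<open>nu = 0\<close>, and with \<open>S_lam\<close> (\<open>d = 2\<close>)
  or \<open>Q_lam\<close> (\<open>d = 4\<close>) otherwise.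

  For \<open>d \<ge> 2\<close>, the irreducible element \<open>y ^ d\<close> of \<open>k[F_d]\<close> divides the square of \<open>y ^ (d - 1) * z\<close> but not
  \<open>y ^ (d - 1) * z\<close> itself, and \<open>x0\<^sup>2\<close> and \<open>x0 * x1\<close> play the same role in \<open>Q_lam\<close>. Inverting \<open>x0\<close> turns \<open>S_lam\<close>
  into \<open>k[y, 1/y, z]\<close>, and \<open>x0\<close> is prime exactly if \<open>- lam\<close> is not a square, so Nagata's criterion applies.
\<close>

text \<open>Dimension is defined by chains of primes, so algebraic dependence has to be extracted
  from such chains: three algebraically independent elements are turned into primes 0 < P1 < P2 <
  P3. A prime is enlarged by cutting with t - c, where t is transcendental over a subring R modulo
  that prime. The obstacle is that a prime of R[t] need not extend to the whole finitely generated
  ring; but every prime avoiding one suitable element extends, and c is a natural number chosen so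
  that this element is avoided. The condition on units enters because an element algebraic over k is
  zero or a unit, hence a scalar. The surface and its model are compared inside k(y, z). Derivations
  that vanish on scalars and agree on w and x agree on all of k[w, 1/w, x], so only equality of two
  subrings remains. One inclusion is tested on highest weight vectors, since a subspace stable under
  D and U that contains all of them is everything; the other on generators of the model, which are
  produced from its highest weight vector by U, by division by scalars and, for Q_lam, by the
  quadric relation.\<close>

hide_const (open) UnivPoly.coeff UnivPoly.monom Module.smult

section \<open>Prime ideals of subrings\<close>

text \<open>Rings, ideals and primes are subsets of one ambient type. A quotient by a prime
  \<open>Q\<close> would change the type, so the statements below are made modulo \<open>Q\<close>:
  relations are tested by membership in \<open>Q\<close>, and a prime of a subring \<open>A\<close>
  corresponds to one of the quotient if it contains \<open>Q \<inter> A\<close>.\<close>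

definition is_subring :: "'a::comm_ring_1 set \<Rightarrow> bool" where
  "is_subring A \<longleftrightarrow> 1 \<in> A \<and> (\<forall>x\<in>A. \<forall>y\<in>A. x + y \<in> A \<and> x * y \<in> A) \<and> (\<forall>x\<in>A. - x \<in> A)"

definition ideal_in :: "'a::comm_ring_1 set \<Rightarrow> 'a set \<Rightarrow> bool" where
  "ideal_in A I \<longleftrightarrow> I \<subseteq> A \<and> 0 \<in> I \<and> (\<forall>x\<in>I. \<forall>y\<in>I. x + y \<in> I) \<and> (\<forall>x\<in>A. \<forall>y\<in>I. x * y \<in> I)"

definition prime_in :: "'a::comm_ring_1 set \<Rightarrow> 'a set \<Rightarrow> bool" where
  "prime_in A p \<longleftrightarrow> ideal_in A p \<and> 1 \<notin> p \<and> (\<forall>x\<in>A. \<forall>y\<in>A. x * y \<in> p \<longrightarrow> x \<in> p \<or> y \<in> p)"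

definition coeffs_in :: "'a::comm_ring_1 set \<Rightarrow> 'a poly \<Rightarrow> bool" where
  "coeffs_in A f \<longleftrightarrow> (\<forall>i. coeff f i \<in> A)"

definition adjoin :: "'a::comm_ring_1 set \<Rightarrow> 'a \<Rightarrow> 'a set" where
  "adjoin A t = {poly f t |f. coeffs_in A f}"

definition ring_gen :: "'a::comm_ring_1 set \<Rightarrow> 'a set" where
  "ring_gen S = \<Inter>{A. is_subring A \<and> S \<subseteq> A}"

section \<open>Closure rules for subrings, ideals and coefficients\<close>

lemma is_subringD:
  assumes "is_subring A"
  shows "1 \<in> A" "0 \<in> A" "x \<in> A \<Longrightarrow> y \<in> A \<Longrightarrow> x + y \<in> A" "x \<in> A \<Longrightarrow> y \<in> A \<Longrightarrow> x * y \<in> A"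
    "x \<in> A \<Longrightarrow> - x \<in> A" "x \<in> A \<Longrightarrow> y \<in> A \<Longrightarrow> x - y \<in> A"
proof -
  show *: "1 \<in> A" "x \<in> A \<Longrightarrow> y \<in> A \<Longrightarrow> x + y \<in> A" "x \<in> A \<Longrightarrow> y \<in> A \<Longrightarrow> x * y \<in> A"
    "x \<in> A \<Longrightarrow> - x \<in> A" for x y using assms by (auto simp: is_subring_def)
  show "0 \<in> A" using *(2)[OF *(1) *(4)[OF *(1)]] by simp
  show "x \<in> A \<Longrightarrow> y \<in> A \<Longrightarrow> x - y \<in> A" using *(2)[of x "-y"] *(4)[of y] by simp
qed

lemma is_subring_sum: "is_subring A \<Longrightarrow> (\<And>i. i \<in> I \<Longrightarrow> g i \<in> A) \<Longrightarrow> sum g I \<in> A"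
  by (induction I rule: infinite_finite_induct) (auto simp: is_subringD)

lemma is_subring_prod: "is_subring A \<Longrightarrow> (\<And>i. i \<in> I \<Longrightarrow> g i \<in> A) \<Longrightarrow> prod g I \<in> A"
  by (induction I rule: infinite_finite_induct) (auto simp: is_subringD)

lemma is_subring_power: "is_subring A \<Longrightarrow> x \<in> A \<Longrightarrow> x ^ n \<in> A"
  by (induction n) (auto simp: is_subringD)

lemma is_subring_of_nat: "is_subring A \<Longrightarrow> of_nat n \<in> A"
  by (induction n) (auto simp: is_subringD)

lemma is_subring_poly: "is_subring A \<Longrightarrow> coeffs_in A f \<Longrightarrow> t \<in> A \<Longrightarrow> poly f t \<in> A"
  unfolding poly_altdef coeffs_in_def by (intro is_subring_sum is_subringD is_subring_power) auto

lemma ideal_inD: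
  assumes "ideal_in A I" "is_subring A"
  shows "I \<subseteq> A" "0 \<in> I" "x \<in> I \<Longrightarrow> y \<in> I \<Longrightarrow> x + y \<in> I" "x \<in> A \<Longrightarrow> y \<in> I \<Longrightarrow> x * y \<in> I"
    "y \<in> A \<Longrightarrow> x \<in> I \<Longrightarrow> x * y \<in> I" "x \<in> I \<Longrightarrow> - x \<in> I" "x \<in> I \<Longrightarrow> y \<in> I \<Longrightarrow> x - y \<in> I"
proof -
  show *: "I \<subseteq> A" "0 \<in> I" "x \<in> I \<Longrightarrow> y \<in> I \<Longrightarrow> x + y \<in> I" "x \<in> A \<Longrightarrow> y \<in> I \<Longrightarrow> x * y \<in> I" for x y
    using assms by (auto simp: ideal_in_def)
  show "y \<in> A \<Longrightarrow> x \<in> I \<Longrightarrow> x * y \<in> I" using *(4)[of y x] by (simp add: mult.commute)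
  have "- 1 \<in> A" using assms(2) by (auto simp: is_subringD)
  then show **: "x \<in> I \<Longrightarrow> - x \<in> I" for x using *(4)[of "-1" x] by simp
  show "x \<in> I \<Longrightarrow> y \<in> I \<Longrightarrow> x - y \<in> I" using *(3)[of x "-y"] **[of y] by simp
qed

lemma ideal_in_sum: "ideal_in A I \<Longrightarrow> (\<And>i. i \<in> J \<Longrightarrow> g i \<in> I) \<Longrightarrow> sum g J \<in> I"
  by (induction J rule: infinite_finite_induct) (auto simp: ideal_in_def)

lemma is_subring_UNIV [simp]: "is_subring UNIV"
  by (auto simp: is_subring_def)

lemma prime_inD:
  assumes "prime_in A p"
  shows "ideal_in A p" "1 \<notin> p" "x \<in> A \<Longrightarrow> y \<in> A \<Longrightarrow> x * y \<in> p \<Longrightarrow> x \<in> p \<or> y \<in> p"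
  using assms by (auto simp: prime_in_def)

lemma coeffs_in_0 [simp]: "0 \<in> A \<Longrightarrow> coeffs_in A 0"
  by (auto simp: coeffs_in_def)

lemma coeffs_in_const: "0 \<in> A \<Longrightarrow> c \<in> A \<Longrightarrow> coeffs_in A [:c:]"
  by (auto simp: coeffs_in_def coeff_pCons split: nat.splits)

lemma coeffs_in_pCons: "coeffs_in A (pCons c f) \<longleftrightarrow> c \<in> A \<and> coeffs_in A f"
  by (auto simp: coeffs_in_def coeff_pCons split: nat.splits)

lemma coeffs_in_ring:
  assumes "is_subring A" "coeffs_in A f" "coeffs_in A g"
  shows "coeffs_in A (f + g)" "coeffs_in A (f - g)" "coeffs_in A (f * g)" "coeffs_in A (- f)"
  using assms by (auto simp: coeffs_in_def coeff_mult is_subringD intro!: is_subring_sum)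

lemma coeffs_in_monom: "is_subring A \<Longrightarrow> c \<in> A \<Longrightarrow> coeffs_in A (monom c n)"
  by (auto simp: coeffs_in_def is_subringD)

lemma coeffs_in_ideal:
  assumes "ideal_in A I" "is_subring A" "coeffs_in I f"
  shows "coeffs_in I g \<Longrightarrow> coeffs_in I (f + g)" "coeffs_in I g \<Longrightarrow> coeffs_in I (f - g)"
    "coeffs_in A g \<Longrightarrow> coeffs_in I (g * f)"
  using assms ideal_inD[OF assms(1,2)]
  by (auto simp: coeffs_in_def coeff_mult intro!: ideal_in_sum[OF assms(1)])

lemma poly_in_ideal:
  assumes "ideal_in A I" "is_subring A" "coeffs_in I f" "t \<in> A"
  shows "poly f t \<in> I"
  unfolding poly_altdef
  by (intro ideal_in_sum[OF assms(1)] ideal_inD[OF assms(1,2)] is_subring_power[OF assms(2,4)])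
     (use assms(3) in \<open>auto simp: coeffs_in_def\<close>)

text \<open>Gauss's argument that \<open>p[X]\<close> is prime in \<open>A[X]\<close>: if
  \<open>i\<close> and \<open>j\<close> are the first positions where \<open>f\<close> and
  \<open>g\<close> have coefficients outside \<open>p\<close>, all other terms of the coefficient of
  \<open>f * g\<close> at \<open>i + j\<close> lie in \<open>p\<close>.\<close>

lemma coeffs_in_prime_mult:
  assumes p: "prime_in A p" "is_subring A" and fg: "coeffs_in A f" "coeffs_in A g" "coeffs_in p (f * g)"
  shows "coeffs_in p f \<or> coeffs_in p g"
proof (rule ccontr)
  assume "\<not> ?thesis"
  then have ex: "\<exists>i. coeff f i \<notin> p" "\<exists>j. coeff g j \<notin> p" by (auto simp: coeffs_in_def)
  define i where "i = (LEAST i. coeff f i \<notin> p)"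
  define j where "j = (LEAST i. coeff g i \<notin> p)"
  have i: "coeff f i \<notin> p" "\<And>i'. i' < i \<Longrightarrow> coeff f i' \<in> p"
    using LeastI_ex[OF ex(1)] not_less_Least unfolding i_def by blast+
  have j: "coeff g j \<notin> p" "\<And>i'. i' < j \<Longrightarrow> coeff g i' \<in> p"
    using LeastI_ex[OF ex(2)] not_less_Least unfolding j_def by blast+
  note I = ideal_inD[OF prime_inD(1)[OF p(1)] p(2)]
  have A: "coeff f l \<in> A" "coeff g l \<in> A" for l using fg by (auto simp: coeffs_in_def)
  have "coeff (f * g) (i + j) = (\<Sum>l\<le>i+j. coeff f l * coeff g (i + j - l))" by (rule coeff_mult)
  also have "\<dots> = coeff f i * coeff g j + (\<Sum>l\<in>{..i+j}-{i}. coeff f l * coeff g (i + j - l))"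
    by (subst sum.remove[of _ i]) auto
  finally have eq: "coeff f i * coeff g j
      = coeff (f * g) (i + j) - (\<Sum>l\<in>{..i+j}-{i}. coeff f l * coeff g (i + j - l))" by simp
  have "(\<Sum>l\<in>{..i+j}-{i}. coeff f l * coeff g (i + j - l)) \<in> p"
  proof (rule ideal_in_sum[OF prime_inD(1)[OF p(1)]])
    fix l assume "l \<in> {..i+j}-{i}"
    then have "l < i \<or> i + j - l < j" by auto
    then show "coeff f l * coeff g (i + j - l) \<in> p" using i(2) j(2) I(4,5) A by blast
  qed
  then have "coeff f i * coeff g j \<in> p" unfolding eq using fg(3) by (intro I(7)) (auto simp: coeffs_in_def)
  with prime_inD(3)[OF p(1) A] i j show False by blast
qed

section \<open>Adjoining elements to a subring\<close>

lemma adjoin_subring: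
  assumes "is_subring A"
  shows "is_subring (adjoin A t)"
  unfolding is_subring_def adjoin_def
proof (intro conjI ballI)
  show "1 \<in> {poly f t |f. coeffs_in A f}"
    using coeffs_in_const[OF is_subringD(2,1)[OF assms]] by (force intro!: exI[of _ "[:1:]"])
next
  fix x y assume "x \<in> {poly f t |f. coeffs_in A f}" "y \<in> {poly f t |f. coeffs_in A f}"
  then obtain f g where "x = poly f t" "y = poly g t" "coeffs_in A f" "coeffs_in A g" by auto
  then show "x + y \<in> {poly f t |f. coeffs_in A f}" "x * y \<in> {poly f t |f. coeffs_in A f}"
    using coeffs_in_ring[OF assms, of f g] by (auto intro: exI[of _ "f + g"] exI[of _ "f * g"])
next
  fix x assume "x \<in> {poly f t |f. coeffs_in A f}"
  then obtain f where "x = poly f t" "coeffs_in A f" by auto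
  then show "- x \<in> {poly f t |f. coeffs_in A f}"
    using coeffs_in_ring(4)[OF assms, of f f] by (auto intro: exI[of _ "- f"])
qed

lemma adjoin_incl:
  assumes "is_subring A"
  shows "A \<subseteq> adjoin A t" "t \<in> adjoin A t"
proof -
  show "A \<subseteq> adjoin A t" unfolding adjoin_def
  proof
    fix x assume "x \<in> A"
    then show "x \<in> {poly f t |f. coeffs_in A f}"
      using coeffs_in_const[OF is_subringD(2)[OF assms]] by (force intro!: exI[of _ "[:x:]"])
  qed
  have "coeffs_in A [:0, 1:]" using is_subringD(1,2)[OF assms]
    by (auto simp: coeffs_in_def coeff_pCons split: nat.splits)
  then show "t \<in> adjoin A t" unfolding adjoin_def by (auto intro!: exI[of _ "[:0, 1:]"])
qed

lemma ring_gen_subring [simp]: "is_subring (ring_gen S)"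
  unfolding ring_gen_def is_subring_def by auto

lemma ring_gen_incl: "S \<subseteq> ring_gen S"
  unfolding ring_gen_def by auto

lemma ring_gen_least: "is_subring A \<Longrightarrow> S \<subseteq> A \<Longrightarrow> ring_gen S \<subseteq> A"
  unfolding ring_gen_def by auto

lemma ring_gen_self: "is_subring A \<Longrightarrow> ring_gen A = A"
  using ring_gen_incl ring_gen_least by blast

lemma ring_gen_mono: "S \<subseteq> T \<Longrightarrow> ring_gen S \<subseteq> ring_gen T"
  unfolding ring_gen_def by auto

lemma adjoin_ring_gen: "adjoin (ring_gen S) t = ring_gen (insert t S)"
proof
  have "ring_gen S \<subseteq> ring_gen (insert t S)" by (rule ring_gen_mono) auto
  moreover have "t \<in> ring_gen (insert t S)" using ring_gen_incl[of "insert t S"] by auto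
  ultimately show "adjoin (ring_gen S) t \<subseteq> ring_gen (insert t S)"
    unfolding adjoin_def by (force intro!: is_subring_poly simp: coeffs_in_def)
  show "ring_gen (insert t S) \<subseteq> adjoin (ring_gen S) t"
    using adjoin_incl(1)[OF ring_gen_subring[of S], of t] adjoin_incl(2)[OF ring_gen_subring[of S], of t] ring_gen_incl[of S]
    by (intro ring_gen_least adjoin_subring) auto
qed

section \<open>Extension of prime ideals to larger rings\<close>

lemma prime_avoiding:
  assumes R: "is_subring R" and I: "ideal_in R I"
    and S: "1 \<in> S" "\<And>x y. x \<in> S \<Longrightarrow> y \<in> S \<Longrightarrow> x * y \<in> S" "I \<inter> S = {}"
  shows "\<exists>P. prime_in R P \<and> I \<subseteq> P \<and> P \<inter> S = {}"
proof -
  let ?F = "{J. ideal_in R J \<and> I \<subseteq> J \<and> J \<inter> S = {}}"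
  have "\<exists>M\<in>?F. \<forall>X\<in>?F. M \<subseteq> X \<longrightarrow> X = M"
  proof (rule subset_Zorn_nonempty)
    show "?F \<noteq> {}" using I S by auto
    fix C assume C: "C \<noteq> {}" "subset.chain ?F C"
    then have sub: "C \<subseteq> ?F" and ch: "\<And>X Y. X \<in> C \<Longrightarrow> Y \<in> C \<Longrightarrow> X \<subseteq> Y \<or> Y \<subseteq> X"
      unfolding subset.chain_def by blast+
    have "ideal_in R (\<Union>C)" unfolding ideal_in_def
    proof (intro conjI ballI)
      show "\<Union>C \<subseteq> R" "0 \<in> \<Union>C" using sub C(1) by (auto simp: ideal_in_def)
      fix x y assume "y \<in> \<Union>C"
      then show "x \<in> R \<Longrightarrow> x * y \<in> \<Union>C" using sub unfolding ideal_in_def by blast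
      assume "x \<in> \<Union>C"
      with \<open>y \<in> \<Union>C\<close> obtain X Y where "X \<in> C" "Y \<in> C" "x \<in> X" "y \<in> Y" by auto
      with ch[of X Y] obtain Z where Z: "Z \<in> C" "x \<in> Z" "y \<in> Z" by auto
      then have "x + y \<in> Z" using sub by (auto simp: ideal_in_def)
      then show "x + y \<in> \<Union>C" using Z by auto
    qed
    then show "\<Union>C \<in> ?F" using sub C(1) by blast
  qed
  then obtain M where M: "ideal_in R M" "I \<subseteq> M" "M \<inter> S = {}"
    and max: "\<And>X. ideal_in R X \<Longrightarrow> M \<subseteq> X \<Longrightarrow> X \<inter> S = {} \<Longrightarrow> X = M" by auto
  note MD = ideal_inD[OF M(1) R]
  \<comment> \<open>By maximality the ideal generated by \<open>M\<close> and \<open>a\<close> meets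
    \<open>S\<close>. If neither factor of a product in \<open>M\<close> were in \<open>M\<close>,
    two such elements of \<open>S\<close> would multiply into \<open>M\<close>, which misses
    \<open>S\<close>.\<close>
  have ext: "\<exists>m\<in>M. \<exists>r\<in>R. m + r * a \<in> S" if a: "a \<in> R" "a \<notin> M" for a
  proof -
    let ?X = "{m + r * a |m r. m \<in> M \<and> r \<in> R}"
    have "ideal_in R ?X" unfolding ideal_in_def
    proof (intro conjI ballI)
      show "?X \<subseteq> R" using MD(1) a R by (auto simp: is_subringD subset_iff)
      show "0 \<in> ?X" using MD(2) is_subringD(2)[OF R] by force
      fix x y assume "y \<in> ?X"
      then obtain m r where y: "y = m + r * a" "m \<in> M" "r \<in> R" by auto
      { assume "x \<in> ?X"
        then obtain m' r' where x: "x = m' + r' * a" "m' \<in> M" "r' \<in> R" by auto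
        have "x + y = (m' + m) + (r' + r) * a" by (simp add: x y algebra_simps)
        then show "x + y \<in> ?X" using x y MD(3) is_subringD(3)[OF R] by blast }
      { assume x: "x \<in> R"
        have "x * y = x * m + (x * r) * a" by (simp add: y algebra_simps)
        then show "x * y \<in> ?X" using x y MD(4) is_subringD(4)[OF R] by blast }
    qed
    moreover have "M \<subseteq> ?X" using is_subringD(2)[OF R] by force
    moreover have "?X \<noteq> M"
    proof
      have "0 + 1 * a \<in> ?X" using MD(2) is_subringD(1)[OF R] by blast
      moreover assume "?X = M" ultimately show False using a by simp
    qed
    ultimately have "?X \<inter> S \<noteq> {}" using max by blast
    then show ?thesis by auto
  qed
  have "prime_in R M" unfolding prime_in_def
  proof (intro conjI ballI impI)
    show "ideal_in R M" "1 \<notin> M" using M S by auto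
    fix x y assume xy: "x \<in> R" "y \<in> R" "x * y \<in> M"
    show "x \<in> M \<or> y \<in> M"
    proof (rule ccontr)
      assume "\<not> (x \<in> M \<or> y \<in> M)"
      then obtain m r m' r' where m: "m \<in> M" "r \<in> R" "m + r * x \<in> S" "m' \<in> M" "r' \<in> R" "m' + r' * y \<in> S"
        using ext xy by meson
      have "(m + r * x) * (m' + r' * y) = (m' + r' * y) * m + ((r * x) * m' + (r * r') * (x * y))"
        by (simp add: algebra_simps)
      moreover have "\<dots> \<in> M"
        using m xy MD(1) by (intro MD(3) MD(4)[of _ m] MD(4)[of _ m'] MD(4)[of _ "x * y"] is_subringD[OF R]) auto
      ultimately show False using S(2)[OF m(3,6)] M(3) by auto
    qed
  qed
  then show ?thesis using M by auto
qed

text \<open>Modulo \<open>Q\<close>, \<open>adjoin A t\<close> is a polynomial ring over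
  \<open>A\<close>, so the polynomials with coefficients in \<open>p\<close> give a prime over
  \<open>p\<close>. The last conjunct lets a single coefficient outside \<open>p\<close> certify
  that an element of \<open>adjoin A t\<close> avoids \<open>P\<close>.\<close>

lemma prime_over_transcendental:
  assumes A: "is_subring A" and Q: "prime_in UNIV Q"
    and tr: "\<And>f. coeffs_in A f \<Longrightarrow> poly f t \<in> Q \<Longrightarrow> coeffs_in Q f"
    and p: "prime_in A p" "Q \<inter> A \<subseteq> p"
  shows "\<exists>P. prime_in (adjoin A t) P \<and> Q \<inter> adjoin A t \<subseteq> P \<and> P \<inter> A = p \<and>
    (\<forall>g. coeffs_in A g \<longrightarrow> poly g t \<in> P \<longrightarrow> coeffs_in p g)"
proof -
  let ?P = "{poly f t |f. coeffs_in p f}"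
  note AD = is_subringD[OF A] and QD = ideal_inD[OF prime_inD(1)[OF Q] is_subring_UNIV]
  note pI = prime_inD(1)[OF p(1)] note pD = ideal_inD[OF pI A]
  have pA: "coeffs_in p f \<Longrightarrow> coeffs_in A f" for f using pD(1) by (auto simp: coeffs_in_def)
  \<comment> \<open>Membership does not depend on the representing polynomial: two of them differ by
    coefficients in \<open>Q \<inter> A\<close>, which lie in \<open>p\<close>.\<close>
  have uniq: "coeffs_in p g" if g: "coeffs_in A g" "poly g t \<in> ?P" for g
  proof -
    obtain f where f: "poly g t = poly f t" "coeffs_in p f" using g(2) by blast
    then have "poly (g - f) t \<in> Q" using QD(2) by simp
    then have *: "coeffs_in Q (g - f)" "coeffs_in A (g - f)"
      using tr coeffs_in_ring[OF A g(1) pA[OF f(2)]] by auto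
    then have "coeffs_in p (g - f)" using p(2) by (auto simp: coeffs_in_def)
    then have "coeffs_in p (g - f + f)" using coeffs_in_ideal(1)[OF pI A] f by blast
    then show ?thesis by simp
  qed
  have QP: "coeffs_in p f" if "coeffs_in A f" "poly f t \<in> Q" for f
    using tr[OF that] that(1) p(2) by (auto simp: coeffs_in_def)
  have const: "c \<in> A \<Longrightarrow> coeffs_in A [:c:]" for c using AD by (intro coeffs_in_const) auto
  have "prime_in (adjoin A t) ?P" unfolding prime_in_def ideal_in_def
  proof (intro conjI ballI impI)
    show "?P \<subseteq> adjoin A t" using pA unfolding adjoin_def by auto
    show "0 \<in> ?P" using pD(2) by (auto intro!: exI[of _ 0])
    show "1 \<notin> ?P"
    proof
      assume "1 \<in> ?P"
      then have "poly [:1:] t \<in> ?P" by simp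
      then have "coeffs_in p [:1:]" using uniq const[OF AD(1)] by blast
      then have "coeff [:1:] 0 \<in> p" unfolding coeffs_in_def by blast
      then show False using prime_inD(2)[OF p(1)] by simp
    qed
    fix x y
    { assume "x \<in> ?P" "y \<in> ?P"
      then obtain f g where "x = poly f t" "y = poly g t" "coeffs_in p f" "coeffs_in p g" by auto
      then show "x + y \<in> ?P" using coeffs_in_ideal(1)[OF pI A, of f g] by (auto intro!: exI[of _ "f + g"]) }
    { assume "x \<in> adjoin A t" "y \<in> ?P"
      then obtain f g where "x = poly f t" "y = poly g t" "coeffs_in A f" "coeffs_in p g"
        by (auto simp: adjoin_def)
      then show "x * y \<in> ?P" using coeffs_in_ideal(3)[OF pI A, of g f] by (auto intro!: exI[of _ "f * g"]) }
    { assume "x \<in> adjoin A t" "y \<in> adjoin A t" "x * y \<in> ?P"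
      then obtain f g where fg: "x = poly f t" "y = poly g t" "coeffs_in A f" "coeffs_in A g"
        by (auto simp: adjoin_def)
      then have "coeffs_in p (f * g)" using \<open>x * y \<in> ?P\<close> coeffs_in_ring[OF A fg(3,4)] by (intro uniq) auto
      then show "x \<in> ?P \<or> y \<in> ?P" using coeffs_in_prime_mult[OF p(1) A fg(3,4)] fg(1,2) by blast }
  qed
  moreover have "Q \<inter> adjoin A t \<subseteq> ?P" using QP unfolding adjoin_def by auto
  moreover have "?P \<inter> A = p"
  proof (intro equalityI subsetI)
    fix c assume "c \<in> ?P \<inter> A"
    then have "coeffs_in p [:c:]" using uniq[of "[:c:]"] const by auto
    then show "c \<in> p" by (auto simp: coeffs_in_pCons)
  next
    fix c assume "c \<in> p"
    then show "c \<in> ?P \<inter> A" using pD by (auto intro!: exI[of _ "[:c:]"] coeffs_in_const)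
  qed
  ultimately show ?thesis using uniq by blast
qed

text \<open>Lying over when \<open>t\<close> is a root modulo \<open>Q\<close> of a polynomial whose leading coefficient is a unit
  at \<open>n\<close>. If the extension of \<open>n\<close> contained an element outside \<open>n\<close>, then \<open>t\<close> would also be a root of some
  \<open>G\<close> with constant term outside \<open>n\<close> and all other coefficients in \<open>n\<close>; of the two polynomials the one of
  larger degree could be replaced by one of smaller degree.\<close>

lemma prime_over_integral:
  assumes C: "is_subring C" and Q: "prime_in UNIV Q" and n: "prime_in C n" "Q \<inter> C \<subseteq> n"
    and f: "coeffs_in C f" "poly f t \<in> Q" "lead_coeff f \<notin> n"
  shows "\<exists>P. prime_in (adjoin C t) P \<and> Q \<inter> adjoin C t \<subseteq> P \<and> P \<inter> C = n"
proof -
  note CD = is_subringD[OF C] and QD = ideal_inD[OF prime_inD(1)[OF Q] is_subring_UNIV]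
  note nI = prime_inD(1)[OF n(1)] note nD = ideal_inD[OF nI C] note nP = prime_inD(2,3)[OF n(1)]
  define good where "good G \<longleftrightarrow> coeffs_in C G \<and> coeff G 0 \<notin> n \<and> (\<forall>i>0. coeff G i \<in> n) \<and> poly G t \<in> Q" for G
  define nice where "nice f \<longleftrightarrow> coeffs_in C f \<and> poly f t \<in> Q \<and> lead_coeff f \<notin> n" for f
  have no_good: "\<not> good G0" for G0
  proof
    assume "good G0"
    \<comment> \<open>\<open>G\<close> and \<open>F\<close> are taken of least degree among the good
      and the nice polynomials, so either reduction below contradicts minimality.\<close>
    then obtain G where G: "good G" and Gmin: "\<And>G'. good G' \<Longrightarrow> degree G \<le> degree G'"
      using ex_has_least_nat[of good _ degree] by auto
    have "nice f" using f by (auto simp: nice_def)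
    then obtain F where F: "nice F" and Fmin: "\<And>F'. nice F' \<Longrightarrow> degree F \<le> degree F'"
      using ex_has_least_nat[of nice _ degree] by auto
    define e m where "e = degree G" and "m = degree F"
    define a where "a = lead_coeff F"
    have Gc: "coeff G i \<in> C" "coeff G 0 \<notin> n" "i > 0 \<Longrightarrow> coeff G i \<in> n" "poly G t \<in> Q" for i
      using G by (auto simp: good_def coeffs_in_def)
    have Fc: "coeff F i \<in> C" "poly F t \<in> Q" "a \<notin> n" "a \<in> C" "coeff F m = a" for i
      using F by (auto simp: nice_def coeffs_in_def a_def m_def)
    have "e \<noteq> 0"
    proof
      assume "e = 0"
      then have "poly G t = coeff G 0" unfolding e_def by (auto elim!: degree_eq_zeroE)
      then show False using Gc n(2) by auto
    qed
    have "m \<noteq> 0"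
    proof
      assume "m = 0"
      then have "poly F t = a" unfolding m_def a_def by (auto elim!: degree_eq_zeroE)
      then show False using Fc n(2) by auto
    qed
    show False
    proof (cases "m \<le> e")
      case True
      \<comment> \<open>The leading term of \<open>G\<close> is cancelled by a multiple of
        \<open>F\<close>. Since \<open>coeff G e\<close> lies in \<open>n\<close>, the correction
        has coefficients in \<open>n\<close>, and the constant term is still
        \<open>a * coeff G 0\<close> modulo \<open>n\<close>.\<close>
      let ?G = "Polynomial.smult a G - Polynomial.smult (coeff G e) (monom 1 (e - m) * F)"
      have Ge: "coeff G e \<in> n" "coeff G e \<in> C" using Gc \<open>e \<noteq> 0\<close> by auto
      have cf: "coeff ?G i = a * coeff G i - coeff G e * (if e - m \<le> i then coeff F (i - (e - m)) else 0)" for i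
        by (simp add: coeff_monom_mult)
      have inC: "(if e - m \<le> i then coeff F (i - (e - m)) else 0) \<in> C" for i using Fc CD by auto
      have "good ?G" unfolding good_def
      proof (intro conjI allI impI)
        show "coeffs_in C ?G" unfolding coeffs_in_def cf using Gc Fc inC CD by auto
        have *: "coeff G e * (if e - m \<le> i then coeff F (i - (e - m)) else 0) \<in> n" for i
          using inC Ge nD(5) by blast
        show "coeff ?G 0 \<notin> n"
        proof
          assume "coeff ?G 0 \<in> n"
          from nD(3)[OF this[unfolded cf] *[of 0]] have "a * coeff G 0 \<in> n" by simp
          then show False using nP(2)[of a "coeff G 0"] Fc Gc by auto
        qed
        show "coeff ?G i \<in> n" if "i > 0" for i
          unfolding cf by (rule nD(7)[OF nD(4)[OF Fc(4) Gc(3)[OF that]] *])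
        show "poly ?G t \<in> Q" using Gc(4) Fc(2) QD by (auto simp: poly_monom)
      qed
      moreover have "degree ?G < e"
      proof -
        have "degree ?G \<le> e" 
        proof (rule degree_le, intro allI impI)
          fix i assume "e < i"
          then show "coeff ?G i = 0" unfolding cf using \<open>m \<le> e\<close>
            by (auto simp: coeff_eq_0 e_def[symmetric] m_def[symmetric])
        qed
        moreover have "coeff ?G e = 0" unfolding cf using \<open>m \<le> e\<close> Fc(5) by simp
        ultimately show ?thesis using \<open>e \<noteq> 0\<close> eq_zero_or_degree_less by fastforce
      qed
      ultimately show False using Gmin unfolding e_def by fastforce
    next
      case False
      \<comment> \<open>Here \<open>degree G < degree F\<close>: cancelling the constant terms
        leaves a multiple of the variable, and the quotient \<open>F'\<close> has leading
        coefficient \<open>coeff G 0 * a\<close>, outside \<open>n\<close>. As \<open>Q\<close> is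
        prime, \<open>poly F' t\<close> or \<open>t\<close> lies in \<open>Q\<close>; the latter
        would put \<open>coeff G 0\<close> into \<open>Q\<close>.\<close>
      define F' where "F' = poly_shift 1 (Polynomial.smult (coeff G 0) F - Polynomial.smult (coeff F 0) G)"
      have cf: "coeff F' i = coeff G 0 * coeff F (Suc i) - coeff F 0 * coeff G (Suc i)" for i
        by (simp add: F'_def coeff_poly_shift)
      have eq: "Polynomial.smult (coeff G 0) F - Polynomial.smult (coeff F 0) G = pCons 0 F'"
        by (rule poly_eqI) (auto simp: coeff_pCons cf mult.commute split: nat.splits)
      have top: "coeff F' (m - 1) = coeff G 0 * a"
        using \<open>m \<noteq> 0\<close> False Fc(5) by (simp add: cf coeff_eq_0 e_def)
      have top': "coeff F' (m - 1) \<notin> n" unfolding top using nP(2)[of "coeff G 0" a] Fc Gc by auto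
      have "degree F' \<le> m - 1"
      proof (rule degree_le, intro allI impI)
        fix i assume "m - 1 < i"
        then have "m < Suc i" by simp
        then show "coeff F' i = 0" unfolding cf using False
          by (auto simp: coeff_eq_0 e_def[symmetric] m_def[symmetric])
      qed
      moreover have "coeff F' (m - 1) \<noteq> 0" using top' nD(2) by auto
      ultimately have deg: "degree F' = m - 1" using le_degree antisym by blast
      have "t * poly F' t = coeff G 0 * poly F t - coeff F 0 * poly G t"
        using arg_cong[OF eq, of "\<lambda>q. poly q t"] by simp
      also have "\<dots> \<in> Q" using Gc(4) Fc(2) QD by auto
      finally have "t \<in> Q \<or> poly F' t \<in> Q" using prime_inD(3)[OF Q] by auto
      then show False
      proof
        assume "poly F' t \<in> Q"
        then have "nice F'" unfolding nice_def coeffs_in_def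
          using top' deg Gc(1) Fc(1) CD by (auto simp: cf)
        from Fmin[OF this] deg \<open>m \<noteq> 0\<close> show False unfolding m_def by simp
      next
        assume tQ: "t \<in> Q"
        have "G = pCons (coeff G 0) (poly_shift 1 G)"
          by (rule poly_eqI) (auto simp: coeff_pCons coeff_poly_shift split: nat.splits)
        then have "poly G t = coeff G 0 + t * poly (poly_shift 1 G) t" by (metis poly_pCons)
        then have "coeff G 0 = poly G t - t * poly (poly_shift 1 G) t" by simp
        also have "\<dots> \<in> Q" using Gc(4) tQ QD by auto
        finally show False using Gc n(2) by auto
      qed
    qed
  qed
  \<comment> \<open>The extension of \<open>n\<close> to \<open>adjoin C t\<close>, enlarged by
    \<open>Q\<close>. An element \<open>h\<close> of it in \<open>C - n\<close> would make
    \<open>[:h:] - G\<close> good.\<close>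
  let ?I = "{x \<in> adjoin C t. \<exists>G. coeffs_in n G \<and> x - poly G t \<in> Q}"
  have "ideal_in (adjoin C t) ?I" unfolding ideal_in_def
  proof (intro conjI ballI)
    show "?I \<subseteq> adjoin C t" by auto
    show "0 \<in> ?I" using is_subringD(2)[OF adjoin_subring[OF C]] nD(2) QD(2) by (auto intro!: exI[of _ 0])
    fix x y assume y: "y \<in> ?I"
    then obtain G where G: "coeffs_in n G" "y - poly G t \<in> Q" by auto
    { assume "x \<in> ?I"
      then obtain F where F: "coeffs_in n F" "x - poly F t \<in> Q" by auto
      have "(x - poly F t) + (y - poly G t) \<in> Q" using F G QD by blast
      then have "(x + y) - poly (F + G) t \<in> Q" by (simp add: algebra_simps)
      then show "x + y \<in> ?I" using coeffs_in_ideal(1)[OF nI C F(1) G(1)] y \<open>x \<in> ?I\<close>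
          is_subringD(3)[OF adjoin_subring[OF C]] by blast }
    { assume x: "x \<in> adjoin C t"
      then obtain F where F: "coeffs_in C F" "x = poly F t" by (auto simp: adjoin_def)
      have "x * (y - poly G t) \<in> Q" using G QD by blast
      then have "x * y - poly (F * G) t \<in> Q" by (simp add: algebra_simps F)
      then show "x * y \<in> ?I" using coeffs_in_ideal(3)[OF nI C G(1) F(1)] y x
          is_subringD(4)[OF adjoin_subring[OF C]] by blast }
  qed
  moreover have "?I \<inter> (C - n) = {}"
  proof (rule ccontr)
    assume "?I \<inter> (C - n) \<noteq> {}"
    then obtain h G where h: "h \<in> C" "h \<notin> n" "coeffs_in n G" "h - poly G t \<in> Q" by auto
    have "good ([:h:] - G)" unfolding good_def
    proof (intro conjI allI impI)
      have "coeffs_in C G" using h(3) nD(1) by (auto simp: coeffs_in_def)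
      then show "coeffs_in C ([:h:] - G)" using h(1) CD by (intro coeffs_in_ring[OF C] coeffs_in_const) auto
      show "poly ([:h:] - G) t \<in> Q" using h by simp
      show "coeff ([:h:] - G) 0 \<notin> n"
      proof
        assume "coeff ([:h:] - G) 0 \<in> n"
        from nD(3)[OF this, of "coeff G 0"] h show False by (auto simp: coeffs_in_def)
      qed
      show "coeff ([:h:] - G) i \<in> n" if "i > 0" for i
        using that h(3) nD(6) by (auto simp: coeffs_in_def coeff_pCons split: nat.splits)
    qed
    then show False using no_good by blast
  qed
  ultimately obtain P where P: "prime_in (adjoin C t) P" "?I \<subseteq> P" "P \<inter> (C - n) = {}"
    using prime_avoiding[OF adjoin_subring[OF C], of t ?I "C - n"] CD(1,4) nP by blast
  have "Q \<inter> adjoin C t \<subseteq> ?I" using nD(2) by (auto intro!: exI[of _ 0])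
  moreover have "n \<subseteq> ?I"
  proof
    fix x assume "x \<in> n"
    then show "x \<in> ?I" using nD(1,2) adjoin_incl(1)[OF C] QD(2)
      by (auto intro!: exI[of _ "[:x:]"] coeffs_in_const)
  qed
  ultimately show ?thesis using P nD(1) by blast
qed

text \<open>The relations have coefficients in \<open>A\<close>, and each new prime meets
  \<open>A\<close> in \<open>p\<close>, so their leading coefficients stay outside the prime at
  every stage of the tower.\<close>

lemma prime_over_integral_tower:
  assumes "finite G" "is_subring A" "prime_in UNIV Q" "prime_in A p" "Q \<inter> A \<subseteq> p"
    and "\<And>g. g \<in> G \<Longrightarrow> coeffs_in A (F g) \<and> poly (F g) g \<in> Q \<and> lead_coeff (F g) \<notin> p"
  shows "\<exists>P. prime_in (ring_gen (A \<union> G)) P \<and> Q \<inter> ring_gen (A \<union> G) \<subseteq> P \<and> P \<inter> A = p"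
  using assms
proof (induction G rule: finite_induct)
  case empty
  then show ?case by (auto simp: ring_gen_self prime_in_def ideal_in_def intro!: exI[of _ p])
next
  case (insert g G)
  then obtain P where P: "prime_in (ring_gen (A \<union> G)) P" "Q \<inter> ring_gen (A \<union> G) \<subseteq> P" "P \<inter> A = p" by auto
  have A: "A \<subseteq> ring_gen (A \<union> G)" using ring_gen_incl[of "A \<union> G"] by auto
  have Fg: "coeffs_in A (F g)" "poly (F g) g \<in> Q" "lead_coeff (F g) \<notin> p" using insert.prems by auto
  then have "coeffs_in (ring_gen (A \<union> G)) (F g)" "lead_coeff (F g) \<notin> P"
    using A P by (auto simp: coeffs_in_def)
  from prime_over_integral[OF ring_gen_subring insert.prems(2) P(1,2) this(1) Fg(2) this(2)]
  obtain P' where "prime_in (adjoin (ring_gen (A \<union> G)) g) P'"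
    "Q \<inter> adjoin (ring_gen (A \<union> G)) g \<subseteq> P'" "P' \<inter> ring_gen (A \<union> G) = P" by auto
  then show ?case using P(3) A unfolding adjoin_ring_gen by (auto intro!: exI[of _ P'])
qed

text \<open>A relation whose leading coefficient lies in \<open>Q\<close> remains a relation when
  its leading term is dropped, so by descending degree all its coefficients lie in
  \<open>Q\<close>.\<close>

lemma transcendental_if_not_algebraic:
  assumes A: "is_subring A" and Q: "ideal_in UNIV Q"
    and no: "\<not> (\<exists>f. coeffs_in A f \<and> poly f t \<in> Q \<and> lead_coeff f \<notin> Q)"
    and "coeffs_in A f" "poly f t \<in> Q"
  shows "coeffs_in Q f"
  using assms(4,5)
proof (induction "degree f" arbitrary: f rule: less_induct)
  case less
  note QD = ideal_inD[OF Q is_subring_UNIV]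
  have lc: "lead_coeff f \<in> Q" using no less by auto
  define f' where "f' = f - monom (lead_coeff f) (degree f)"
  have "poly f' t = poly f t - lead_coeff f * t ^ degree f" by (simp add: f'_def poly_monom)
  then have f'Q: "poly f' t \<in> Q" using less.prems lc QD by auto
  have f'A: "coeffs_in A f'" unfolding f'_def
    using less.prems by (intro coeffs_in_ring[OF A] coeffs_in_monom[OF A]) (auto simp: coeffs_in_def)
  have "coeffs_in Q f'"
  proof (cases "degree f = 0")
    case True
    then have "f' = 0" by (auto simp: f'_def monom_0 elim!: degree_eq_zeroE)
    then show ?thesis using QD(2) by simp
  next
    case False
    have "degree f' \<le> degree f" unfolding f'_def
      by (rule degree_diff_le) (auto simp: degree_monom_le)
    moreover have "coeff f' (degree f) = 0" by (simp add: f'_def)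
    ultimately have "degree f' < degree f" using False eq_zero_or_degree_less by fastforce
    then show ?thesis using less.hyps f'A f'Q by auto
  qed
  then have "coeff f' i \<in> Q" for i by (auto simp: coeffs_in_def)
  from QD(3)[OF this] have "coeff f' i + (if i = degree f then lead_coeff f else 0) \<in> Q" for i
    using lc QD(2) by auto
  moreover have "coeff f' i + (if i = degree f then lead_coeff f else 0) = coeff f i" for i
    by (auto simp: f'_def)
  ultimately show ?case by (auto simp: coeffs_in_def)
qed

lemma prime_prod_notin:
  assumes "prime_in A p" "is_subring A" "finite G" "\<And>g. g \<in> G \<Longrightarrow> c g \<in> A"
  shows "prod c G \<in> A \<and> (prod c G \<notin> p \<longleftrightarrow> (\<forall>g\<in>G. c g \<notin> p))"
  using assms(3,4)
proof (induction G rule: finite_induct)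
  case empty
  then show ?case using assms by (auto simp: is_subringD prime_inD)
next
  case (insert g G)
  then show ?case using prime_inD(3)[OF assms(1), of "c g" "prod c G"]
      ideal_inD(4,5)[OF prime_inD(1)[OF assms(1)] assms(2)] is_subringD(4)[OF assms(2)]
    by auto
qed

text \<open>Not every prime \<open>p\<close> of \<open>A\<close> extends to the ring generated by
  \<open>G\<close>, but those avoiding one element \<open>a\<close> do. If all generators are
  algebraic modulo \<open>Q\<close>, \<open>a\<close> is the product of the leading coefficients of
  their relations; otherwise a transcendental generator is absorbed into the base ring.\<close>

theorem generic_lying_over:
  assumes "finite G" "is_subring A" "prime_in UNIV Q"
  shows "\<exists>a\<in>A - Q. \<forall>p. prime_in A p \<longrightarrow> Q \<inter> A \<subseteq> p \<longrightarrow> a \<notin> p \<longrightarrow>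
    (\<exists>P. prime_in (ring_gen (A \<union> G)) P \<and> Q \<inter> ring_gen (A \<union> G) \<subseteq> P \<and> P \<inter> A = p)"
  using assms
proof (induction "card G" arbitrary: G A rule: less_induct)
  case less
  note A = less.prems(2) and Q = less.prems(3)
  note AD = is_subringD[OF A] and QI = prime_inD(1)[OF Q]
  show ?case
  proof (cases "\<forall>g\<in>G. \<exists>f. coeffs_in A f \<and> poly f g \<in> Q \<and> lead_coeff f \<notin> Q")
    case True
    then have "\<exists>F. \<forall>g\<in>G. coeffs_in A (F g) \<and> poly (F g) g \<in> Q \<and> lead_coeff (F g) \<notin> Q"
      by (rule bchoice)
    then obtain F where F: "\<And>g. g \<in> G \<Longrightarrow> coeffs_in A (F g) \<and> poly (F g) g \<in> Q \<and> lead_coeff (F g) \<notin> Q"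
      by blast
    have FA: "\<And>g. g \<in> G \<Longrightarrow> lead_coeff (F g) \<in> A" using F by (auto simp: coeffs_in_def)
    let ?a = "\<Prod>g\<in>G. lead_coeff (F g)"
    have "?a \<in> A" "?a \<notin> Q"
    proof -
      have pr: "?a \<notin> Q \<longleftrightarrow> (\<forall>g\<in>G. lead_coeff (F g) \<notin> Q)"
        using prime_prod_notin[OF Q is_subring_UNIV less.prems(1), of "\<lambda>g. lead_coeff (F g)"] by simp
      then show "?a \<notin> Q" using F by auto
      show "?a \<in> A" using FA by (rule is_subring_prod[OF A])
    qed
    moreover have "\<exists>P. prime_in (ring_gen (A \<union> G)) P \<and> Q \<inter> ring_gen (A \<union> G) \<subseteq> P \<and> P \<inter> A = p"
      if p: "prime_in A p" "Q \<inter> A \<subseteq> p" "?a \<notin> p" for p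
    proof (rule prime_over_integral_tower[OF less.prems(1) A Q p(1,2)])
      have "\<forall>g\<in>G. lead_coeff (F g) \<notin> p" using prime_prod_notin[OF p(1) A less.prems(1), of "\<lambda>g. lead_coeff (F g)"] FA p(3) by simp
      then show "coeffs_in A (F g) \<and> poly (F g) g \<in> Q \<and> lead_coeff (F g) \<notin> p" if "g \<in> G" for g
        using F that by auto
    qed
    ultimately show ?thesis by blast
  next
    case False
    then obtain g where g: "g \<in> G" "\<not> (\<exists>f. coeffs_in A f \<and> poly f g \<in> Q \<and> lead_coeff f \<notin> Q)" by auto
    note tr = transcendental_if_not_algebraic[OF A QI g(2)]
    have "card (G - {g}) < card G" using card_Diff1_less[OF less.prems(1) g(1)] .
    from less.hyps[OF this _ adjoin_subring[OF A, of g] Q] less.prems(1)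
    obtain a1 where a1: "a1 \<in> adjoin A g - Q"
      and lift: "\<And>p. prime_in (adjoin A g) p \<Longrightarrow> Q \<inter> adjoin A g \<subseteq> p \<Longrightarrow> a1 \<notin> p \<Longrightarrow>
        \<exists>P. prime_in (ring_gen (adjoin A g \<union> (G - {g}))) P \<and>
          Q \<inter> ring_gen (adjoin A g \<union> (G - {g})) \<subseteq> P \<and> P \<inter> adjoin A g = p"
      by blast
    have gen: "ring_gen (adjoin A g \<union> (G - {g})) = ring_gen (A \<union> G)"
    proof
      have "adjoin A g = ring_gen (insert g A)"
        using adjoin_ring_gen[of A g] by (simp add: ring_gen_self[OF A])
      also have "\<dots> \<subseteq> ring_gen (A \<union> G)" using g by (intro ring_gen_mono) auto
      finally show "ring_gen (adjoin A g \<union> (G - {g})) \<subseteq> ring_gen (A \<union> G)"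
        using ring_gen_incl[of "A \<union> G"] by (intro ring_gen_least ring_gen_subring) auto
      show "ring_gen (A \<union> G) \<subseteq> ring_gen (adjoin A g \<union> (G - {g}))"
        using adjoin_incl[OF A, of g] by (intro ring_gen_least ring_gen_subring subset_trans[OF _ ring_gen_incl]) auto
    qed
    obtain h where h: "a1 = poly h g" "coeffs_in A h" using a1 by (auto simp: adjoin_def)
    have "\<not> coeffs_in Q h" using a1 poly_in_ideal[OF QI is_subring_UNIV, of h g] h by auto
    \<comment> \<open>A coefficient of the element \<open>a1\<close> found over
      \<open>adjoin A g\<close> serves over \<open>A\<close>: if it avoids \<open>p\<close>, then
      \<open>a1\<close> avoids the extension of \<open>p\<close>.\<close>
    then obtain i where i: "coeff h i \<notin> Q" by (auto simp: coeffs_in_def)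
    have "\<exists>P. prime_in (ring_gen (A \<union> G)) P \<and> Q \<inter> ring_gen (A \<union> G) \<subseteq> P \<and> P \<inter> A = p"
      if p: "prime_in A p" "Q \<inter> A \<subseteq> p" "coeff h i \<notin> p" for p
    proof -
      from prime_over_transcendental[OF A Q tr p(1,2)]
      obtain P1 where P1: "prime_in (adjoin A g) P1" "Q \<inter> adjoin A g \<subseteq> P1" "P1 \<inter> A = p"
        "\<And>h. coeffs_in A h \<Longrightarrow> poly h g \<in> P1 \<Longrightarrow> coeffs_in p h" by blast
      have "a1 \<notin> P1" using P1(4)[OF h(2)] h(1) p(3) by (auto simp: coeffs_in_def)
      from lift[OF P1(1,2) this] obtain P where P: "prime_in (ring_gen (A \<union> G)) P"
        "Q \<inter> ring_gen (A \<union> G) \<subseteq> P" "P \<inter> adjoin A g = P1" unfolding gen by auto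
      then have "P \<inter> A = p" using P1(3) adjoin_incl(1)[OF A, of g] by auto
      then show ?thesis using P by blast
    qed
    moreover have "coeff h i \<in> A - Q" using i h by (auto simp: coeffs_in_def)
    ultimately show ?thesis by blast
  qed
qed

text \<open>Roots can be counted modulo \<open>Q\<close> because differences of distinct naturals
  are units: once a linear factor is split off, the quotient still takes values in \<open>Q\<close>
  at the other roots.\<close>

lemma coeffs_in_if_infinitely_many_roots:
  fixes Q :: "'a::comm_ring_1 set"
  assumes Q: "ideal_in UNIV Q" and R: "is_subring R"
    and units: "\<And>n::nat. n > 0 \<Longrightarrow> of_nat n dvd (1::'a)"
    and inf: "infinite {c::nat. poly f (of_nat c) \<in> Q}"
  shows "coeffs_in Q f"
  using inf
proof (induction "degree f" arbitrary: f rule: less_induct)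
  case less
  note QD = ideal_inD[OF Q is_subring_UNIV]
  obtain c where c: "poly f (of_nat c) \<in> Q" using less.prems by (metis (mono_tags) mem_Collect_eq not_finite_existsD)
  define g where "g = synthetic_div f (of_nat c)"
  have f: "f = [:poly f (of_nat c):] + [:- of_nat c, 1:] * g"
    using synthetic_div_correct'[of "of_nat c" f] by (simp add: g_def algebra_simps)
  show ?case
  proof (cases "degree f = 0")
    case True
    then obtain a where "f = [:a:]" by (auto elim: degree_eq_zeroE)
    then show ?thesis using c QD by (auto intro: coeffs_in_const)
  next
    case False
    have *: "poly g (of_nat c') \<in> Q" if c': "poly f (of_nat c') \<in> Q" "c' \<noteq> c" for c'
    proof -
      have "poly f (of_nat c') = poly f (of_nat c) + (of_nat c' - of_nat c) * poly g (of_nat c')"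
        by (subst f) (simp add: algebra_simps)
      then have "(of_nat c' - of_nat c) * poly g (of_nat c') = poly f (of_nat c') - poly f (of_nat c)" by simp
      then have m: "(of_nat c' - of_nat c) * poly g (of_nat c') \<in> Q" using c c' QD by auto
      have "(of_nat c' - of_nat c :: 'a) dvd 1"
      proof (cases "c < c'")
        case True
        then show ?thesis using units[of "c' - c"] by (simp add: of_nat_diff)
      next
        case False
        then have "of_nat (c - c') dvd (1::'a)" using c'(2) by (intro units) auto
        moreover have "of_nat (c - c') = - (of_nat c' - of_nat c :: 'a)" using False by (simp add: of_nat_diff)
        ultimately show ?thesis using minus_dvd_iff by metis
      qed
      then obtain u :: 'a where "1 = (of_nat c' - of_nat c) * u" unfolding dvd_def by blast
      then have e: "u * ((of_nat c' - of_nat c) * poly g (of_nat c')) = poly g (of_nat c')"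
        by (metis mult.assoc mult.commute mult.right_neutral)
      have "u * ((of_nat c' - of_nat c) * poly g (of_nat c')) \<in> Q" using m QD(4) by blast
      then show ?thesis by (simp only: e)
    qed
    have "{c'. poly f (of_nat c') \<in> Q} \<subseteq> insert c {c'. poly g (of_nat c') \<in> Q}" using * by auto
    then have "infinite {c'::nat. poly g (of_nat c') \<in> Q}" using less.prems finite_subset by blast
    moreover have "degree g < degree f" using False by (simp add: g_def degree_synthetic_div)
    ultimately have g: "coeffs_in Q g" using less.hyps by blast
    have "coeffs_in Q ([:poly f (of_nat c):] + [:- of_nat c, 1:] * g)"
    proof (rule coeffs_in_ideal(1)[OF Q is_subring_UNIV])
      show "coeffs_in Q [:poly f (of_nat c):]" using c QD by (intro coeffs_in_const) auto
      show "coeffs_in Q ([:- of_nat c, 1:] * g)"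
        by (rule coeffs_in_ideal(3)[OF Q is_subring_UNIV g]) (simp add: coeffs_in_def)
    qed
    then show ?thesis using f by simp
  qed
qed

text \<open>\<open>P\<close> contains \<open>Q\<close> and \<open>t - c\<close>, while nothing
  changes in \<open>R\<close>. The element of \<open>adjoin R t\<close> to be avoided for lifting is
  a polynomial in \<open>t\<close> with some coefficient outside \<open>Q\<close>, so some natural
  number \<open>c\<close> is not a root of it modulo \<open>Q\<close>.\<close>

lemma prime_cutting_transcendental:
  fixes Q :: "'a::comm_ring_1 set"
  assumes S: "finite S" "ring_gen (R \<union> S) = UNIV" and R: "is_subring R" and Q: "prime_in UNIV Q"
    and units: "\<And>n::nat. n > 0 \<Longrightarrow> of_nat n dvd (1::'a)"
    and tr: "\<And>f. coeffs_in R f \<Longrightarrow> poly f t \<in> Q \<Longrightarrow> coeffs_in Q f"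
  shows "\<exists>P. prime_in UNIV P \<and> Q \<subset> P \<and> P \<inter> R = Q \<inter> R"
proof -
  note RD = is_subringD[OF R] and QI = prime_inD(1)[OF Q]
  note QD = ideal_inD[OF QI is_subring_UNIV]
  let ?A = "adjoin R t"
  have A: "is_subring ?A" by (rule adjoin_subring[OF R])
  obtain a where a: "a \<in> ?A - Q" and lift: "\<And>p. prime_in ?A p \<Longrightarrow> Q \<inter> ?A \<subseteq> p \<Longrightarrow> a \<notin> p \<Longrightarrow>
      \<exists>P. prime_in (ring_gen (?A \<union> S)) P \<and> Q \<inter> ring_gen (?A \<union> S) \<subseteq> P \<and> P \<inter> ?A = p"
    using generic_lying_over[OF S(1) A Q] by blast
  have gen: "ring_gen (?A \<union> S) = UNIV"
    using ring_gen_mono[of "R \<union> S" "?A \<union> S"] adjoin_incl(1)[OF R, of t] S(2) by auto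
  obtain h where h: "a = poly h t" "coeffs_in R h" using a by (auto simp: adjoin_def)
  have "\<not> coeffs_in Q h" using a poly_in_ideal[OF QI is_subring_UNIV, of h t] h by auto
  then have "finite {c::nat. poly h (of_nat c) \<in> Q}"
    using coeffs_in_if_infinitely_many_roots[OF QI R units] by blast
  then obtain c :: nat where c: "poly h (of_nat c) \<notin> Q"
    using infinite_UNIV_nat by (metis (mono_tags, lifting) UNIV_I finite_subset mem_Collect_eq subsetI)
  \<comment> \<open>The kernel of the substitution of \<open>c\<close> for \<open>t\<close>, taken
    modulo \<open>Q\<close>; it is well defined because \<open>t\<close> is transcendental modulo
    \<open>Q\<close>.\<close>
  let ?p = "{poly f t |f. coeffs_in R f \<and> poly f (of_nat c) \<in> Q}"
  have uniq: "poly g (of_nat c) \<in> Q" if g: "coeffs_in R g" "poly g t \<in> ?p" for g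
  proof -
    obtain f where f: "poly g t = poly f t" "coeffs_in R f" "poly f (of_nat c) \<in> Q" using g(2) by blast
    then have "coeffs_in Q (g - f)" using tr coeffs_in_ring(2)[OF R g(1) f(2)] QD(2) by simp
    then have "poly (g - f) (of_nat c) \<in> Q" using poly_in_ideal[OF QI is_subring_UNIV] by blast
    then have "poly (g - f) (of_nat c) + poly f (of_nat c) \<in> Q" using f(3) QD by blast
    then show ?thesis by simp
  qed
  have QA: "poly f t \<in> ?p" if "coeffs_in R f" "poly f t \<in> Q" for f
    using tr[OF that] that(1) poly_in_ideal[OF QI is_subring_UNIV, of f "of_nat c"] by auto
  have const: "r \<in> R \<Longrightarrow> coeffs_in R [:r:]" for r using RD by (intro coeffs_in_const) auto
  have p1: "prime_in ?A ?p" unfolding prime_in_def ideal_in_def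
  proof (intro conjI ballI impI)
    show "?p \<subseteq> ?A" unfolding adjoin_def by auto
    show "0 \<in> ?p" using QA[of 0] RD(2) QD(2) by simp
    show "1 \<notin> ?p"
    proof
      assume "1 \<in> ?p"
      then have "poly [:1:] t \<in> ?p" by simp
      from uniq[OF const[OF RD(1)] this] show False using prime_inD(2)[OF Q] by simp
    qed
    fix x y
    { assume "x \<in> ?p" "y \<in> ?p"
      then obtain f g where "x = poly f t" "y = poly g t" "coeffs_in R f" "coeffs_in R g"
        "poly f (of_nat c) \<in> Q" "poly g (of_nat c) \<in> Q" by auto
      then show "x + y \<in> ?p" using coeffs_in_ring(1)[OF R, of f g] QD(3)
        by (auto intro!: exI[of _ "f + g"]) }
    { assume "x \<in> ?A" "y \<in> ?p"
      then obtain f g where "x = poly f t" "y = poly g t" "coeffs_in R f" "coeffs_in R g"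
        "poly g (of_nat c) \<in> Q" by (auto simp: adjoin_def)
      then show "x * y \<in> ?p" using coeffs_in_ring(3)[OF R, of f g] QD(4)
        by (auto intro!: exI[of _ "f * g"]) }
    { assume "x \<in> ?A" "y \<in> ?A" "x * y \<in> ?p"
      then obtain f g where fg: "x = poly f t" "y = poly g t" "coeffs_in R f" "coeffs_in R g"
        by (auto simp: adjoin_def)
      then have "poly (f * g) (of_nat c) \<in> Q"
        using \<open>x * y \<in> ?p\<close> by (intro uniq coeffs_in_ring[OF R]) auto
      then have "poly f (of_nat c) \<in> Q \<or> poly g (of_nat c) \<in> Q" using prime_inD(3)[OF Q] by auto
      then show "x \<in> ?p \<or> y \<in> ?p" using fg by auto }
  qed
  have p2: "Q \<inter> ?A \<subseteq> ?p" using QA unfolding adjoin_def by blast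
  have p3: "a \<notin> ?p"
  proof
    assume "a \<in> ?p"
    then have "poly h t \<in> ?p" by (simp only: h(1))
    from uniq[OF h(2) this] c show False by simp
  qed
  from lift[OF p1 p2 p3]
  obtain P where P: "prime_in UNIV P" "Q \<subseteq> P" "P \<inter> ?A = ?p"
    unfolding gen by auto
  have lin: "coeffs_in R [:- of_nat c, 1:]" using R
    by (auto simp: coeffs_in_def coeff_pCons is_subringD is_subring_of_nat split: nat.splits)
  have "P \<inter> R = Q \<inter> R"
  proof
    show "P \<inter> R \<subseteq> Q \<inter> R"
    proof
      fix r assume r: "r \<in> P \<inter> R"
      then have "r \<in> P \<inter> ?A" using adjoin_incl(1)[OF R] by auto
      then have "poly [:r:] t \<in> ?p" using P(3) by simp
      from uniq[OF const this] show "r \<in> Q \<inter> R" using r by auto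
    qed
  qed (use P in auto)
  moreover have "t - of_nat c \<in> P"
  proof -
    have "poly [:- of_nat c, 1:] t \<in> ?p" using lin QD(2) by fastforce
    then show ?thesis using P(3) by auto
  qed
  moreover have "t - of_nat c \<notin> Q"
  proof
    assume "t - of_nat c \<in> Q"
    then have "coeffs_in Q [:- of_nat c, 1:]" using tr[OF lin] by simp
    then have "coeff [:- of_nat c, 1:] 1 \<in> Q" unfolding coeffs_in_def by blast
    then show False using prime_inD(2)[OF Q] by simp
  qed
  ultimately show ?thesis using P by blast
qed

text \<open>The elements are cut in the reverse order of adjunction. A cut does not change the
  intersection with the ring below, so the elements adjoined earlier stay transcendental modulo the
  new prime and can be cut next.\<close>

lemma prime_chain_of_transcendentals:
  fixes f g x :: "'a::idom"
  assumes S: "finite S" "ring_gen (K \<union> S) = UNIV" and K: "is_subring K"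
    and units: "\<And>n::nat. n > 0 \<Longrightarrow> of_nat n dvd (1::'a)"
    and f: "\<And>p. coeffs_in K p \<Longrightarrow> poly p f = 0 \<Longrightarrow> p = 0"
    and g: "\<And>p. coeffs_in (adjoin K f) p \<Longrightarrow> poly p g = 0 \<Longrightarrow> p = 0"
    and x: "\<And>p. coeffs_in (adjoin (adjoin K f) g) p \<Longrightarrow> poly p x = 0 \<Longrightarrow> p = 0"
  shows "\<exists>P1 P2 P3 :: 'a set. prime_in UNIV P1 \<and> prime_in UNIV P2 \<and> prime_in UNIV P3 \<and>
    {0} \<subset> P1 \<and> P1 \<subset> P2 \<and> P2 \<subset> P3"
proof -
  let ?R1 = "adjoin K f" let ?R2 = "adjoin ?R1 g"
  have R1: "is_subring ?R1" and R2: "is_subring ?R2" using K by (auto intro: adjoin_subring)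
  have sub1: "K \<subseteq> ?R1" and sub2: "?R1 \<subseteq> ?R2" using adjoin_incl(1) K R1 by auto
  have S1: "ring_gen (?R1 \<union> S) = UNIV" and S2: "ring_gen (?R2 \<union> S) = UNIV"
    using ring_gen_mono[of "K \<union> S" "?R1 \<union> S"] ring_gen_mono[of "K \<union> S" "?R2 \<union> S"] sub1 sub2 S(2) by auto
  have Q: "prime_in UNIV {0::'a}" by (auto simp: prime_in_def ideal_in_def)
  have zero: "coeffs_in I (0::'a poly)" if "prime_in UNIV I" for I
    using that by (auto simp: prime_in_def ideal_in_def)
  have tr1: "coeffs_in {0} p" if "coeffs_in ?R2 p" "poly p x \<in> {0}" for p
    using x[OF that(1)] that(2) zero[OF Q] by simp
  obtain P1 where P1: "prime_in UNIV P1" "{0} \<subset> P1" "P1 \<inter> ?R2 = {0} \<inter> ?R2"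
    using prime_cutting_transcendental[where t = x, OF S(1) S2 R2 Q units tr1] by blast
  have tr2: "coeffs_in P1 p" if p: "coeffs_in ?R1 p" "poly p g \<in> P1" for p
  proof -
    have "poly p g \<in> P1 \<inter> ?R2" using p by (auto simp: adjoin_def)
    then have "poly p g = 0" unfolding P1(3) by simp
    with g[OF p(1)] zero[OF P1(1)] show ?thesis by simp
  qed
  obtain P2 where P2: "prime_in UNIV P2" "P1 \<subset> P2" "P2 \<inter> ?R1 = P1 \<inter> ?R1"
    using prime_cutting_transcendental[where t = g, OF S(1) S1 R1 P1(1) units tr2] by blast
  have tr3: "coeffs_in P2 p" if p: "coeffs_in K p" "poly p f \<in> P2" for p
  proof -
    have R: "poly p f \<in> ?R1" using p(1) by (auto simp: adjoin_def)
    then have "poly p f \<in> P2 \<inter> ?R1" using p by auto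
    then have "poly p f \<in> P1 \<inter> ?R2" unfolding P2(3) using R sub2 by auto
    then have "poly p f = 0" unfolding P1(3) by simp
    with f[OF p(1)] zero[OF P2(1)] show ?thesis by simp
  qed
  obtain P3 where P3: "prime_in UNIV P3" "P2 \<subset> P3"
    using prime_cutting_transcendental[where t = f, OF S K P2(1) units tr3] by blast
  have "prime_in UNIV P1 \<and> prime_in UNIV P2 \<and> prime_in UNIV P3 \<and> {0} \<subset> P1 \<and> P1 \<subset> P2 \<and> P2 \<subset> P3"
    by (intro conjI P1(1,2) P2(1,2) P3)
  then show ?thesis by (intro exI)
qed

section \<open>Chains of primes and the Krull dimension\<close>

lemma alg_of_simps [simp]:
  "carrier (alg_of s) = UNIV" "monoid.mult (alg_of s) = (*)" "monoid.one (alg_of s) = 1" "ring.zero (alg_of s) = 0"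
  "ring.add (alg_of s) = (+)" "module.smult (alg_of s) = s"
  by (simp_all add: alg_of_def)

lemma cring_alg_of: "cring (alg_of s)"
proof (intro cringI abelian_groupI comm_monoidI)
  fix x :: 'a assume "x \<in> carrier (alg_of s)"
  show "\<exists>y\<in>carrier (alg_of s). y \<oplus>\<^bsub>alg_of s\<^esub> x = \<zero>\<^bsub>alg_of s\<^esub>"
    by (auto intro: exI[of _ "- x"])
qed (simp_all add: algebra_simps)

lemma a_inv_alg_of [simp]: "\<ominus>\<^bsub>alg_of s\<^esub> x = - x"
proof -
  interpret cring "alg_of s" by (rule cring_alg_of)
  show ?thesis by (rule minus_equality) auto
qed

lemma primeideal_alg_of:
  assumes "prime_in UNIV P"
  shows "primeideal P (alg_of s)"
proof -
  note I = prime_inD(1)[OF assms] note D = ideal_inD[OF I is_subring_UNIV]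
  interpret cring "alg_of s" by (rule cring_alg_of)
  show ?thesis
  proof (intro primeidealI idealI subgroup.intro)
    show "ring (alg_of s)" by (rule ring_axioms)
    show "cring (alg_of s)" by (rule cring_axioms)
    show "inv\<^bsub>add_monoid (alg_of s)\<^esub> x \<in> P" if "x \<in> P" for x
      using D(6)[OF that] by (simp only: a_inv_alg_of[of s x, unfolded a_inv_def])
    show "carrier (alg_of s) \<noteq> P" using prime_inD(2)[OF assms] by auto
    show "a \<in> P \<or> b \<in> P" if "a \<otimes>\<^bsub>alg_of s\<^esub> b \<in> P" for a b
      using prime_inD(3)[OF assms] that by auto
  qed (use D in auto)
qed

lemma krull_dim_ge_3:
  assumes "prime_in UNIV P1" "prime_in UNIV P2" "prime_in UNIV P3"
    "{0::'b::idom} \<subset> P1" "P1 \<subset> P2" "P2 \<subset> P3"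
  shows "krull_dim (alg_of (s :: 'k \<Rightarrow> 'b \<Rightarrow> 'b)) \<ge> 3"
proof -
  define P where "P i = (if i = 0 then {0} else if i = 1 then P1 else if i = 2 then P2 else P3)" for i :: nat
  have "prime_in UNIV {0::'b}" by (auto simp: prime_in_def ideal_in_def)
  then have "\<forall>i\<le>3. primeideal (P i) (alg_of s)" using assms primeideal_alg_of by (auto simp: P_def)
  moreover have "\<forall>i<3. P i \<subset> P (Suc i)"
  proof (intro allI impI)
    fix i :: nat assume "i < 3"
    then have "i = 0 \<or> i = 1 \<or> i = 2" by auto
    then show "P i \<subset> P (Suc i)" using assms(4-6) by (elim disjE) (simp_all add: P_def)
  qed
  ultimately have "enat 3 \<le> krull_dim (alg_of s)"
    unfolding krull_dim_def by (intro SUP_upper) auto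
  then show ?thesis by (simp add: numeral_eq_enat)
qed

section \<open>Fundamental pairs\<close>

locale sl2_algebra =
  fixes scale :: "'k::field_char_0 \<Rightarrow> 'b::idom \<Rightarrow> 'b" and D U :: "'b \<Rightarrow> 'b"
  assumes alg: "algebra class_ring (alg_of scale)" and pair: "fundamental_pair scale D U"
begin

text \<open>Scalars are moved into the ring, so that scaling becomes multiplication and polynomial
  relations over \<open>k\<close> can be written with coefficients in
  \<open>range iota\<close>.\<close>

definition iota :: "'k \<Rightarrow> 'b" where "iota c = scale c 1"

definition E :: "'b \<Rightarrow> 'b" where "E = bracket D U"

abbreviation wt :: "int \<Rightarrow> 'b set" where "wt \<equiv> weight_space D U"

lemma scale_eq: "scale c x = iota c * x"
  using algebra.smult_assoc2[OF alg, of c 1 x] by (simp add: iota_def class_ring_def)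

lemma iota_add: "iota (c + d) = iota c + iota d"
  using module.smult_l_distr[OF algebra.axioms(1)[OF alg], of c d 1] by (simp add: iota_def class_ring_def)

lemma iota_mult: "iota (c * d) = iota c * iota d"
  using module.smult_assoc1[OF algebra.axioms(1)[OF alg], of c d 1]
  by (simp add: class_ring_def scale_eq)

lemma iota_1 [simp]: "iota 1 = 1"
  using module.smult_one[OF algebra.axioms(1)[OF alg], of 1] by (simp add: iota_def class_ring_def)

lemma iota_0: "iota 0 = 0"
  using iota_add[of 0 0] by (metis add.right_neutral add_left_cancel)

sublocale iota: comm_ring_hom iota
  by unfold_locales (auto simp: iota_add iota_mult iota_0)

lemma iota_eq_0 [simp]: "iota c = 0 \<longleftrightarrow> c = 0"
proof
  assume "iota c = 0"
  show "c = 0"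
  proof (rule ccontr)
    assume "c \<noteq> 0"
    then have "iota c * iota (1 / c) = 1" by (simp flip: iota_mult)
    with \<open>iota c = 0\<close> show False by simp
  qed
qed simp

lemma iota_inverse: "c \<noteq> 0 \<Longrightarrow> iota c * iota (1 / c) = 1" "c \<noteq> 0 \<Longrightarrow> iota (1 / c) * iota c = 1"
  by (simp_all flip: iota_mult)

lemma of_int_eq_iota: "(of_int n :: 'b) = iota (of_int n)"
  by (simp add: iota.hom_of_int)

lemma of_nat_eq_iota: "(of_nat n :: 'b) = iota (of_nat n)"
  by (simp add: iota.hom_of_nat)

lemma of_int_eq_0 [simp]: "(of_int n :: 'b) = 0 \<longleftrightarrow> n = 0"
  by (simp add: of_int_eq_iota)

lemma of_nat_eq_0 [simp]: "(of_nat n :: 'b) = 0 \<longleftrightarrow> n = 0"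
  by (simp add: of_nat_eq_iota)

lemma D_simps: "D (x + y) = D x + D y" "D (x * y) = D x * y + x * D y" "D (iota c * x) = iota c * D x"
  using pair by (auto simp: fundamental_pair_def LND_def scale_eq)

lemma U_simps: "U (x + y) = U x + U y" "U (x * y) = U x * y + x * U y" "U (iota c * x) = iota c * U x"
  using pair by (auto simp: fundamental_pair_def LND_def scale_eq)

lemma D_nil: "\<exists>n. (D ^^ n) x = 0" and U_nil: "\<exists>n. (U ^^ n) x = 0"
  using pair by (auto simp: fundamental_pair_def LND_def)

text \<open>Stated for an arbitrary derivation so as to serve \<open>D\<close>, \<open>U\<close> and
  also \<open>E\<close>, which is a commutator of derivations and hence a derivation.\<close>

lemma derivation_facts:
  assumes "\<And>x y. F (x + y) = F x + (F y :: 'b)" "\<And>x y. F (x * y) = F x * y + x * F y"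
  shows "F 0 = 0" "F 1 = 0" "F (- x) = - F x" "F (x - y) = F x - F y"
    "F (sum g I) = (\<Sum>i\<in>I. F (g i))"
proof -
  show z: "F 0 = 0" using assms(1)[of 0 0] by (metis add.right_neutral add_left_cancel)
  show "F 1 = 0" using assms(2)[of 1 1] by (metis add.right_neutral add_left_cancel mult_1_left mult_1_right)
  show m: "F (- x) = - F x" for x using assms(1)[of x "- x"] z by (simp add: eq_neg_iff_add_eq_0 add.commute)
  show "F (x - y) = F x - F y" using assms(1)[of x "- y"] m[of y] by simp
  show "F (sum g I) = (\<Sum>i\<in>I. F (g i))"
    by (induction I rule: infinite_finite_induct) (simp_all add: z assms(1))
qed

lemmas D_more [simp] = derivation_facts[of D, OF D_simps(1,2)]
lemmas U_more [simp] = derivation_facts[of U, OF U_simps(1,2)]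

lemma D_iota [simp]: "D (iota c) = 0" and U_iota [simp]: "U (iota c) = 0"
  using D_simps(3)[of c 1] U_simps(3)[of c 1] by simp_all

lemma D_const_mult: "D (of_int n * x) = of_int n * D x" "U (of_int n * x) = of_int n * U x"
  by (simp_all add: of_int_eq_iota D_simps U_simps)

lemma D_pow_const_mult: "(D ^^ n) (iota c * x) = iota c * (D ^^ n) x"
  by (induction n) (simp_all add: D_simps)

lemma D_pow_diff: "(D ^^ n) (x - y) = (D ^^ n) x - (D ^^ n) y"
  by (induction n) simp_all

lemma DU: "D (U x) = U (D x) + E x"
  by (simp add: E_def bracket_def)

lemma E_simps: "E (x + y) = E x + E y" "E (x * y) = E x * y + x * E y" "E (iota c * x) = iota c * E x"
  by (simp_all add: E_def bracket_def D_simps U_simps algebra_simps)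

lemmas E_more [simp] = derivation_facts[of E, OF E_simps(1,2)]

lemma E_D: "E (D x) = D (E x) + 2 * D x" and E_U: "E (U x) = U (E x) - 2 * U x"
proof -
  have "D (E x) - E (D x) = - 2 * D x" "U (E x) - E (U x) = 2 * U x"
    using pair unfolding fundamental_pair_def E_def by (auto simp: bracket_def)
  then show "E (D x) = D (E x) + 2 * D x" "E (U x) = U (E x) - 2 * U x"
    by (simp_all add: algebra_simps)
qed

section \<open>Weight spaces and highest weight vectors\<close>

lemma wt_iff: "x \<in> wt d \<longleftrightarrow> E x = of_int d * x"
  by (simp add: weight_space_def E_def)

lemma wt_0 [simp]: "0 \<in> wt d"
  by (simp add: wt_iff)

lemma wt_add: "x \<in> wt d \<Longrightarrow> y \<in> wt d \<Longrightarrow> x + y \<in> wt d"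
  and wt_diff: "x \<in> wt d \<Longrightarrow> y \<in> wt d \<Longrightarrow> x - y \<in> wt d"
  and wt_mult: "x \<in> wt d \<Longrightarrow> y \<in> wt e \<Longrightarrow> x * y \<in> wt (d + e)"
  by (simp_all add: wt_iff E_simps(1,2) algebra_simps)

lemma wt_const: "x \<in> wt d \<Longrightarrow> iota c * x \<in> wt d"
  by (simp add: wt_iff E_simps(3) mult.left_commute)

lemma wt_iota [simp]: "iota c \<in> wt 0"
  by (simp add: wt_iff E_def bracket_def)

lemma wt_power: "x \<in> wt d \<Longrightarrow> x ^ n \<in> wt (int n * d)"
proof (induction n)
  case 0
  then show ?case using wt_iota[of 1] by simp
next
  case (Suc n)
  then show ?case using wt_mult[of x d "x ^ n" "int n * d"] by (simp add: algebra_simps)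
qed

lemma wt_D: "x \<in> wt d \<Longrightarrow> D x \<in> wt (d + 2)" and wt_U: "x \<in> wt d \<Longrightarrow> U x \<in> wt (d - 2)"
  by (simp_all add: wt_iff E_D E_U D_const_mult distrib_right left_diff_distrib)

lemma wt_D_pow: "x \<in> wt d \<Longrightarrow> (D ^^ n) x \<in> wt (d + 2 * int n)"
proof (induction n)
  case (Suc n)
  then show ?case using wt_D[of "(D ^^ n) x" "d + 2 * int n"] by (simp add: algebra_simps)
qed simp

lemma wt_U_pow: "x \<in> wt d \<Longrightarrow> (U ^^ n) x \<in> wt (d - 2 * int n)"
proof (induction n)
  case (Suc n)
  then show ?case using wt_U[of "(U ^^ n) x" "d - 2 * int n"] by (simp add: algebra_simps)
qed simp

text \<open>Eigenvectors of \<open>E\<close> for distinct eigenvalues: applying \<open>E - e\<close>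
  removes the term of weight \<open>e\<close> and multiplies the others by nonzero integers
  \<open>d - e\<close>, which can be cancelled in characteristic zero.\<close>

lemma wt_independent:
  "finite I \<Longrightarrow> (\<And>d. d \<in> I \<Longrightarrow> g d \<in> wt d) \<Longrightarrow> sum g I = 0 \<Longrightarrow> d \<in> I \<Longrightarrow> g d = 0"
proof (induction I arbitrary: g d rule: finite_induct)
  case (insert e I)
  have "0 = E (sum g (insert e I)) - of_int e * sum g (insert e I)"
    using insert.prems(2) by simp
  also have "\<dots> = (\<Sum>d\<in>insert e I. of_int d * g d) - (\<Sum>d\<in>insert e I. of_int e * g d)"
    using insert.prems(1) by (simp only: E_more(5) sum_distrib_left wt_iff cong: sum.cong)
  also have "\<dots> = (\<Sum>d\<in>I. of_int (d - e) * g d)"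
    using insert.hyps by (simp add: sum_subtractf algebra_simps)
  finally have s: "(\<Sum>d\<in>I. of_int (d - e) * g d) = 0" by simp
  have z: "g d = 0" if "d \<in> I" for d
  proof -
    have "of_int (d - e) * g d = 0"
    proof (rule insert.IH[OF _ s that])
      show "of_int (d' - e) * g d' \<in> wt d'" if "d' \<in> I" for d'
        using insert.prems(1) that unfolding of_int_eq_iota by (intro wt_const) auto
    qed
    then show ?thesis using insert.hyps(2) that by (auto simp del: of_int_diff)
  qed
  moreover have "g e = 0" using insert.prems(2) insert.hyps z by (simp add: sum.neutral)
  ultimately show ?case using insert.prems(3) by auto
qed simp

lemma wt_decomp: "\<exists>I g. finite I \<and> (\<forall>d\<in>I. g d \<in> wt d) \<and> x = sum g I"
  using pair unfolding fundamental_pair_def by blast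

text \<open>The coefficient is the sum of the weights \<open>d\<close>, \<open>d - 2\<close>, ...,
  \<open>d - 2 * j\<close> that are picked up when \<open>D\<close> is moved past the copies of
  \<open>U\<close>.\<close>

lemma D_U_pow:
  assumes "v \<in> wt d" "D v = 0"
  shows "D ((U ^^ Suc j) v) = of_int ((int j + 1) * (d - int j)) * (U ^^ j) v"
proof (induction j)
  case 0
  then show ?case using assms by (simp add: DU wt_iff)
next
  case (Suc j)
  let ?y = "(U ^^ Suc j) v"
  have "E ?y = of_int (d - 2 * int (Suc j)) * ?y"
    using wt_U_pow[OF assms(1), of "Suc j"] by (simp only: wt_iff)
  moreover have "U (D ?y) = of_int ((int j + 1) * (d - int j)) * ?y"
    unfolding Suc.IH by (simp only: D_const_mult funpow.simps o_apply)
  ultimately have "D (U ?y) = of_int ((int j + 1) * (d - int j)) * ?y + of_int (d - 2 * int (Suc j)) * ?y"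
    unfolding DU by simp
  also have "\<dots> = of_int ((int j + 1) * (d - int j) + (d - 2 * int (Suc j))) * ?y"
    by (simp only: of_int_add distrib_right)
  also have "(int j + 1) * (d - int j) + (d - 2 * int (Suc j)) = (int (Suc j) + 1) * (d - int (Suc j))"
    by (simp add: algebra_simps)
  finally show ?case by (simp only: funpow.simps o_apply)
qed

text \<open>If \<open>U ^^ n\<close> is the last power that does not kill \<open>v\<close>, applying
  \<open>D\<close> to the vanishing next one gives \<open>(n + 1) * (d - n) = 0\<close>, so the
  weight is \<open>n\<close>. Local nilpotency of \<open>U\<close> takes the place of finite
  dimension.\<close>

lemma highest_weight:
  assumes v: "v \<in> wt d" "D v = 0" "v \<noteq> 0"
  shows "d \<ge> 0" "(U ^^ Suc (nat d)) v = 0" "(U ^^ nat d) v \<noteq> 0"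
proof -
  obtain N where N: "(U ^^ N) v = 0" "\<And>m. m < N \<Longrightarrow> (U ^^ m) v \<noteq> 0"
    using U_nil[of v] exists_least_iff[of "\<lambda>n. (U ^^ n) v = 0"] by blast
  obtain n where n: "N = Suc n" using N(1) v(3) by (cases N) auto
  have "0 = D ((U ^^ Suc n) v)" using N(1) n by simp
  then have "of_int ((int n + 1) * (d - int n)) * (U ^^ n) v = 0"
    unfolding D_U_pow[OF v(1,2)] by simp
  then have "(int n + 1) * (d - int n) = 0" using N(2)[of n] n by (simp del: of_int_mult)
  then have "d = int n" by auto
  then show "d \<ge> 0" "(U ^^ Suc (nat d)) v = 0" "(U ^^ nat d) v \<noteq> 0" using N n by auto
qed

text \<open>The scalar is the product of the factors \<open>(j + 1) * (d - j)\<close> for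
  \<open>j < i\<close>, all nonzero as long as \<open>i \<le> d\<close>.\<close>

lemma D_pow_U_pow:
  assumes "v \<in> wt d" "D v = 0" "int i \<le> d"
  shows "\<exists>c. c \<noteq> 0 \<and> (D ^^ i) ((U ^^ i) v) = iota c * v"
  using assms(3)
proof (induction i)
  case 0
  then show ?case by (auto intro: exI[of _ 1])
next
  case (Suc i)
  then obtain c where c: "c \<noteq> 0" "(D ^^ i) ((U ^^ i) v) = iota c * v" by auto
  have "(D ^^ Suc i) ((U ^^ Suc i) v) = (D ^^ i) (D ((U ^^ Suc i) v))" by (simp only: funpow_Suc_right o_apply)
  also have "\<dots> = iota (of_int ((int i + 1) * (d - int i)) * c) * v"
    unfolding D_U_pow[OF assms(1,2)] of_int_eq_iota D_pow_const_mult c(2) iota_mult by (simp add: mult.assoc)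
  finally show ?case using c(1) Suc.prems
    by (intro exI[of _ "of_int ((int i + 1) * (d - int i)) * c"]) (auto simp flip: of_int_eq_0_iff simp del: of_int_mult)
qed

text \<open>Induction on the order of nilpotency of \<open>D\<close> at \<open>x\<close>. The vector
  \<open>a = (D ^^ n) x\<close> is killed by \<open>D\<close>, and \<open>(U ^^ n) a\<close> has the
  weight of \<open>x\<close>; subtracting a multiple of it from \<open>x\<close> makes
  \<open>D ^^ n\<close> vanish. The scalar can be inverted because the weight
  \<open>e + 2 * n\<close> of \<open>a\<close> is at least \<open>n\<close> for nonnegative
  \<open>e\<close>.\<close>

lemma nonneg_weights_in_submodule:
  assumes C: "\<And>x y. x \<in> C \<Longrightarrow> y \<in> C \<Longrightarrow> x + y \<in> C" "\<And>c x. x \<in> C \<Longrightarrow> iota c * x \<in> C"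
    "\<And>x. x \<in> C \<Longrightarrow> U x \<in> C" "\<And>d v. v \<in> wt d \<Longrightarrow> D v = 0 \<Longrightarrow> v \<in> C"
    and x: "x \<in> wt e" "e \<ge> 0"
  shows "x \<in> C"
proof -
  have CU: "y \<in> C \<Longrightarrow> (U ^^ n) y \<in> C" for y n by (induction n) (auto intro: C)
  obtain n where "(D ^^ n) x = 0" using D_nil by blast
  then show ?thesis using x(1)
  proof (induction n arbitrary: x)
    case 0
    then show ?case using C(4)[of 0 0] by simp
  next
    case (Suc n)
    define a where "a = (D ^^ n) x"
    have a: "D a = 0" "a \<in> wt (e + 2 * int n)" using Suc.prems wt_D_pow by (auto simp: a_def)
    obtain c where c: "c \<noteq> 0" "(D ^^ n) ((U ^^ n) a) = iota c * a"
      using D_pow_U_pow[OF a(2,1), of n] x(2) by auto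
    define y where "y = iota (1 / c) * (U ^^ n) a"
    have yC: "y \<in> C" unfolding y_def using CU C(2) C(4)[OF a(2,1)] by blast
    have "y \<in> wt e" unfolding y_def using wt_const wt_U_pow[OF a(2), of n] by simp
    moreover have "(D ^^ n) (x - y) = 0"
      unfolding D_pow_diff y_def D_pow_const_mult c(2) mult.assoc[symmetric]
      by (simp add: iota_inverse[OF c(1)] a_def)
    ultimately have "x - y \<in> C" using Suc.IH Suc.prems(2) wt_diff by blast
    from C(1)[OF this yC] show ?case by simp
  qed
qed

lemma weight_space_swap: "weight_space U D d = wt (- d)"
proof -
  have "- a - b = - (a - - b)" for a b :: 'b by simp
  then have "(- a - b = 0) = (a - - b = (0::'b))" for a b by (simp only: neg_equal_0_iff_equal)
  moreover have "bracket U D x = - E x" for x by (simp add: E_def bracket_def)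
  ultimately show ?thesis by (simp add: weight_space_def flip: E_def)
qed

text \<open>Exchanging \<open>D\<close> and \<open>U\<close> negates all weights, so that everything
  proved for highest weight vectors applies to lowest weight vectors.\<close>

lemma swap: "sl2_algebra scale U D"
proof (rule sl2_algebra.intro)
  show "algebra class_ring (alg_of scale)" by (rule alg)
  have br: "bracket U D x = - E x" for x by (simp add: E_def bracket_def)
  show "fundamental_pair scale U D" unfolding fundamental_pair_def
  proof (intro conjI allI)
    show "U \<in> LND scale" "D \<in> LND scale" using pair by (auto simp: fundamental_pair_def)
    show "bracket U (bracket U D) x = - 2 * U x" "bracket D (bracket U D) x = 2 * D x" for x
      by (simp_all add: bracket_def[of U "bracket U D"] bracket_def[of D "bracket U D"] br E_D E_U)
    show "\<exists>I g. finite I \<and> (\<forall>d\<in>I. g d \<in> weight_space U D d) \<and> x = sum g I" for x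
    proof -
      obtain I g where I: "finite I" "\<forall>d\<in>I. g d \<in> wt d" "x = sum g I" using wt_decomp by blast
      have "x = (\<Sum>d\<in>uminus ` I. g (- d))" unfolding I(3) by (simp add: sum.reindex)
      then show ?thesis using I weight_space_swap
        by (intro exI[of _ "uminus ` I"] exI[of _ "\<lambda>d. g (- d)"]) auto
    qed
  qed
qed

text \<open>Vectors of nonnegative weight are obtained from highest weight vectors, those of nonpositive weight
  from lowest weight vectors, and a lowest weight vector lies in the module generated by a highest one.\<close>

lemma submodule_eq_UNIV:
  assumes C: "\<And>x y. x \<in> C \<Longrightarrow> y \<in> C \<Longrightarrow> x + y \<in> C" "\<And>c x. x \<in> C \<Longrightarrow> iota c * x \<in> C"
    "\<And>x. x \<in> C \<Longrightarrow> D x \<in> C" "\<And>x. x \<in> C \<Longrightarrow> U x \<in> C" "\<And>d v. v \<in> wt d \<Longrightarrow> D v = 0 \<Longrightarrow> v \<in> C"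
  shows "x \<in> C"
proof -
  interpret op: sl2_algebra scale U D by (rule swap)
  note op_wt = weight_space_swap
  have CU: "y \<in> C \<Longrightarrow> (U ^^ n) y \<in> C" for y n by (induction n) (auto intro: C)
  have low: "v \<in> C" if v: "v \<in> op.wt d" "U v = 0" for d v
  proof (cases "v = 0")
    case True
    then show ?thesis using C(5)[of 0 0] by simp
  next
    case False
    note hw = op.highest_weight[OF v False]
    have "(D ^^ nat d) v \<in> wt (- d + 2 * int (nat d))"
      using v(1) unfolding op_wt by (rule wt_D_pow)
    moreover have "D ((D ^^ nat d) v) = 0" using hw(2) by simp
    ultimately have "(D ^^ nat d) v \<in> C" by (rule C(5))
    then have 1: "(U ^^ nat d) ((D ^^ nat d) v) \<in> C" by (rule CU)
    obtain c where c: "c \<noteq> 0" "(U ^^ nat d) ((D ^^ nat d) v) = iota c * v"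
      using op.D_pow_U_pow[OF v, of "nat d"] hw(1) by auto
    have "iota (1 / c) * (iota c * v) \<in> C" using C(2) 1 c(2) by metis
    then show ?thesis by (simp only: mult.assoc[symmetric] iota_inverse[OF c(1)] mult_1_left)
  qed
  have wtC: "y \<in> C" if "y \<in> wt d" for y d
  proof (cases "d \<ge> 0")
    case True
    show ?thesis by (rule nonneg_weights_in_submodule[of C, OF C(1,2,4,5) that True])
  next
    case False
    show ?thesis
    proof (rule op.nonneg_weights_in_submodule[where C = C and x = y and e = "- d"])
      show "y \<in> op.wt (- d)" using that by (simp add: op_wt)
      show "- d \<ge> 0" using False by linarith
      show "v \<in> C" if "v \<in> op.wt d" "U v = 0" for d v using that by (rule low)
    qed (fact C)+
  qed
  obtain I g where I: "finite I" "\<forall>d\<in>I. g d \<in> wt d" "x = sum g I" using wt_decomp by blast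
  have "sum g I \<in> C" using I(1,2)
  proof (induction I rule: finite_induct)
    case empty
    then show ?case using C(5)[of 0 0] by simp
  next
    case (insert d I)
    then have "g d \<in> C" "sum g I \<in> C" using wtC[of "g d" d] by auto
    then show ?case using insert.hyps C(1) by simp
  qed
  then show ?thesis using I(3) by simp
qed

end

section \<open>Evaluation of polynomials in two variables\<close>

definition eval2 :: "('k::comm_ring_1 \<Rightarrow> 'r::comm_ring_1) \<Rightarrow> 'r \<Rightarrow> 'r \<Rightarrow> 'k poly poly \<Rightarrow> 'r" where
  "eval2 h a b q = poly (map_poly (\<lambda>p. poly (map_poly h p) a) q) b"

lemma comm_ring_hom_eval:
  assumes "comm_ring_hom h"
  shows "comm_ring_hom (\<lambda>p. poly (map_poly h p) a)"
proof -
  interpret comm_ring_hom h by (rule assms)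
  interpret h: map_poly_comm_ring_hom h ..
  show ?thesis by unfold_locales (simp_all add: hom_distribs)
qed

lemma comm_ring_hom_eval2: "comm_ring_hom h \<Longrightarrow> comm_ring_hom (eval2 h a b)"
  unfolding eval2_def[abs_def] by (intro comm_ring_hom_eval)

lemma eval2_simps:
  assumes "comm_ring_hom h"
  shows "eval2 h a b [:[:c:]:] = h c" "eval2 h a b [:[:0, 1:]:] = a" "eval2 h a b [:0, 1:] = b"
proof -
  interpret comm_ring_hom h by (rule assms)
  interpret e: comm_ring_hom "\<lambda>p. poly (map_poly h p) a" by (rule comm_ring_hom_eval[OF assms])
  show "eval2 h a b [:[:c:]:] = h c" "eval2 h a b [:[:0, 1:]:] = a" "eval2 h a b [:0, 1:] = b"
    by (simp_all add: eval2_def map_poly_pCons_hom e.map_poly_pCons_hom)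
qed

context sl2_algebra
begin

section \<open>Algebraic independence from slices and from weights\<close>

lemma D_poly: "(\<And>i. D (coeff p i) = 0) \<Longrightarrow> D (poly p x) = poly (pderiv p) x * D x"
proof (induction p)
  case (pCons a p)
  have "D (coeff p i) = 0" for i using pCons.prems[of "Suc i"] by simp
  moreover have "D a = 0" using pCons.prems[of 0] by simp
  ultimately show ?case using pCons.IH by (simp add: D_simps pderiv_pCons algebra_simps)
qed simp

lemma D_pow_w: "D w = 0 \<Longrightarrow> D (w ^ n) = 0"
  by (induction n) (simp_all add: D_simps)

text \<open>\<open>D x\<close> is a nonzero element of the kernel, so applying \<open>D\<close> to a
  relation over the kernel gives a relation for its derivative, of smaller degree. In characteristic
  zero the derivative of a nonconstant polynomial is nonzero.\<close>

lemma slice_transcendental: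
  assumes "D x \<noteq> 0" "D (D x) = 0" "\<And>i. D (coeff p i) = 0" "poly p x = 0"
  shows "p = 0"
  using assms(3,4)
proof (induction "degree p" arbitrary: p rule: less_induct)
  case less
  show ?case
  proof (cases "degree p = 0")
    case True
    then show ?thesis using less.prems(2) by (auto elim: degree_eq_zeroE)
  next
    case False
    have "poly (pderiv p) x * D x = 0"
      using D_poly[of p x] less.prems by simp
    then have "poly (pderiv p) x = 0" using assms(1) by simp
    moreover have "D (coeff (pderiv p) i) = 0" for i
      using less.prems(1)[of "Suc i"] D_const_mult(1)[of "int (Suc i)" "coeff p (Suc i)"]
      by (simp add: coeff_pderiv)
    moreover have "degree (pderiv p) < degree p"
    proof -
      have "degree (pderiv p) \<le> degree p - 1"
        by (rule degree_le) (auto simp: coeff_pderiv coeff_eq_0)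
      then show ?thesis using False by simp
    qed
    ultimately have "pderiv p = 0" using less.hyps by blast
    then have "of_nat (Suc (degree p - 1)) * coeff p (Suc (degree p - 1)) = 0"
      by (metis coeff_pderiv coeff_0)
    then have "lead_coeff p = 0" using False of_nat_eq_0 by (simp del: of_nat_Suc)
    then show ?thesis by simp
  qed
qed

lemma subring_ker_D: "is_subring {v. D v = 0}"
  by (auto simp: is_subring_def D_simps)

lemma subring_wt_0: "is_subring (wt 0)"
  using wt_mult[of _ 0 _ 0] wt_diff[of 0 0] wt_iota[of 1] by (auto simp: is_subring_def wt_add)

lemma subring_K: "is_subring (range iota)"
  unfolding is_subring_def
proof (intro conjI ballI)
  show "1 \<in> range iota" using iota_1 by (metis rangeI)
  fix x y assume "x \<in> range iota" "y \<in> range iota"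
  then obtain c d where "x = iota c" "y = iota d" by auto
  then show "x + y \<in> range iota" "x * y \<in> range iota" "- x \<in> range iota"
    by (metis iota_add rangeI, metis iota_mult rangeI, metis iota.hom_uminus rangeI)
qed

lemma adjoin_subset: "is_subring R \<Longrightarrow> A \<subseteq> R \<Longrightarrow> t \<in> R \<Longrightarrow> adjoin A t \<subseteq> R"
  unfolding adjoin_def by (force simp: coeffs_in_def intro!: is_subring_poly)

lemma wt_independent_family:
  assumes "finite I" "inj_on e I" "\<And>i. i \<in> I \<Longrightarrow> g i \<in> wt (e i)" "sum g I = 0" "i \<in> I"
  shows "g i = 0"
proof -
  let ?g = "\<lambda>d. g (the_inv_into I e d)"
  have inv: "the_inv_into I e (e i) = i" if "i \<in> I" for i using assms(2) that by (rule the_inv_into_f_f)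
  have "sum ?g (e ` I) = sum g I" using inv by (simp add: sum.reindex[OF assms(2)])
  then have "?g (e i) = 0"
    by (intro wt_independent[of "e ` I" ?g]) (use assms inv in auto)
  then show ?thesis using inv assms(5) by simp
qed

text \<open>As the coefficients have weight 0, the terms of \<open>poly p w\<close> have the
  distinct weights \<open>i * d\<close>, so each of them vanishes.\<close>

lemma weight_transcendental:
  assumes w: "w \<in> wt d" "w \<noteq> 0" "d \<noteq> 0" and p: "\<And>i. coeff p i \<in> wt 0" "poly p w = 0"
  shows "p = 0"
proof (rule poly_eqI)
  fix i
  have "coeff p i * w ^ i = 0" if "i \<le> degree p"
  proof (rule wt_independent_family[of "{..degree p}" "\<lambda>i. int i * d" "\<lambda>i. coeff p i * w ^ i"])
    show "inj_on (\<lambda>i. int i * d) {..degree p}" using w(3) by (auto intro!: inj_onI)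
    show "(\<Sum>i\<le>degree p. coeff p i * w ^ i) = 0" using p(2) by (simp add: poly_altdef)
    show "coeff p i * w ^ i \<in> wt (int i * d)" for i
      using wt_mult[OF p(1) wt_power[OF w(1)], of i i] by simp
  qed (use that in auto)
  then show "coeff p i = coeff 0 i" using w(2) by (cases "i \<le> degree p") (auto simp: coeff_eq_0)
qed

end

section \<open>Highest weight vectors on a normal surface with trivial units\<close>

locale sl2_surface = sl2_algebra +
  assumes affine: "affine_domain (alg_of scale)" and normal: "normal_domain TYPE('b)"
    and dim: "krull_dim (alg_of scale) = 2"
    and units: "Units (alg_of scale) = {scale c 1 |c. c \<noteq> 0}" and nontriv: "nontrivial_pair D U"
begin

lemma unit_in_K:
  assumes "f * u = 1"
  shows "f \<in> range iota"
proof -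
  have "f \<in> Units (alg_of scale)" using assms by (auto simp: Units_def mult.commute)
  then show ?thesis unfolding units by (auto simp: iota_def)
qed

text \<open>After powers of a nonzero \<open>f\<close> are cancelled, a relation has nonzero
  constant term and exhibits \<open>f\<close> as a unit; the only units are scalars.\<close>

lemma algebraic_in_K:
  assumes "p \<noteq> 0" "coeffs_in (range iota) p" "poly p f = 0"
  shows "f \<in> range iota"
  using assms
proof (induction p)
  case (pCons a p)
  have p: "coeffs_in (range iota) p" "a \<in> range iota" using pCons.prems by (auto simp: coeffs_in_pCons)
  show ?case
  proof (cases "a = 0")
    case True
    then have "f = 0 \<or> poly p f = 0" using pCons.prems(3) by simp
    then show ?thesis
    proof
      assume "f = 0" then show ?thesis using iota_0 by (metis rangeI)
    next
      assume "poly p f = 0"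
      then show ?thesis using pCons.IH p(1) pCons.prems(1) True by auto
    qed
  next
    case False
    obtain c where c: "a = iota c" using p(2) by auto
    then have "c \<noteq> 0" using False by auto
    have "f * poly p f = - iota c" using pCons.prems(3) c by (simp add: eq_neg_iff_add_eq_0 add.commute)
    then have "f * (- poly p f * iota (1 / c)) = iota c * iota (1 / c)"
      by (metis mult.assoc mult_minus_left mult_minus_right minus_minus)
    then show ?thesis using unit_in_K iota_inverse(1)[OF \<open>c \<noteq> 0\<close>] by metis
  qed
qed simp

text \<open>The slice \<open>x\<close> is transcendental over the kernel of \<open>D\<close>, hence
  over \<open>k[f, g]\<close>; the three elements would give a chain of primes longer than dimension
  2 permits.\<close>

lemma no_three_transcendentals:
  assumes f: "D f = 0" "\<And>p. coeffs_in (range iota) p \<Longrightarrow> poly p f = 0 \<Longrightarrow> p = 0"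
    and g: "D g = 0" "\<And>p. coeffs_in (adjoin (range iota) f) p \<Longrightarrow> poly p g = 0 \<Longrightarrow> p = 0"
    and x: "D x \<noteq> 0" "D (D x) = 0"
  shows False
proof -
  obtain S where S: "finite S" "generated_subalgebra (alg_of scale) S = UNIV"
    using affine by (auto simp: affine_domain_def)
  have sc: "scalars (alg_of scale) = range iota" by (auto simp: scalars_def iota_def)
  have "v \<in> ring_gen (range iota \<union> S)" if "v \<in> generate_ring (alg_of scale) (range iota \<union> S)" for v
    using that
  proof induction
    case (incl h)
    then show ?case using ring_gen_incl[of "range iota \<union> S"] by blast
  qed (auto intro: is_subringD[OF ring_gen_subring])
  then have gen: "ring_gen (range iota \<union> S) = UNIV"
    using S(2) by (auto simp: generated_subalgebra_def sc)
  have un: "of_nat n dvd (1::'b)" if "n > 0" for n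
  proof -
    have "of_nat n * iota (1 / of_nat n) = (1::'b)"
      unfolding of_nat_eq_iota using that by (intro iota_inverse) auto
    then show ?thesis by (metis dvd_triv_left)
  qed
  have "adjoin (adjoin (range iota) f) g \<subseteq> {v. D v = 0}"
    using f(1) g(1) subring_ker_D by (intro adjoin_subset) auto
  then have "D (coeff p i) = 0" if "coeffs_in (adjoin (adjoin (range iota) f) g) p" for p i
    using that by (auto simp: coeffs_in_def)
  then have x': "p = 0" if "coeffs_in (adjoin (adjoin (range iota) f) g) p" "poly p x = 0" for p
    using slice_transcendental[OF x _ that(2)] that(1) by blast
  have "\<exists>P1 P2 P3 :: 'b set. prime_in UNIV P1 \<and> prime_in UNIV P2 \<and> prime_in UNIV P3 \<and>
    {0} \<subset> P1 \<and> P1 \<subset> P2 \<and> P2 \<subset> P3"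
  proof (rule prime_chain_of_transcendentals[OF S(1) gen subring_K])
    show "of_nat n dvd (1::'b)" if "n > 0" for n using that by (rule un)
    show "p = 0" if "coeffs_in (range iota) p" "poly p f = 0" for p using that by (rule f(2))
    show "p = 0" if "coeffs_in (adjoin (range iota) f) p" "poly p g = 0" for p using that by (rule g(2))
    show "p = 0" if "coeffs_in (adjoin (adjoin (range iota) f) g) p" "poly p x = 0" for p
      using that by (rule x')
  qed
  then obtain P1 P2 P3 :: "'b set" where "prime_in UNIV P1" "prime_in UNIV P2" "prime_in UNIV P3"
    "{0} \<subset> P1" "P1 \<subset> P2" "P2 \<subset> P3" by (elim exE conjE)
  from krull_dim_ge_3[OF this, of scale] show False unfolding dim by (simp add: numeral_eq_enat)
qed

lemma K_coeffs_wt_0: "coeffs_in (range iota) p \<Longrightarrow> coeff p i \<in> wt 0"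
  by (auto simp: coeffs_in_def) (metis rangeE wt_iota)

text \<open>If all highest weight vectors had weight 0, they would be killed by \<open>U\<close> as
  well, and the submodule generated by them, which is everything, would be killed by both
  operators.\<close>

lemma exists_positive_weight: "\<exists>d v. d > 0 \<and> v \<in> wt d \<and> D v = 0 \<and> v \<noteq> 0"
proof (rule ccontr)
  assume no: "\<not> ?thesis"
  let ?C = "{v \<in> wt 0. D v = 0}"
  have U0: "U v = 0" if "v \<in> ?C" for v
    using highest_weight(2)[of v 0] that by (cases "v = 0") auto
  have all: "x \<in> ?C" for x
  proof (rule submodule_eq_UNIV)
    show "v \<in> ?C" if v: "v \<in> wt d" "D v = 0" for d v
    proof (cases "v = 0")
      case False
      then have "d = 0" using highest_weight(1)[OF v] no v by (metis less_le)
      then show ?thesis using v by simp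
    qed simp
  qed (use U0 in \<open>auto simp: wt_add wt_const D_simps\<close>)
  then have "D = (\<lambda>_. 0)" "U = (\<lambda>_. 0)" using U0 by auto
  then show False using nontriv by (simp add: nontrivial_pair_def)
qed

lemma slice_of_highest_weight:
  assumes "v \<in> wt d" "D v = 0" "v \<noteq> 0" "d \<noteq> 0"
  shows "D (U v) \<noteq> 0" "D (D (U v)) = 0"
proof -
  have "D (U v) = of_int d * v" using assms by (simp add: DU wt_iff)
  then show "D (U v) \<noteq> 0" "D (D (U v)) = 0" using assms by (simp_all add: D_const_mult)
qed

lemma invariants: "f \<in> wt 0 \<Longrightarrow> D f = 0 \<Longrightarrow> f \<in> range iota"
proof (rule ccontr)
  assume f: "f \<in> wt 0" "D f = 0" "f \<notin> range iota"
  obtain d w where w: "d > 0" "w \<in> wt d" "D w = 0" "w \<noteq> 0" using exists_positive_weight by blast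
  have "adjoin (range iota) f \<subseteq> wt 0" using f by (intro adjoin_subset subring_wt_0) auto
  then have "coeff p i \<in> wt 0" if "coeffs_in (adjoin (range iota) f) p" for p i
    using that by (auto simp: coeffs_in_def)
  \<comment> \<open>Weights make \<open>w\<close> transcendental over the subring
    \<open>k[f]\<close> of weight 0. The third element is the slice \<open>U w\<close>, because
    \<open>D (U w)\<close> is a nonzero multiple of \<open>w\<close>.\<close>
  then have "p = 0" if "coeffs_in (adjoin (range iota) f) p" "poly p w = 0" for p
    using weight_transcendental[OF w(2,4) _ _ that(2)] w(1) that(1) by auto
  moreover have "p = 0" if "coeffs_in (range iota) p" "poly p f = 0" for p
    using algebraic_in_K that f(3) by blast
  ultimately show False
    using no_three_transcendentals[OF f(2) _ w(3) _ slice_of_highest_weight[OF w(2-4)]] w(1) by blast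
qed

lemma integral_over_normal:
  assumes "lead_coeff q = 1" "poly (map_poly to_fract q) (r :: 'b fract) = 0"
  obtains h where "r = to_fract h"
  using normal assms unfolding normal_domain_def by blast

lemma eval_to_fract: "poly (map_poly to_fract q) (to_fract h) = to_fract (poly q h)"
  by (simp add: to_fract_hom.poly_map_poly)

text \<open>A nontrivial relation between \<open>f\<close> and \<open>g\<close> may be taken homogeneous, so it is an integral equation
  for \<open>g / f\<close> over the field of scalars.\<close>

lemma highest_weight_unique:
  assumes f: "f \<in> wt n" "D f = 0" "f \<noteq> 0" and g: "g \<in> wt n" "D g = 0" and n: "n > 0"
  shows "\<exists>c. g = iota c * f"
proof -
  have ftr: "p = 0" if "coeffs_in (range iota) p" "poly p f = 0" for p
    using weight_transcendental[OF f(1,3), of p] n K_coeffs_wt_0 that by auto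
  have "\<not> (\<forall>p. coeffs_in (adjoin (range iota) f) p \<longrightarrow> poly p g = 0 \<longrightarrow> p = 0)"
    using no_three_transcendentals[OF f(2) ftr g(2) _ slice_of_highest_weight[OF f]] n by blast
  then obtain p where p: "coeffs_in (adjoin (range iota) f) p" "poly p g = 0" "p \<noteq> 0"
    by blast
  then have "\<forall>j. \<exists>P. coeff p j = poly P f \<and> coeffs_in (range iota) P"
    by (auto simp: coeffs_in_def adjoin_def)
  then obtain P where P: "\<And>j. coeff p j = poly (P j) f" "\<And>j. coeffs_in (range iota) (P j)"
    by metis
  define M where "M = (MAX j\<in>{..degree p}. degree (P j))"
  have M: "degree (P j) \<le> M" if "j \<le> degree p" for j
    unfolding M_def using that by (intro Max_ge) auto
  define S where "S = {..degree p} \<times> {..M}"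
  define h where "h = (\<lambda>(j, i). coeff (P j) i * f ^ i * g ^ j)"
  have "0 = (\<Sum>j\<le>degree p. coeff p j * g ^ j)" using p(2) by (simp add: poly_altdef)
  also have "\<dots> = (\<Sum>j\<le>degree p. \<Sum>i\<le>M. h (j, i))"
  proof (rule sum.cong[OF refl])
    fix j assume "j \<in> {..degree p}"
    then have "poly (P j) f = (\<Sum>i\<le>M. coeff (P j) i * f ^ i)"
      unfolding poly_altdef using M by (intro sum.mono_neutral_left) (auto simp: coeff_eq_0)
    then show "coeff p j * g ^ j = (\<Sum>i\<le>M. h (j, i))" by (simp add: P(1) h_def sum_distrib_right)
  qed
  also have "\<dots> = sum h S" by (simp add: S_def sum.cartesian_product)
  \<comment> \<open>The monomials \<open>f ^ i * g ^ j\<close> are grouped by total degree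
    \<open>N\<close>; a group has weight \<open>N * n\<close>, so the groups vanish
    separately.\<close>
  also have "\<dots> = (\<Sum>N\<in>(\<lambda>(j, i). j + i) ` S. sum h {x. x \<in> S \<and> (\<lambda>(j, i). j + i) x = N})"
    by (rule sum.image_gen) (simp add: S_def)
  finally have hsum: "(\<Sum>N\<in>(\<lambda>(j, i). j + i) ` S. sum h {x. x \<in> S \<and> (\<lambda>(j, i). j + i) x = N}) = 0" by simp
  have hwt: "h x \<in> wt (int N * n)" if "(\<lambda>(j, i). j + i) x = N" for x N
  proof -
    obtain j i where x: "x = (j, i)" by (cases x)
    have "coeff (P j) i * f ^ i * g ^ j \<in> wt (0 + int i * n + int j * n)"
      using P(2) f(1) g(1) by (intro wt_mult wt_power K_coeffs_wt_0) auto
    then show ?thesis using that x by (auto simp: h_def algebra_simps)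
  qed
  have comp: "sum h {x. x \<in> S \<and> (\<lambda>(j, i). j + i) x = N} = 0" if N: "N \<in> (\<lambda>(j, i). j + i) ` S" for N
  proof (rule wt_independent_family[OF _ _ _ hsum N, of "\<lambda>N. int N * n"])
    show "finite ((\<lambda>(j, i). j + i) ` S)" by (simp add: S_def)
    show "inj_on (\<lambda>N. int N * n) ((\<lambda>(j, i). j + i) ` S)" using n by (auto intro!: inj_onI)
    show "sum h {x \<in> S. (\<lambda>(j, i). j + i) x = N} \<in> wt (int N * n)" for N
    proof -
      have *: "sum h T \<in> wt (int N * n)" if "T \<subseteq> {x. (\<lambda>(j, i). j + i) x = N}" for T
        using that by (induction T rule: infinite_finite_induct) (auto intro!: wt_add hwt)
      show ?thesis by (rule *) auto
    qed
  qed
  obtain j0 where j0: "coeff p j0 \<noteq> 0" "j0 \<le> degree p" using p(3) leading_coeff_0_iff by blast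
  then have "P j0 \<noteq> 0" using P(1) by auto
  then obtain i0 where i0: "coeff (P j0) i0 \<noteq> 0" "i0 \<le> degree (P j0)" using leading_coeff_0_iff by blast
  \<comment> \<open>The degree of a monomial with nonzero coefficient, so that the homogeneous
    relation extracted here is nontrivial.\<close>
  define N where "N = j0 + i0"
  have S0: "(j0, i0) \<in> S" using j0 i0 M[of j0] by (auto simp: S_def)
  define c where "c j = (if j \<le> degree p \<and> j \<le> N \<and> N - j \<le> M then coeff (P j) (N - j) else 0)" for j
  have "0 = sum h {x. x \<in> S \<and> (\<lambda>(j, i). j + i) x = N}" using comp S0 unfolding N_def by force
  also have "\<dots> = (\<Sum>j\<in>{j. j \<le> degree p \<and> j \<le> N \<and> N - j \<le> M}. c j * f ^ (N - j) * g ^ j)"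
    by (rule sum.reindex_bij_witness[of _ "\<lambda>j. (j, N - j)" fst]) (auto simp: S_def h_def c_def)
  also have "\<dots> = (\<Sum>j\<le>N. c j * f ^ (N - j) * g ^ j)"
    by (rule sum.mono_neutral_left) (auto simp: c_def)
  finally have rel: "(\<Sum>j\<le>N. c j * f ^ (N - j) * g ^ j) = 0" by simp
  define q where "q = (\<Sum>j\<le>N. monom (c j) j)"
  have cq: "coeff q j = (if j \<le> N then c j else 0)" for j by (simp add: q_def coeff_sum)
  have cK: "c j \<in> range iota" for j
    using P(2)[of j] is_subringD(2)[OF subring_K] by (auto simp: c_def coeffs_in_def)
  have qK: "coeffs_in (range iota) q" using cK is_subringD(2)[OF subring_K] by (auto simp: coeffs_in_def cq)
  have "coeff q j0 \<noteq> 0" using i0 S0 j0 by (auto simp: cq c_def N_def S_def)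
  then have q0: "q \<noteq> 0" by auto
  \<comment> \<open>A root of the homogeneous relation divided by \<open>f ^ N\<close>. Once
    normality has put this fraction into the ring, \<open>algebraic_in_K\<close> makes it a
    scalar.\<close>
  define r where "r = to_fract g / to_fract f"
  have "degree (map_poly to_fract q) \<le> N" by (rule degree_le) (simp add: coeff_map_poly cq)
  then have "poly (map_poly to_fract q) r = (\<Sum>j\<le>N. coeff (map_poly to_fract q) j * r ^ j)"
    unfolding poly_altdef by (intro sum.mono_neutral_left) (auto simp: coeff_eq_0)
  also have "\<dots> = (\<Sum>j\<le>N. to_fract (c j) * r ^ j)" by (simp add: coeff_map_poly cq)
  also have "\<dots> * to_fract f ^ N = (\<Sum>j\<le>N. to_fract (c j * f ^ (N - j) * g ^ j))"
    unfolding sum_distrib_right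
  proof (rule sum.cong[OF refl])
    fix j assume "j \<in> {..N}"
    then have "to_fract f ^ N = to_fract f ^ (N - j) * to_fract f ^ j" by (simp flip: power_add)
    then show "to_fract (c j) * r ^ j * to_fract f ^ N = to_fract (c j * f ^ (N - j) * g ^ j)"
      using f(3) by (simp add: r_def power_divide hom_distribs)
  qed
  also have "\<dots> = to_fract (\<Sum>j\<le>N. c j * f ^ (N - j) * g ^ j)" by (simp only: hom_distribs)
  finally have "poly (map_poly to_fract q) r * to_fract f ^ N = 0" using rel by simp
  then have qr: "poly (map_poly to_fract q) r = 0" using f(3) by simp
  obtain l where l: "lead_coeff q = iota l" using qK by (auto simp: coeffs_in_def)
  then have "l \<noteq> 0" using q0 by auto
  let ?q = "Polynomial.smult (iota (1 / l)) q"
  have "lead_coeff ?q = 1" using l \<open>l \<noteq> 0\<close> iota_inverse(2)[OF \<open>l \<noteq> 0\<close>] by simp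
  moreover have "poly (map_poly to_fract ?q) r = 0" using qr by (simp add: hom_distribs)
  ultimately obtain h where h: "r = to_fract h" by (rule integral_over_normal)
  have "poly q h = 0" using qr unfolding h eval_to_fract by simp
  then obtain c where c: "h = iota c" using algebraic_in_K[OF q0 qK] by blast
  have "to_fract g = to_fract (iota c * f)" using h f(3) by (simp add: r_def c field_simps hom_distribs)
  then have "g = iota c * f" by (simp only: to_fract_eq_iff)
  then show ?thesis by blast
qed

text \<open>Let \<open>d\<close> be the least positive highest weight and
  \<open>n = d * q + r\<close> a division with remainder. Then \<open>(v / w ^ q) ^ d\<close> is a
  scalar times \<open>w ^ r\<close>, because both sides come from vectors of equal weight. So
  \<open>v / w ^ q\<close> is integral over the ring, hence in it by normality, and it is a highest
  weight vector of weight \<open>r < d\<close>; minimality forces \<open>r = 0\<close>.\<close>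

lemma highest_weight_vectors_are_powers:
  "\<exists>d w. d > 0 \<and> w \<in> wt (int d) \<and> D w = 0 \<and> w \<noteq> 0 \<and>
    (\<forall>n v. v \<in> wt n \<longrightarrow> D v = 0 \<longrightarrow> v \<noteq> 0 \<longrightarrow> (\<exists>q c. n = int d * int q \<and> v = iota c * w ^ q))"
proof -
  let ?P = "\<lambda>d. d > 0 \<and> (\<exists>w. w \<in> wt (int d) \<and> D w = 0 \<and> w \<noteq> 0)"
  obtain d0 v0 where d0: "d0 > 0" "v0 \<in> wt d0" "D v0 = 0" "v0 \<noteq> 0" using exists_positive_weight by blast
  then have "?P (nat d0)" by auto
  then obtain d where d: "?P d" and dmin: "\<And>d'. d' < d \<Longrightarrow> \<not> ?P d'"
    using exists_least_iff[of ?P] by blast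
  then obtain w where w: "d > 0" "w \<in> wt (int d)" "D w = 0" "w \<noteq> 0" by auto
  have "\<exists>q c. n = int d * int q \<and> v = iota c * w ^ q" if v: "v \<in> wt n" "D v = 0" "v \<noteq> 0" for n v
  proof -
    have n0: "n \<ge> 0" using highest_weight(1)[OF v] .
    define q r where "q = nat n div d" and "r = nat n mod d"
    have n: "n = int d * int q + int r"
    proof -
      have "n = int (nat n)" using n0 by simp
      also have "nat n = d * q + r" by (simp add: q_def r_def)
      finally show ?thesis by simp
    qed
    have "r < d" using w(1) by (simp add: r_def)
    have "r = 0"
    proof (rule ccontr)
      assume "r \<noteq> 0"
      then have npos: "n > 0" using n w(1) by (simp add: add_nonneg_pos)
      define m where "m = nat n"
      have m: "n = int m" "m > 0" using npos by (auto simp: m_def)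
      have mqr: "m = q * d + r" by (simp add: q_def r_def m_def)
      have "v ^ d \<in> wt (int d * n)" "w ^ m \<in> wt (int d * n)"
        using wt_power[OF v(1), of d] wt_power[OF w(2), of m] m by (simp_all add: mult.commute)
      moreover have "D (v ^ d) = 0" "D (w ^ m) = 0" "w ^ m \<noteq> 0" using v w D_pow_w by auto
      ultimately obtain c where c: "v ^ d = iota c * w ^ m"
        using highest_weight_unique[of "w ^ m" "int d * n" "v ^ d"] w(1) npos by auto
      define s where "s = to_fract v / to_fract w ^ q"
      have "s ^ d * to_fract w ^ (q * d) = to_fract (v ^ d)"
        using w(4) by (simp add: s_def power_divide power_mult hom_distribs)
      also have "\<dots> = to_fract (iota c * w ^ r) * to_fract w ^ (q * d)"
        unfolding c mqr power_add by (simp add: hom_distribs)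
      finally have sd: "s ^ d = to_fract (iota c * w ^ r)" using w(4) by simp
      let ?f = "monom 1 d - [:iota c * w ^ r:]"
      have cf: "coeff ?f i = (if i = d then 1 else 0) - (if i = 0 then iota c * w ^ r else 0)" for i
        by (simp add: coeff_pCons split: nat.splits)
      have cd: "coeff ?f d = 1" using w(1) by (simp only: cf) simp
      have "coeff ?f i = 0" if "i > d" for i using that by (simp only: cf) simp
      then have "degree ?f \<le> d" by (intro degree_le) blast
      moreover have "d \<le> degree ?f" by (rule le_degree) (simp only: cd, simp)
      ultimately have "lead_coeff ?f = 1" using cd by (metis antisym)
      moreover have "poly (map_poly to_fract ?f) s = 0"
      proof -
        have "poly (map_poly to_fract (monom 1 d - [:a:])) s = s ^ d - to_fract a" for a
          by (simp add: hom_distribs map_poly_monom poly_monom)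
        then show ?thesis using sd by (simp only: diff_self)
      qed
      ultimately obtain h where h: "s = to_fract h" by (rule integral_over_normal)
      have "to_fract (h * w ^ q) = to_fract v" using w(4) h by (simp add: s_def hom_distribs field_simps)
      then have hv: "h * w ^ q = v" by (simp only: to_fract_eq_iff)
      have "w ^ q \<noteq> 0" using w(4) by simp
      have "D h * w ^ q = 0" using v(2) D_pow_w[OF w(3), of q] unfolding hv[symmetric] by (simp add: D_simps)
      then have Dh: "D h = 0" using w(4) by simp
      have "E (w ^ q) = of_int (int q * int d) * w ^ q" using wt_power[OF w(2), of q] by (simp only: wt_iff)
      moreover have "E (h * w ^ q) = of_int n * (h * w ^ q)" using v(1) unfolding hv by (simp only: wt_iff)
      ultimately have "E h * w ^ q + h * (of_int (int q * int d) * w ^ q) = of_int n * (h * w ^ q)"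
        by (simp only: E_simps)
      then have "E h * w ^ q = of_int (n - int q * int d) * (h * w ^ q)"
        by (simp add: algebra_simps)
      then have "(E h - of_int (n - int q * int d) * h) * w ^ q = 0" by (simp only: left_diff_distrib mult.assoc) simp
      then have "E h = of_int (n - int q * int d) * h" using \<open>w ^ q \<noteq> 0\<close> by (metis mult_eq_0_iff eq_iff_diff_eq_0)
      then have "h \<in> wt (int r)" using n by (simp add: wt_iff mult.commute)
      moreover have "h \<noteq> 0" using hv v(3) by auto
      ultimately show False using dmin[OF \<open>r < d\<close>] Dh \<open>r \<noteq> 0\<close> by auto
    qed
    then have nq: "n = int d * int q" using n by simp
    have wq: "w ^ q \<in> wt n" "D (w ^ q) = 0" "w ^ q \<noteq> 0"
      using wt_power[OF w(2), of q] nq w D_pow_w by (simp_all add: mult.commute)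
    show ?thesis
    proof (cases "n = 0")
      case True
      then have "q = 0" using nq w(1) by simp
      moreover obtain c where "v = iota c" using invariants v True by auto
      ultimately show ?thesis using nq by (intro exI[of _ q] exI[of _ c]) simp
    next
      case False
      then obtain c where "v = iota c * w ^ q" using highest_weight_unique[OF wq v(1,2)] n0 by auto
      then show ?thesis using nq by blast
    qed
  qed
  then show ?thesis using w by blast
qed

end

section \<open>The field k(y, z) as a target of evaluations\<close>

definition cnst2 :: "'k::comm_ring_1 \<Rightarrow> 'k poly poly" where "cnst2 c = [:[:c:]:]"

definition kappa :: "'k::field \<Rightarrow> 'k poly poly fract" where "kappa c = to_fract (cnst2 c)"

lemma comm_ring_hom_cnst2: "comm_ring_hom cnst2"
  by unfold_locales (auto simp: cnst2_def)

lemma comm_ring_hom_kappa: "comm_ring_hom kappa"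
proof -
  interpret comm_ring_hom cnst2 by (rule comm_ring_hom_cnst2)
  show ?thesis by unfold_locales (simp_all add: kappa_def hom_distribs)
qed

lemma eval2_vars:
  assumes "comm_ring_hom h"
  shows "eval2 h a b (cnst2 c) = h c" "eval2 h a b var_y = a" "eval2 h a b var_z = b"
  unfolding cnst2_def var_y_def var_z_def by (rule eval2_simps[OF assms])+

lemma hom_poly_eval:
  assumes "comm_ring_hom h" "comm_ring_hom g"
  shows "h (poly (map_poly g p) a) = poly (map_poly (\<lambda>c. h (g c)) p) (h a)"
proof -
  interpret h: comm_ring_hom h by (rule assms)
  interpret g: comm_ring_hom g by (rule assms)
  interpret hg: comm_ring_hom "\<lambda>c. h (g c)" by unfold_locales (simp_all add: hom_distribs)
  show ?thesis
    by (induction p) (simp_all add: Polynomial.map_poly_pCons h.hom_add h.hom_mult)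
qed

lemma hom_eval2:
  assumes "comm_ring_hom h" "comm_ring_hom g"
  shows "h (eval2 g a b q) = eval2 (\<lambda>c. h (g c)) (h a) (h b) q"
  unfolding eval2_def
  by (subst hom_poly_eval[OF assms(1) comm_ring_hom_eval[OF assms(2)]]) (simp only: hom_poly_eval[OF assms])

lemma eval2_0 [simp]: "eval2 g a b 0 = 0"
  by (simp add: eval2_def)

lemma eval2_pCons: "eval2 g a b (pCons p q) = poly (map_poly g p) a + b * eval2 g a b q"
  by (simp add: eval2_def Polynomial.map_poly_pCons)

lemma poly_map_cnst2: "poly (map_poly cnst2 p) [:Y:] = [:pcompose p (Y :: 'k::comm_ring_1 poly):]"
proof -
  interpret comm_ring_hom "cnst2 :: 'k \<Rightarrow> _" by (rule comm_ring_hom_cnst2)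
  show ?thesis by (induction p) (simp_all add: Polynomial.map_poly_pCons pcompose_pCons, simp add: cnst2_def)
qed

text \<open>The part free of \<open>z\<close> is the innermost polynomial \<open>p\<close> composed
  with \<open>y ^ n\<close>, and composition with a nonconstant polynomial is injective. The rest is
  a multiple of the second monomial, which is cancelled before the induction continues.\<close>

lemma monomials_algebraically_independent:
  assumes "n > 0" "eval2 kappa (to_fract (var_y ^ n)) (to_fract (var_y ^ (n - 1) * var_z)) (q :: 'k::field poly poly) = 0"
  shows "q = 0"
proof -
  let ?Y = "[:0, 1:] :: 'k poly"
  have y: "var_y ^ i = [:?Y ^ i:]" for i by (simp add: var_y_def poly_const_pow)
  have z: "var_y ^ (n - 1) * var_z = [:0, ?Y ^ (n - 1):]" by (simp add: y var_z_def)
  have "to_fract (eval2 cnst2 (var_y ^ n) (var_y ^ (n - 1) * var_z) q) = 0"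
    using assms(2) unfolding kappa_def[abs_def]
    by (simp only: hom_eval2[OF to_fract_hom.comm_ring_hom_axioms comm_ring_hom_cnst2])
  then have "eval2 cnst2 [:?Y ^ n:] [:0, ?Y ^ (n - 1):] q = 0" unfolding z unfolding y by simp
  then show ?thesis
  proof (induction q)
    case (pCons p q)
    have *: "[:pcompose p (?Y ^ n):] + [:0, ?Y ^ (n - 1):] * eval2 cnst2 [:?Y ^ n:] [:0, ?Y ^ (n - 1):] q = 0"
      using pCons.prems by (simp add: eval2_pCons poly_map_cnst2)
    have "coeff ([:pcompose p (?Y ^ n):] + [:0, ?Y ^ (n - 1):] * eval2 cnst2 [:?Y ^ n:] [:0, ?Y ^ (n - 1):] q) 0
        = pcompose p (?Y ^ n)" by (simp add: coeff_mult)
    then have p: "pcompose p (?Y ^ n) = 0" using * by simp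
    moreover have "degree (?Y ^ n) = n" by (simp add: degree_power_eq)
    ultimately have "p = 0" using assms(1) by (metis pcompose_eq_0)
    moreover have "eval2 cnst2 [:?Y ^ n:] [:0, ?Y ^ (n - 1):] q = 0" using * p by simp
    then have "q = 0" using pCons.IH by simp
    ultimately show ?case by simp
  qed simp
qed

context sl2_algebra
begin

section \<open>The normal form in terms of w and x\<close>

lemma derivations_of_numbers [simp]: "D (of_nat n) = 0" "U (of_nat n) = 0" "D (of_int m) = 0" "U (of_int m) = 0"
  by (simp_all only: of_nat_eq_iota of_int_eq_iota D_iota U_iota)

lemma eval_subring: "ring_gen (range iota \<union> {w, x}) \<subseteq> range (eval2 iota w x)"
proof (rule ring_gen_least)
  interpret ev: comm_ring_hom "eval2 iota w x" by (rule comm_ring_hom_eval2[OF iota.comm_ring_hom_axioms])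
  show "is_subring (range (eval2 iota w x))" unfolding is_subring_def
  proof (intro conjI ballI)
    show "1 \<in> range (eval2 iota w x)" by (metis ev.hom_one rangeI)
    fix u v assume "u \<in> range (eval2 iota w x)" "v \<in> range (eval2 iota w x)"
    then show "u + v \<in> range (eval2 iota w x)" "u * v \<in> range (eval2 iota w x)" "- u \<in> range (eval2 iota w x)"
      by (auto simp flip: ev.hom_add ev.hom_mult ev.hom_uminus)
  qed
  show "range iota \<union> {w, x} \<subseteq> range (eval2 iota w x)"
    using eval2_vars[OF iota.comm_ring_hom_axioms, where a = w and b = x] by (auto simp: image_iff) metis+
qed

text \<open>\<open>x\<close> is a slice and therefore transcendental over the kernel of
  \<open>D\<close>, in which \<open>w\<close> is transcendental over \<open>k\<close> by
  weights.\<close>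

lemma eval_injective:
  assumes w: "w \<in> wt d" "D w = 0" "w \<noteq> 0" "d > 0" and x: "D x = w" and q: "eval2 iota w x q = 0"
  shows "q = 0"
proof (rule poly_eqI)
  fix j
  interpret e: comm_ring_hom "\<lambda>p. poly (map_poly iota p) w"
    by (rule comm_ring_hom_eval[OF iota.comm_ring_hom_axioms])
  have D0: "D (poly (map_poly iota p) w) = 0" for p
    using is_subring_poly[OF subring_ker_D, of "map_poly iota p" w] w(2) by (simp add: coeffs_in_def coeff_map_poly)
  have "map_poly (\<lambda>p. poly (map_poly iota p) w) q = 0"
    by (rule slice_transcendental[of x]) (use w x q in \<open>simp_all add: coeff_map_poly D0 eval2_def\<close>)
  then have "coeff (map_poly (\<lambda>p. poly (map_poly iota p) w) q) j = 0" by simp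
  then have "poly (map_poly iota (coeff q j)) w = 0" by (simp add: coeff_map_poly)
  then have "map_poly iota (coeff q j) = 0"
    by (intro weight_transcendental[OF w(1,3)]) (use w(4) in \<open>simp_all add: coeff_map_poly\<close>)
  then have "coeff (map_poly iota (coeff q j)) i = 0" for i by simp
  then show "coeff q j = coeff 0 j" by (intro poly_eqI) (simp add: coeff_map_poly)
qed

end

text \<open>The equations fix both derivations on \<open>k[w, 1/w, x]\<close>. The one for
  \<open>U x\<close> carries a factor \<open>w\<close> because its right hand side need not be
  divisible by \<open>w\<close> in \<open>k[w, x]\<close>.\<close>

locale sl2_normal_form = sl2_surface scale D U
  for scale :: "'k::field_char_0 \<Rightarrow> 'b::idom \<Rightarrow> 'b" and D U :: "'b \<Rightarrow> 'b" +
  fixes d :: nat and w x :: 'b and nu :: 'k and e :: nat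
  assumes d: "d > 0" and w: "w \<in> wt (int d)" "D w = 0" "w \<noteq> 0"
    and x: "D x = w" "U w = of_nat d * x"
    and Ux: "w * U x = of_int (int d - 1) * x\<^sup>2 + iota nu * w ^ e"
    and hw: "\<And>n v. v \<in> wt n \<Longrightarrow> D v = 0 \<Longrightarrow> v \<noteq> 0 \<Longrightarrow> \<exists>q c. v = iota c * w ^ q"

text \<open>The element \<open>w * U x - (d - 1) * x\<^sup>2\<close> is a highest weight vector of weight \<open>2 * d - 4\<close>, hence a multiple of
  a power of \<open>w\<close>; so it vanishes unless \<open>d\<close> divides 4.\<close>

lemma (in sl2_surface) normal_form:
  "\<exists>d w x nu e. sl2_normal_form scale D U d w x nu e \<and> (nu = 0 \<or> d = 2 \<and> e = 0 \<or> d = 4 \<and> e = 1)"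
proof -
  obtain d w where w: "d > 0" "w \<in> wt (int d)" "D w = 0" "w \<noteq> 0"
    and hw: "\<And>n v. v \<in> wt n \<Longrightarrow> D v = 0 \<Longrightarrow> v \<noteq> 0 \<Longrightarrow> \<exists>q c. n = int d * int q \<and> v = iota c * w ^ q"
    using highest_weight_vectors_are_powers by blast
  have inv: "iota (of_nat d) * iota (1 / of_nat d) = 1" using w(1) by (intro iota_inverse) auto
  \<comment> \<open>The scalar makes \<open>D x = w\<close>, since
    \<open>D (U w) = E w = d * w\<close>.\<close>
  define x where "x = iota (1 / of_nat d) * U w"
  have Uw: "U w = of_nat d * x" unfolding x_def of_nat_eq_iota
    by (simp only: mult.assoc[symmetric] inv mult_1_left)
  have "D (U w) = of_nat d * w" using w by (simp add: DU wt_iff)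
  then have Dx: "D x = w" unfolding x_def D_simps(3) of_nat_eq_iota
    by (metis inv mult.assoc mult.commute mult_1_left)
  have wx: "x \<in> wt (int d - 2)" unfolding x_def using wt_U[OF w(2)] by (rule wt_const)
  have "D (U x) = of_nat d * x + of_int (int d - 2) * x" using wx by (simp add: DU Dx Uw wt_iff)
  then have DUx: "D (U x) = 2 * (of_int (int d - 1) * x)" by (simp add: algebra_simps)
  define y where "y = w * U x - of_int (int d - 1) * x\<^sup>2"
  have "D y = 0" using w(3) unfolding y_def
    by (simp add: D_simps D_const_mult power2_eq_square Dx DUx algebra_simps)
  have "w * U x \<in> wt (int d + (int d - 2 - 2))" by (intro wt_mult w wt_U wx)
  moreover have "of_int (int d - 1) * x\<^sup>2 \<in> wt (int 2 * (int d - 2))"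
    unfolding of_int_eq_iota by (intro wt_const wt_power wx)
  ultimately have wy: "y \<in> wt (2 * int d - 4)" unfolding y_def by (intro wt_diff) (simp_all add: algebra_simps)
  have "\<exists>nu e. y = iota nu * w ^ e \<and> (nu = 0 \<or> d = 2 \<and> e = 0 \<or> d = 4 \<and> e = 1)"
  proof (cases "y = 0")
    case True
    then show ?thesis by (intro exI[of _ 0]) auto
  next
    case False
    obtain q c where q: "2 * int d - 4 = int d * int q" "y = iota c * w ^ q"
      using hw[OF wy \<open>D y = 0\<close> False] by blast
    \<comment> \<open>From \<open>d * q = 2 * d - 4 < 2 * d\<close>. The remaining values
      \<open>q = 0\<close> and \<open>q = 1\<close> give \<open>d = 2\<close> and
      \<open>d = 4\<close>.\<close>
    have "q < 2"
    proof (rule ccontr)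
      assume "\<not> q < 2"
      then have "int d * 2 \<le> int d * int q" by (intro mult_left_mono) auto
      then show False using q(1) by simp
    qed
    then have "q = 0 \<or> q = 1" by auto
    then have "d = 2 \<and> q = 0 \<or> d = 4 \<and> q = 1" using q(1) by auto
    then show ?thesis using q(2) by blast
  qed
  then obtain nu e where nu: "y = iota nu * w ^ e" "nu = 0 \<or> d = 2 \<and> e = 0 \<or> d = 4 \<and> e = 1" by blast
  have "sl2_normal_form scale D U d w x nu e"
  proof (unfold_locales)
    show "w * U x = of_int (int d - 1) * x\<^sup>2 + iota nu * w ^ e" using nu(1) by (simp add: y_def algebra_simps)
    show "\<exists>q c. v = iota c * w ^ q" if "v \<in> wt n" "D v = 0" "v \<noteq> 0" for n v using hw[OF that] by blast
  qed (use w Uw Dx in auto)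
  then show ?thesis using nu(2) by blast
qed

context sl2_normal_form
begin

abbreviation ev :: "'k poly poly \<Rightarrow> 'b" where "ev \<equiv> eval2 iota w x"

sublocale ev: comm_ring_hom ev
  by (rule comm_ring_hom_eval2[OF iota.comm_ring_hom_axioms])

lemma ev_simps [simp]: "ev (cnst2 c) = iota c" "ev var_y = w" "ev var_z = x"
  by (rule eval2_vars[OF iota.comm_ring_hom_axioms])+

text \<open>Inverting \<open>w\<close> turns the ring into \<open>k[w, 1/w, x]\<close>: the elements
  carried into \<open>k[w, x]\<close> by a power of \<open>w\<close> form a subspace stable under
  \<open>D\<close> and \<open>U\<close> that contains all highest weight vectors.\<close>

lemma expansion: "\<exists>N q. w ^ N * b = ev q"
proof -
  define P where "P = ring_gen (range iota \<union> {w, x})"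
  have P: "range iota \<subseteq> P" "w \<in> P" "x \<in> P" using ring_gen_incl[of "range iota \<union> {w, x}"] unfolding P_def by auto
  note PD = is_subringD[OF ring_gen_subring[of "range iota \<union> {w, x}"], folded P_def]
  note Ppow = is_subring_power[OF ring_gen_subring[of "range iota \<union> {w, x}"], folded P_def]
  have Pz: "of_int n \<in> P" for n using P(1) by (auto simp: of_int_eq_iota)
  have Pn: "of_nat n \<in> P" for n using P(1) by (auto simp: of_nat_eq_iota)
  \<comment> \<open>\<open>U\<close> preserves \<open>P\<close> only after multiplication by
    \<open>w\<close>, since \<open>U x\<close> need not be a polynomial in \<open>w\<close> and
    \<open>x\<close>; this costs one more power of \<open>w\<close> when stability under
    \<open>U\<close> is shown.\<close>
  have DU_P: "P \<subseteq> {p \<in> P. D p \<in> P \<and> w * U p \<in> P}"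
    unfolding P_def
  proof (rule ring_gen_least, unfold P_def[symmetric])
    have eq: "w * (U u * v + u * U v) = (w * U u) * v + u * (w * U v)" for u v by (simp add: algebra_simps)
    show "is_subring {p \<in> P. D p \<in> P \<and> w * U p \<in> P}"
      unfolding is_subring_def
    proof (intro conjI ballI)
      show "1 \<in> {p \<in> P. D p \<in> P \<and> w * U p \<in> P}" using PD(1,2) by simp
      fix u assume u: "u \<in> {p \<in> P. D p \<in> P \<and> w * U p \<in> P}"
      then show "- u \<in> {p \<in> P. D p \<in> P \<and> w * U p \<in> P}" using PD(5) by simp
      fix v assume v: "v \<in> {p \<in> P. D p \<in> P \<and> w * U p \<in> P}"
      show "u + v \<in> {p \<in> P. D p \<in> P \<and> w * U p \<in> P}"
        using u v PD(3) by (simp add: D_simps U_simps distrib_left)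
      have "u * v \<in> P" "D u * v + u * D v \<in> P" "(w * U u) * v + u * (w * U v) \<in> P"
        using u v by (auto intro!: PD(3,4))
      then show "u * v \<in> {p \<in> P. D p \<in> P \<and> w * U p \<in> P}" by (simp add: D_simps U_simps eq)
    qed
    have "w * U x \<in> P" unfolding Ux using P by (intro PD Ppow Pz) auto
    moreover have "w * U w \<in> P" unfolding x using P by (intro PD Pn)
    ultimately show "range iota \<union> {w, x} \<subseteq> {p \<in> P. D p \<in> P \<and> w * U p \<in> P}"
      using P w x PD(2) by auto
  qed
  then have dP: "D p \<in> P" "w * U p \<in> P" if "p \<in> P" for p using that by auto
  let ?C = "{b. \<exists>N. w ^ N * b \<in> P}"
  have "b \<in> ?C"
  proof (rule submodule_eq_UNIV)
    fix u assume "u \<in> ?C"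
    then obtain N where N: "w ^ N * u \<in> P" by auto
    show "iota c * u \<in> ?C" for c
    proof -
      have "iota c * (w ^ N * u) \<in> P" by (rule PD(4)) (use N P(1) in auto)
      then have "w ^ N * (iota c * u) \<in> P" by (simp only: mult.left_commute)
      then show ?thesis by blast
    qed
    have "w ^ N * D u = D (w ^ N * u)" using D_pow_w[OF w(2), of N] by (simp add: D_simps)
    then have "w ^ N * D u \<in> P" using dP(1)[OF N] by simp
    then show "D u \<in> ?C" by blast
    have Uw: "w * U (w ^ N) = of_nat N * (w ^ N * (of_nat d * x))"
    proof (induction N)
      case (Suc N)
      have "w * U (w ^ Suc N) = w ^ Suc N * U w + w * (w * U (w ^ N))" by (simp add: U_simps algebra_simps)
      then show ?case unfolding Suc.IH x by (simp add: algebra_simps)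
    qed simp
    have "w ^ Suc N * U u = w * U (w ^ N * u) - (w * U (w ^ N)) * u" by (simp add: U_simps algebra_simps)
    also have "\<dots> = w * U (w ^ N * u) - of_nat N * (of_nat d * x) * (w ^ N * u)"
      unfolding Uw by (simp add: algebra_simps)
    also have "\<dots> \<in> P" by (rule PD(6)[OF dP(2)[OF N]]) (intro PD(4) Pn P N)
    finally show "U u \<in> ?C" by blast
    fix v assume "v \<in> ?C"
    then obtain M where M: "w ^ M * v \<in> P" by auto
    have "w ^ (N + M) * (u + v) = w ^ M * (w ^ N * u) + w ^ N * (w ^ M * v)"
      by (simp add: power_add algebra_simps)
    also have "\<dots> \<in> P" by (rule PD(3)[OF PD(4)[OF Ppow[OF P(2)] N] PD(4)[OF Ppow[OF P(2)] M]])
    finally show "u + v \<in> ?C" by blast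
  next
    fix n v assume v: "v \<in> wt n" "D v = 0"
    show "v \<in> ?C"
    proof (cases "v = 0")
      case False
      then obtain q c where "v = iota c * w ^ q" using hw v by blast
      then have "w ^ 0 * v \<in> P" using P by (auto intro!: PD Ppow)
      then show ?thesis by blast
    qed (use PD(2) in auto)
  qed
  then show ?thesis using eval_subring[of w x] unfolding P_def by blast
qed

lemma ev_eq_0: "ev q = 0 \<longleftrightarrow> q = 0"
  using eval_injective[OF w] d x(1) by auto

lemma ev_eq: "ev p = ev q \<longleftrightarrow> p = q"
  using ev_eq_0[of "p - q"] by (simp add: ev.hom_minus)

end

text \<open>The embedding of the surface into \<open>k(y, z)\<close> that sends \<open>w\<close> to \<open>y ^ n\<close> and \<open>x\<close> to \<open>y ^ (n - 1) * z\<close>.\<close>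

locale sl2_embedding = sl2_normal_form scale D U d w x nu e
  for scale :: "'k::field_char_0 \<Rightarrow> 'b::idom \<Rightarrow> 'b" and D U :: "'b \<Rightarrow> 'b"
    and d :: nat and w x :: 'b and nu :: 'k and e :: nat +
  fixes n :: nat
  assumes n: "n > 0"
begin

definition alpha :: "'k poly poly fract" where "alpha = to_fract (var_y ^ n)"
definition beta :: "'k poly poly fract" where "beta = to_fract (var_y ^ (n - 1) * var_z)"

abbreviation evF :: "'k poly poly \<Rightarrow> 'k poly poly fract" where "evF \<equiv> eval2 kappa alpha beta"

sublocale evF: comm_ring_hom evF
  by (rule comm_ring_hom_eval2[OF comm_ring_hom_kappa])

lemma evF_simps [simp]: "evF (cnst2 c) = kappa c" "evF var_y = alpha" "evF var_z = beta"
  by (rule eval2_vars[OF comm_ring_hom_kappa])+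

lemma evF_eq_0: "evF q = 0 \<longleftrightarrow> q = 0"
  using monomials_algebraically_independent[OF n, of q] by (auto simp: alpha_def beta_def)

lemma alpha_nz [simp]: "alpha \<noteq> 0"
  by (simp add: alpha_def var_y_def)

text \<open>The intended value is \<open>evF q / alpha ^ N\<close>. It does not depend on the choice
  of \<open>N\<close> and \<open>q\<close>, because \<open>ev\<close> is injective.\<close>

definition Psi :: "'b \<Rightarrow> 'k poly poly fract" where
  "Psi b = (SOME m. \<exists>N q. w ^ N * b = ev q \<and> alpha ^ N * m = evF q)"

lemma Psi_eq:
  assumes "w ^ N * b = ev q"
  shows "alpha ^ N * Psi b = evF q"
proof -
  have "\<exists>m. \<exists>N q. w ^ N * b = ev q \<and> alpha ^ N * m = evF q"
    using assms by (intro exI[of _ "evF q / alpha ^ N"] exI[of _ N] exI[of _ q]) simp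
  from someI_ex[OF this] obtain M p where M: "w ^ M * b = ev p" "alpha ^ M * Psi b = evF p"
    by (auto simp: Psi_def)
  let ?W = "var_y :: 'k poly poly"
  have "ev (?W ^ N * p) = ev (?W ^ M * q)"
    using M(1) assms by (simp add: ev.hom_mult ev.hom_power algebra_simps flip: M(1) assms)
  then have "?W ^ N * p = ?W ^ M * q" by (simp only: ev_eq)
  then have "evF (?W ^ N * p) = evF (?W ^ M * q)" by (rule arg_cong)
  then have "alpha ^ N * evF p = alpha ^ M * evF q" by (simp add: evF.hom_mult evF.hom_power)
  then have "alpha ^ M * (alpha ^ N * Psi b) = alpha ^ M * evF q"
    by (simp add: M(2)[symmetric] mult.left_commute)
  then show ?thesis by simp
qed

lemma Psi_cancel:
  assumes "w ^ N * b = ev q" "alpha ^ N * m = evF q"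
  shows "Psi b = m"
proof -
  have "alpha ^ N * Psi b = alpha ^ N * m" using Psi_eq[OF assms(1)] assms(2) by simp
  then show ?thesis by simp
qed

lemma Psi_iota: "Psi (iota c) = kappa c"
  by (rule Psi_cancel[of 0 _ "cnst2 c"]) simp_all

lemma Psi_w: "Psi w = alpha" and Psi_x: "Psi x = beta"
  by (rule Psi_cancel[of 0 _ var_y], simp_all) (rule Psi_cancel[of 0 _ var_z], simp_all)

lemma Psi_add: "Psi (a + b) = Psi a + Psi b" and Psi_mult: "Psi (a * b) = Psi a * Psi b"
proof -
  obtain N p where N: "w ^ N * a = ev p" using expansion by blast
  obtain M q where M: "w ^ M * b = ev q" using expansion by blast
  note N' = Psi_eq[OF N] and M' = Psi_eq[OF M]
  let ?W = "var_y :: 'k poly poly"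
  have "w ^ (N + M) * (a + b) = w ^ M * (w ^ N * a) + w ^ N * (w ^ M * b)" by (simp add: power_add algebra_simps)
  then have 1: "w ^ (N + M) * (a + b) = ev (?W ^ M * p + ?W ^ N * q)"
    unfolding N M by (simp add: ev.hom_mult ev.hom_power ev.hom_add)
  have "alpha ^ (N + M) * (Psi a + Psi b) = alpha ^ M * (alpha ^ N * Psi a) + alpha ^ N * (alpha ^ M * Psi b)"
    by (simp add: power_add algebra_simps)
  then have "alpha ^ (N + M) * (Psi a + Psi b) = evF (?W ^ M * p + ?W ^ N * q)"
    unfolding N' M' by (simp add: evF.hom_mult evF.hom_power evF.hom_add)
  with 1 show "Psi (a + b) = Psi a + Psi b" by (rule Psi_cancel)
  have "w ^ (N + M) * (a * b) = (w ^ N * a) * (w ^ M * b)" by (simp add: power_add algebra_simps)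
  then have 2: "w ^ (N + M) * (a * b) = ev (p * q)" unfolding N M by (simp add: ev.hom_mult)
  have "alpha ^ (N + M) * (Psi a * Psi b) = (alpha ^ N * Psi a) * (alpha ^ M * Psi b)"
    by (simp add: power_add algebra_simps)
  then have "alpha ^ (N + M) * (Psi a * Psi b) = evF (p * q)"
    unfolding N' M' by (simp add: evF.hom_mult)
  with 2 show "Psi (a * b) = Psi a * Psi b" by (rule Psi_cancel)
qed

sublocale Psi: comm_ring_hom Psi
  using Psi_iota[of 0] Psi_iota[of 1]
  by unfold_locales (simp_all add: Psi_add Psi_mult kappa_def cnst2_def)

lemma Psi_inj: "Psi a = Psi b \<longleftrightarrow> a = b"
proof
  assume "Psi a = Psi b"
  then have z: "Psi (a - b) = 0" by (simp add: Psi.hom_minus)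
  obtain N q where N: "w ^ N * (a - b) = ev q" using expansion by blast
  have "evF q = 0" using Psi_eq[OF N] z by simp
  then have "ev q = 0" by (simp add: evF_eq_0)
  then show "a = b" using N w(3) by simp
qed simp

end

section \<open>Comparison of the surface with a model ring\<close>

lemma generate_ring_alg_of: "generate_ring (alg_of s) S = ring_gen S"
proof
  show "generate_ring (alg_of s) S \<subseteq> ring_gen S"
  proof
    fix v assume "v \<in> generate_ring (alg_of s) S"
    then show "v \<in> ring_gen S"
    proof induction
      case (incl h)
      then show ?case using ring_gen_incl[of S] by blast
    qed (auto intro: is_subringD[OF ring_gen_subring])
  qed
  have "is_subring (generate_ring (alg_of s) S)" unfolding is_subring_def
    using generate_ring.one[of "alg_of s" S] generate_ring.a_inv[of _ "alg_of s" S]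
      generate_ring.eng_add[of _ "alg_of s" S] generate_ring.eng_mult[of _ "alg_of s" S] by simp
  then show "ring_gen S \<subseteq> generate_ring (alg_of s) S"
    by (rule ring_gen_least) (auto intro: generate_ring.incl)
qed

text \<open>A model is the subring generated by scalars and \<open>G\<close> in some ring with two
  derivations, read in \<open>k(y, z)\<close> through \<open>h\<close>. For quotient rings
  \<open>h\<close> has a kernel, and \<open>ker\<close> says that the derivations descend to the
  image. The conditions on \<open>wM\<close> and \<open>xM\<close> repeat the normal form of the
  surface.\<close>

locale sl2_model = sl2_embedding scale D U d w x nu e n
  for scale :: "'k::field_char_0 \<Rightarrow> 'b::idom \<Rightarrow> 'b" and D U :: "'b \<Rightarrow> 'b"
    and d :: nat and w x :: 'b and nu :: 'k and e n :: nat +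
  fixes DM UM :: "'m::comm_ring_1 \<Rightarrow> 'm" and h :: "'m \<Rightarrow> 'k poly poly fract" and cM :: "'k \<Rightarrow> 'm"
    and wM xM :: 'm and G :: "'m set"
  assumes hom: "comm_ring_hom h" "comm_ring_hom cM" "\<And>c. h (cM c) = kappa c"
    and DM: "\<And>p q. DM (p + q) = DM p + DM q" "\<And>p q. DM (p * q) = DM p * q + p * DM q" "\<And>c. DM (cM c) = 0"
    and UM: "\<And>p q. UM (p + q) = UM p + UM q" "\<And>p q. UM (p * q) = UM p * q + p * UM q" "\<And>c. UM (cM c) = 0"
    and ker: "\<And>p. h p = 0 \<Longrightarrow> h (DM p) = 0" "\<And>p. h p = 0 \<Longrightarrow> h (UM p) = 0"
    and gens: "h wM = alpha" "h xM = beta"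
    and actions: "h (DM wM) = 0" "h (DM xM) = alpha" "h (UM wM) = of_nat d * beta"
      "alpha * h (UM xM) = of_int (int d - 1) * beta\<^sup>2 + kappa nu * alpha ^ e"
    and G: "wM \<in> ring_gen (range cM \<union> G)" "DM ` G \<subseteq> ring_gen (range cM \<union> G)" "UM ` G \<subseteq> ring_gen (range cM \<union> G)"
begin

sublocale h: comm_ring_hom h by (rule hom)
sublocale cM: comm_ring_hom cM by (rule hom)

abbreviation M where "M \<equiv> ring_gen (range cM \<union> G)"

definition compatible :: "'m \<Rightarrow> 'b \<Rightarrow> bool" where
  "compatible p b \<longleftrightarrow> h p = Psi b \<and> h (DM p) = Psi (D b) \<and> h (UM p) = Psi (U b)"

lemma compatible_const: "compatible (cM c) (iota c)"
  by (simp add: compatible_def hom(3) Psi_iota DM(3) UM(3))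

lemma compatible_add: "compatible p a \<Longrightarrow> compatible q b \<Longrightarrow> compatible (p + q) (a + b)"
  by (simp add: compatible_def h.hom_add Psi_add DM(1) UM(1) D_simps U_simps)

lemma compatible_mult: "compatible p a \<Longrightarrow> compatible q b \<Longrightarrow> compatible (p * q) (a * b)"
  by (simp add: compatible_def h.hom_add h.hom_mult Psi_add Psi_mult DM(2) UM(2) D_simps(2) U_simps(2))

lemma compatible_w: "compatible wM w"
  using actions w(2) x(2) by (simp add: compatible_def gens Psi_w Psi_x Psi_mult Psi.hom_of_nat)

lemma Psi_Ux: "alpha * Psi (U x) = of_int (int d - 1) * beta\<^sup>2 + kappa nu * alpha ^ e"
  using arg_cong[OF Ux, of Psi]
  by (simp only: Psi_w Psi_x Psi_mult Psi_add Psi_iota Psi.hom_of_int Psi.hom_power)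

lemma compatible_x: "compatible xM x"
proof -
  have "alpha * h (UM xM) = alpha * Psi (U x)" using Psi_Ux actions(4) by simp
  then show ?thesis using actions x(1) by (simp add: compatible_def gens Psi_w Psi_x)
qed

lemma compatible_eval: "compatible (eval2 cM wM xM q) (ev q)"
proof (induction q)
  case 0
  then show ?case using compatible_const[of 0] by simp
next
  case (pCons p q)
  have "compatible (poly (map_poly cM p) wM) (poly (map_poly iota p) w)"
  proof (induction p)
    case 0
    then show ?case using compatible_const[of 0] by simp
  next
    case (pCons c p)
    then show ?case
      using compatible_add[OF compatible_const[of c] compatible_mult[OF compatible_w pCons.IH]]
      by (simp add: Polynomial.map_poly_pCons)
  qed
  then show ?case using compatible_add compatible_mult[OF compatible_x pCons.IH]
    unfolding eval2_pCons by blast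
qed

lemma compatible_pow_w: "compatible (wM ^ N) (w ^ N)"
  using compatible_const[of 1] by (induction N) (auto intro: compatible_mult compatible_w)

lemma h_eqD: "h p = h q \<Longrightarrow> h (DM p) = h (DM q)" "h p = h q \<Longrightarrow> h (UM p) = h (UM q)"
proof -
  have "DM (p - q + q) = DM (p - q) + DM q" "UM (p - q + q) = UM (p - q) + UM q" by (rule DM(1) UM(1))+
  then have "h (DM p) = h (DM (p - q)) + h (DM q)" "h (UM p) = h (UM (p - q)) + h (UM q)"
    by (simp_all add: h.hom_add)
  moreover assume "h p = h q"
  then have "h (p - q) = 0" by (simp add: h.hom_minus)
  ultimately show "h (DM p) = h (DM q)" "h (UM p) = h (UM q)" using ker[of "p - q"] by simp_all
qed

text \<open>The derivations on both sides agree on scalars, \<open>w\<close> and \<open>x\<close>,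
  hence on polynomials in \<open>w\<close> and \<open>x\<close>. By the product rule, agreement at
  \<open>w ^ N * b\<close> and at \<open>w ^ N\<close> gives agreement at \<open>b\<close>, after
  \<open>alpha ^ N\<close> is cancelled.\<close>

lemma compatibleI:
  assumes "h p = Psi b"
  shows "compatible p b"
proof -
  obtain N q where N: "w ^ N * b = ev q" using expansion by blast
  note c = compatible_eval[of q] and cw = compatible_pow_w[of N]
  have "h (wM ^ N * p) = h (eval2 cM wM xM q)"
    using c cw assms N by (simp add: compatible_def h.hom_mult Psi_mult[symmetric])
  from h_eqD[OF this]
  have "h (DM (wM ^ N * p)) = Psi (D (w ^ N * b))" "h (UM (wM ^ N * p)) = Psi (U (w ^ N * b))"
    using c N by (simp_all add: compatible_def)
  then have "alpha ^ N * h (DM p) = alpha ^ N * Psi (D b)" "alpha ^ N * h (UM p) = alpha ^ N * Psi (U b)"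
    using cw assms unfolding DM(2) UM(2) D_simps(2) U_simps(2)
    by (simp_all add: compatible_def h.hom_add h.hom_mult h.hom_power Psi_add Psi_mult Psi.hom_power gens Psi_w)
  then show ?thesis using assms by (simp add: compatible_def)
qed

lemma M_incl: "range cM \<subseteq> M" "G \<subseteq> M"
  using ring_gen_incl[of "range cM \<union> G"] by auto

lemma M_stable: "p \<in> M \<Longrightarrow> DM p \<in> M \<and> UM p \<in> M"
proof -
  note MD = is_subringD[OF ring_gen_subring[of "range cM \<union> G"]]
  have z: "DM 0 = 0" "UM 0 = 0" using DM(3)[of 0] UM(3)[of 0] by simp_all
  have "M \<subseteq> {p \<in> M. DM p \<in> M \<and> UM p \<in> M}"
  proof (rule ring_gen_least)
    show "range cM \<union> G \<subseteq> {p \<in> M. DM p \<in> M \<and> UM p \<in> M}"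
      using M_incl G(2,3) MD(2) by (auto simp: DM(3) UM(3))
    show "is_subring {p \<in> M. DM p \<in> M \<and> UM p \<in> M}" unfolding is_subring_def
    proof (intro conjI ballI)
      show "1 \<in> {p \<in> M. DM p \<in> M \<and> UM p \<in> M}" using MD(1,2) DM(3)[of 1] UM(3)[of 1] by simp
      fix p assume p: "p \<in> {p \<in> M. DM p \<in> M \<and> UM p \<in> M}"
      have "DM (- p) = - DM p" "UM (- p) = - UM p"
        using DM(1)[of p "- p"] UM(1)[of p "- p"] z by (simp_all add: eq_neg_iff_add_eq_0 add.commute)
      then show "- p \<in> {p \<in> M. DM p \<in> M \<and> UM p \<in> M}" using p MD(5) by simp
      fix q assume q: "q \<in> {p \<in> M. DM p \<in> M \<and> UM p \<in> M}"
      show "p + q \<in> {p \<in> M. DM p \<in> M \<and> UM p \<in> M}" using p q MD(3) by (simp add: DM UM)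
      have "p * q \<in> M" "DM p * q + p * DM q \<in> M" "UM p * q + p * UM q \<in> M"
        using p q by (auto intro!: MD(3,4))
      then show "p * q \<in> {p \<in> M. DM p \<in> M \<and> UM p \<in> M}" by (simp add: DM UM)
    qed
  qed
  then show "p \<in> M \<Longrightarrow> DM p \<in> M \<and> UM p \<in> M" by blast
qed

text \<open>The elements whose image lies in the model form a subspace that is stable under
  \<open>D\<close> and \<open>U\<close> by \<open>compatibleI\<close> and contains the multiples of
  powers of \<open>w\<close>, that is, all highest weight vectors.\<close>

lemma range_Psi_subset: "\<exists>p\<in>M. h p = Psi b"
proof -
  note MD = is_subringD[OF ring_gen_subring[of "range cM \<union> G"]]
  have "b \<in> {b. \<exists>p\<in>M. h p = Psi b}"
  proof (rule submodule_eq_UNIV)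
    fix a assume "a \<in> {b. \<exists>p\<in>M. h p = Psi b}"
    then obtain p where p: "p \<in> M" "h p = Psi a" by auto
    have "h (cM c * p) = Psi (iota c * a)" for c using p by (simp add: h.hom_mult Psi_mult Psi_iota hom(3))
    moreover have "cM c * p \<in> M" for c using p M_incl by (intro MD) auto
    ultimately show "iota c * a \<in> {b. \<exists>p\<in>M. h p = Psi b}" for c by blast
    show "D a \<in> {b. \<exists>p\<in>M. h p = Psi b}" "U a \<in> {b. \<exists>p\<in>M. h p = Psi b}"
      using compatibleI[OF p(2)] M_stable[OF p(1)] by (auto simp: compatible_def)
    fix b assume "b \<in> {b. \<exists>p\<in>M. h p = Psi b}"
    then obtain q where "q \<in> M" "h q = Psi b" by auto
    then have "p + q \<in> M" "h (p + q) = Psi (a + b)" using p MD(3) by (simp_all add: h.hom_add Psi_add)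
    then show "a + b \<in> {b. \<exists>p\<in>M. h p = Psi b}" by blast
  next
    fix n v assume v: "v \<in> wt n" "D v = 0"
    show "v \<in> {b. \<exists>p\<in>M. h p = Psi b}"
    proof (cases "v = 0")
      case True
      then show ?thesis using MD(2) by (auto intro!: bexI[of _ 0])
    next
      case False
      then obtain q c where "v = iota c * w ^ q" using hw v by blast
      then have "h (cM c * wM ^ q) = Psi v"
        by (simp add: h.hom_mult h.hom_power hom(3) gens Psi_mult Psi.hom_power Psi_iota Psi_w)
      moreover have "cM c * wM ^ q \<in> M" using M_incl G(1) by (intro MD is_subring_power[OF ring_gen_subring]) auto
      ultimately show ?thesis by blast
    qed
  qed
  then show ?thesis by simp
qed

lemma range_Psi_wM: "h wM \<in> range Psi"
  using compatible_w by (auto simp: compatible_def)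

text \<open>The converse inclusion is obtained on generators: they are reached from
  \<open>wM\<close> by applying \<open>UM\<close> and dividing by the scalars that appear.\<close>

lemma range_Psi_UM: "h p \<in> range Psi \<Longrightarrow> h (UM p) \<in> range Psi"
  using compatibleI by (auto simp: compatible_def)

lemma range_Psi_closed:
  shows "h p \<in> range Psi \<Longrightarrow> h q \<in> range Psi \<Longrightarrow> h (p + q) \<in> range Psi"
    "h p \<in> range Psi \<Longrightarrow> h q \<in> range Psi \<Longrightarrow> h (p * q) \<in> range Psi"
    "h p \<in> range Psi \<Longrightarrow> h (- p) \<in> range Psi" "h (cM c) \<in> range Psi"
  unfolding h.hom_add h.hom_mult h.hom_uminus hom(3) Psi_iota[symmetric]
  by (auto simp flip: Psi_add Psi_mult Psi.hom_uminus)

lemma range_Psi_divide: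
  assumes "c \<noteq> 0" "h (cM c * p) \<in> range Psi"
  shows "h p \<in> range Psi"
proof -
  have "h (cM (1 / c)) * h (cM c * p) = h (cM (1 / c * c)) * h p"
    by (simp only: h.hom_mult cM.hom_mult mult.assoc)
  then have "h p = h (cM (1 / c) * (cM c * p))" using assms(1) by (simp add: h.hom_mult)
  then show ?thesis using range_Psi_closed(2)[OF range_Psi_closed(4) assms(2)] by simp
qed

lemma range_Psi_supset:
  assumes "\<And>g. g \<in> G \<Longrightarrow> h g \<in> range Psi" "p \<in> M"
  shows "h p \<in> range Psi"
proof -
  have "M \<subseteq> {p. h p \<in> range Psi}"
  proof (rule ring_gen_least)
    show "is_subring {p. h p \<in> range Psi}" unfolding is_subring_def
      using range_Psi_closed range_Psi_closed(4)[of 1] by auto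
    show "range cM \<union> G \<subseteq> {p. h p \<in> range Psi}" using assms(1) range_Psi_closed(4) by auto
  qed
  then show ?thesis using assms(2) by blast
qed

text \<open>\<open>pr\<close> covers both kinds of carriers: it is the identity for
  \<open>kF\<close> and the passage to cosets for \<open>S_alg\<close> and
  \<open>Q_alg\<close>.\<close>

theorem equivariant_iso:
  fixes pr :: "'m \<Rightarrow> 'c" and T :: "('k, 'c) module"
  assumes Gim: "\<And>g. g \<in> G \<Longrightarrow> h g \<in> range Psi"
    and pr: "\<And>p q. pr p = pr q \<longleftrightarrow> h p = h q"
    and T: "carrier T = pr ` M" "\<And>p q. pr p \<otimes>\<^bsub>T\<^esub> pr q = pr (p * q)" "\<And>p q. pr p \<oplus>\<^bsub>T\<^esub> pr q = pr (p + q)"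
      "\<one>\<^bsub>T\<^esub> = pr 1" "\<And>c p. c \<odot>\<^bsub>T\<^esub> pr p = pr (cM c * p)"
    and DT: "\<And>p. DT (pr p) = pr (DM p)" "\<And>p. UT (pr p) = pr (UM p)"
  shows "equivariantly_isomorphic (alg_of scale, D, U) (T, DT, UT)"
proof -
  define f where "f b = (SOME p. p \<in> M \<and> h p = Psi b)" for b
  have f: "f b \<in> M" "h (f b) = Psi b" for b
    using someI_ex[of "\<lambda>p. p \<in> M \<and> h p = Psi b"] range_Psi_subset[of b] by (auto simp: f_def)
  have eq: "pr (f b) = pr p" if "h p = Psi b" for b p using that f by (simp add: pr)
  let ?phi = "\<lambda>b. pr (f b)"
  have "?phi \<in> Ring.ring_hom (alg_of scale) T"
  proof (rule ring_hom_memI)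
    show "?phi b \<in> carrier T" for b using f by (simp add: T)
    show "?phi (a \<otimes>\<^bsub>alg_of scale\<^esub> b) = ?phi a \<otimes>\<^bsub>T\<^esub> ?phi b" for a b
      unfolding T by (rule eq) (simp add: h.hom_mult f Psi_mult)
    show "?phi (a \<oplus>\<^bsub>alg_of scale\<^esub> b) = ?phi a \<oplus>\<^bsub>T\<^esub> ?phi b" for a b
      unfolding T by (rule eq) (simp add: h.hom_add f Psi_add)
    show "?phi \<one>\<^bsub>alg_of scale\<^esub> = \<one>\<^bsub>T\<^esub>" unfolding T by (rule eq) simp
  qed
  moreover have "bij_betw ?phi (carrier (alg_of scale)) (carrier T)"
  proof (rule bij_betwI')
    show "(?phi a = ?phi b) = (a = b)" for a b by (simp add: pr f Psi_inj)
    show "?phi b \<in> carrier T" for b using f by (simp add: T)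
    show "\<exists>b\<in>carrier (alg_of scale). t = ?phi b" if t: "t \<in> carrier T" for t
    proof -
      obtain p where p: "t = pr p" "p \<in> M" using t T(1) by auto
      obtain b where "h p = Psi b" using range_Psi_supset[OF Gim p(2)] by auto
      then have "t = pr (f b)" using eq p(1) by simp
      then show ?thesis by auto
    qed
  qed
  moreover have "?phi (scale c b) = c \<odot>\<^bsub>T\<^esub> ?phi b" for c b
    unfolding T by (rule eq) (simp add: scale_eq h.hom_mult Psi_mult Psi_iota hom(3) f)
  moreover have "?phi (D b) = DT (?phi b)" "?phi (U b) = UT (?phi b)" for b
    unfolding DT using compatibleI[OF f(2)[of b]] by (auto intro!: eq simp: compatible_def)
  ultimately show ?thesis unfolding equivariantly_isomorphic_def alg_iso_def ring_iso_def
    by (auto intro!: bexI[of _ ?phi])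
qed

end

section \<open>The model rings\<close>

definition cnst3 :: "'k::comm_ring_1 \<Rightarrow> 'k poly poly poly" where "cnst3 c = [:[:[:c:]:]:]"

definition quadric :: "'k::field \<Rightarrow> 'k poly poly poly" where
  "quadric lam = 2 * x0 * x2 - x1\<^sup>2 - cnst3 lam"

text \<open>The quadric solved for \<open>x2\<close>: the variables \<open>x0\<close>,
  \<open>x1\<close>, \<open>x2\<close> go to \<open>y\<close>, \<open>z\<close> and
  \<open>(z ^ 2 + lam) / (2 * y)\<close>. In characteristic zero the kernel is the ideal of the
  quadric, so computations in the quotient take place in \<open>k(y, z)\<close>.\<close>

definition h3 :: "'k::field \<Rightarrow> 'k poly poly poly \<Rightarrow> 'k poly poly fract" where
  "h3 lam p = poly (map_poly to_fract p) (to_fract (var_z\<^sup>2 + cnst2 lam) / to_fract (2 * var_y))"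

lemma comm_ring_hom_h3: "comm_ring_hom (h3 lam)"
  unfolding h3_def[abs_def] by (rule comm_ring_hom_eval[OF to_fract_hom.comm_ring_hom_axioms])

interpretation h3: comm_ring_hom "h3 lam" for lam
  by (rule comm_ring_hom_h3)

lemma comm_ring_hom_cnst3: "comm_ring_hom cnst3"
  by unfold_locales (auto simp: cnst3_def)

interpretation cnst3: comm_ring_hom cnst3
  by (rule comm_ring_hom_cnst3)

interpretation cnst2: comm_ring_hom cnst2
  by (rule comm_ring_hom_cnst2)

lemma x_eq: "x0 = [:var_y:]" "x1 = [:var_z:]" "cnst3 c = [:cnst2 c:]"
  by (simp_all add: x0_def x1_def var_y_def var_z_def cnst3_def cnst2_def)

lemma numeral_cnst3: "numeral m = cnst3 (numeral m)"
  by (metis cnst3.hom_of_nat of_nat_numeral)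

lemma h3_const: "h3 lam [:a:] = to_fract a"
  by (cases "a = 0") (simp_all add: h3_def)

lemma two_y: "2 * var_y = ([:[:0, 2:]:] :: 'k::field_char_0 poly poly)"
  by (simp add: var_y_def numeral_poly)

lemma two_y_nz: "2 * var_y \<noteq> (0 :: 'k::field_char_0 poly poly)"
  by (simp add: two_y)

lemma h3_gens [simp]:
  "h3 lam x0 = to_fract var_y" "h3 lam x1 = to_fract var_z" "h3 lam (cnst3 c) = kappa c"
  "h3 lam x2 = to_fract (var_z\<^sup>2 + cnst2 lam) / to_fract (2 * var_y)"
  by (simp_all add: x_eq h3_const kappa_def) (simp add: h3_def x2_def)

lemma h3_relation:
  fixes lam :: "'k::field_char_0"
  shows "to_fract (2 * var_y) * h3 lam x2 = to_fract (var_z\<^sup>2 + cnst2 lam)"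
  using two_y_nz[where 'k = 'k] by (simp add: to_fract_eq_0_iff del: to_fract_hom.hom_mult)

lemma quadric_eq: "quadric lam = [:- (var_z\<^sup>2 + cnst2 lam), 2 * var_y:]"
proof -
  have 1: "2 * x0 * x2 = [:0, 2 * var_y:]" by (simp add: x_eq x2_def numeral_poly)
  have 2: "x1\<^sup>2 = [:var_z\<^sup>2:]" by (simp add: x_eq power2_eq_square)
  show ?thesis unfolding quadric_def 1 2 x_eq(3) by simp
qed

lemma h3_quadric: "h3 (lam :: 'k::field_char_0) (quadric lam) = 0"
proof -
  have "quadric lam = [:2 * var_y:] * x2 - [:var_z\<^sup>2 + cnst2 lam:]" by (simp add: quadric_eq x2_def)
  then show ?thesis by (simp only: h3.hom_minus h3.hom_mult h3_const h3_relation diff_self)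
qed

lemma prime_two_y: "prime_elem (2 * var_y :: 'k::field_char_0 poly poly)"
  unfolding two_y by (intro lift_prime_elem_poly prime_elem_linear_field_poly) simp

lemma two_y_not_dvd: "\<not> [:2 * var_y:] dvd quadric (lam :: 'k::field_char_0)"
proof
  assume "[:2 * var_y:] dvd quadric lam"
  then have "2 * var_y dvd coeff (quadric lam) 0" by (simp add: const_poly_dvd_iff)
  then have "2 * var_y dvd - (var_z\<^sup>2 + cnst2 lam)" by (simp add: quadric_eq)
  then have "[:0, 2:] dvd coeff (- (var_z\<^sup>2 + cnst2 lam)) 2"
    unfolding two_y const_poly_dvd_iff by blast
  moreover have "coeff (- (var_z\<^sup>2 + cnst2 lam)) 2 = -1"
    by (simp add: var_z_def cnst2_def power2_eq_square numeral_2_eq_2)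
  ultimately have "[:0, 2 :: 'k:] dvd 1" by simp
  then obtain q where "1 = [:0, 2 :: 'k:] * q" by (auto elim: dvdE)
  then have "poly 1 (0 :: 'k) = poly ([:0, 2:] * q) 0" by simp
  then show False by simp
qed

text \<open>The quadric is linear in \<open>x2\<close> with leading coefficient
  \<open>2 * x0\<close>, so powers of this coefficient permit the elimination of \<open>x2\<close>;
  the remainder is a polynomial in \<open>x0\<close> and \<open>x1\<close>.\<close>

lemma pseudo_division_quadric:
  fixes p :: "'k::field_char_0 poly poly poly"
  shows "\<exists>N q r. [:2 * var_y:] ^ N * p = quadric lam * q + [:r:]"
proof (induction p)
  case 0
  then show ?case by (intro exI[of _ 0]) simp
next
  case (pCons a p)
  then obtain N q r where N: "[:2 * var_y:] ^ N * p = quadric lam * q + [:r:]" by blast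
  let ?Y = "[:2 * var_y:] :: 'k poly poly poly"
  have p: "pCons a p = [:a:] + x2 * p" by (simp add: x2_def)
  have Y: "?Y * x2 = quadric lam + [:var_z\<^sup>2 + cnst2 lam:]" by (simp add: quadric_eq x2_def)
  have "Y ^ Suc N * (A + t * p) = Y ^ Suc N * A + (Y * t) * (Y ^ N * p)" for Y A t :: "'k poly poly poly"
    by (simp add: algebra_simps)
  then have "?Y ^ Suc N * pCons a p = ?Y ^ Suc N * [:a:] + (?Y * x2) * (?Y ^ N * p)"
    unfolding p .
  also have "\<dots> = quadric lam * (?Y * x2 * q + [:r:]) + ([:var_z\<^sup>2 + cnst2 lam:] * [:r:] + ?Y ^ Suc N * [:a:])"
    unfolding N Y by (simp only: distrib_left distrib_right ac_simps)
  also have "[:var_z\<^sup>2 + cnst2 lam:] * [:r:] + ?Y ^ Suc N * [:a:]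
      = [:(var_z\<^sup>2 + cnst2 lam) * r + (2 * var_y) ^ Suc N * a:]"
    by (simp only: poly_const_pow) simp
  finally show ?case by blast
qed

lemma dvd_if_prime_power_mult:
  fixes a f p q :: "'a::idom"
  assumes "prime_elem a" "\<not> a dvd f"
  shows "a ^ N * p = f * q \<Longrightarrow> f dvd p"
proof (induction N arbitrary: q)
  case (Suc N)
  have "a * (a ^ N * p) = f * q" using Suc.prems by (simp add: mult.assoc)
  then have "a dvd f * q" by (metis dvd_triv_left)
  then obtain q' where q': "q = a * q'" using assms by (auto simp: prime_elem_dvd_mult_iff elim: dvdE)
  have "a * (a ^ N * p) = a * (f * q')" using Suc.prems by (simp add: q' algebra_simps)
  moreover have "a \<noteq> 0" using assms(1) by (auto simp: prime_elem_def)
  ultimately have "a ^ N * p = f * q'" by simp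
  then show ?case by (rule Suc.IH)
qed simp

text \<open>The remainder of the pseudo-division lies in \<open>k[x0, x1]\<close>, where
  \<open>h3 lam\<close> is injective, so a power of \<open>2 * x0\<close> times \<open>p\<close> is
  a multiple of the quadric. The power can be removed since \<open>2 * x0\<close> is prime and does
  not divide the quadric.\<close>

lemma h3_eq_0_iff:
  fixes p :: "'k::field_char_0 poly poly poly"
  shows "h3 lam p = 0 \<longleftrightarrow> quadric lam dvd p"
proof
  assume "h3 lam p = 0"
  obtain N q r where N: "[:2 * var_y:] ^ N * p = quadric lam * q + [:r:]"
    using pseudo_division_quadric by blast
  have "h3 lam ([:2 * var_y:] ^ N * p) = to_fract r"
    unfolding N by (simp only: h3.hom_add h3.hom_mult h3_quadric h3_const) simp
  then have "r = 0" using \<open>h3 lam p = 0\<close> by (simp add: h3.hom_mult)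
  then show "quadric lam dvd p" using N
    by (intro dvd_if_prime_power_mult[OF lift_prime_elem_poly[OF prime_two_y] two_y_not_dvd, of N _ lam q]) simp
next
  assume "quadric lam dvd p"
  then show "h3 lam p = 0" by (auto elim!: dvdE simp: h3.hom_mult h3_quadric)
qed

section \<open>The quotient by the quadric\<close>

lemma poly3_simps [simp]:
  "carrier poly3 = UNIV" "monoid.mult poly3 = (*)" "monoid.one poly3 = 1" "ring.zero poly3 = 0"
  "ring.add poly3 = (+)" "module.smult poly3 c p = cnst3 c * p"
  by (simp_all add: poly3_def cnst3_def)

lemma cring_poly3: "cring poly3"
  unfolding poly3_def by (rule cring_alg_of)

lemma S_ideal_eq: "S_ideal lam = {p. quadric lam dvd p}"
proof -
  interpret cring poly3 by (rule cring_poly3)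
  have "S_ideal lam = cgenideal poly3 (quadric lam)"
    using cgenideal_eq_genideal[of "quadric lam"] by (simp add: S_ideal_def quadric_def cnst3_def)
  also have "\<dots> = {p. quadric lam dvd p}" by (auto simp: cgenideal_def dvd_def mult.commute)
  finally show ?thesis .
qed

lemma ideal_S_ideal: "ideal (S_ideal lam) poly3"
proof -
  interpret cring poly3 by (rule cring_poly3)
  show ?thesis unfolding S_ideal_def by (rule genideal_ideal) simp
qed

lemma S_proj_eq: "S_proj lam p = {q. quadric lam dvd q - p}"
proof -
  have "q \<in> S_proj lam p \<longleftrightarrow> (\<exists>i. quadric lam dvd i \<and> q = i + p)" for q
    by (auto simp: S_proj_def a_r_coset_def r_coset_def S_ideal_eq)
  moreover have "(\<exists>i. quadric lam dvd i \<and> q = i + p) \<longleftrightarrow> quadric lam dvd q - p" for q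
    by (auto intro: exI[of _ "q - p"])
  ultimately show ?thesis by auto
qed

lemma S_proj_eq_iff: "S_proj lam p = S_proj (lam :: 'k::field_char_0) q \<longleftrightarrow> h3 lam p = h3 lam q"
proof -
  have "S_proj lam p = S_proj lam q \<longleftrightarrow> quadric lam dvd p - q"
  proof
    assume "S_proj lam p = S_proj lam q"
    moreover have "p \<in> S_proj lam p" by (simp add: S_proj_eq)
    ultimately show "quadric lam dvd p - q" by (simp add: S_proj_eq)
  next
    assume *: "quadric lam dvd p - q"
    have "quadric lam dvd r - p \<longleftrightarrow> quadric lam dvd r - q" for r
      using dvd_add_left_iff[OF *, of "r - p"] by simp
    then show "S_proj lam p = S_proj lam q" by (simp add: S_proj_eq)
  qed
  also have "\<dots> \<longleftrightarrow> h3 lam p = h3 lam q" by (simp add: h3_eq_0_iff[symmetric] h3.hom_minus)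
  finally show ?thesis .
qed

text \<open>The induced operator is a union over the representatives of a coset; all of them
  contribute the same coset because \<open>F\<close> respects equality under
  \<open>h3 lam\<close>.\<close>

lemma induced_S_proj:
  fixes lam :: "'k::field_char_0"
  assumes "\<And>p q. h3 lam p = h3 lam q \<Longrightarrow> h3 lam (F p) = h3 lam (F q)"
  shows "induced poly3 (S_ideal lam) F (S_proj lam p) = S_proj lam (F p)"
proof -
  have *: "S_proj lam (F q) = S_proj lam (F p)" if "q \<in> S_proj lam p" for q
  proof -
    have "quadric lam dvd q - p" using that by (simp add: S_proj_eq)
    then have "h3 lam q = h3 lam p" by (simp add: h3_eq_0_iff[symmetric] h3.hom_minus)
    then show ?thesis unfolding S_proj_eq_iff by (rule assms)
  qed
  have "p \<in> S_proj lam p" by (simp add: S_proj_eq)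
  then have ne: "S_proj lam p \<noteq> {}" by blast
  have "induced poly3 (S_ideal lam) F (S_proj lam p) = (\<Union>q\<in>S_proj lam p. S_proj lam (F q))"
    by (simp only: induced_def S_proj_def)
  also have "\<dots> = (\<Union>q\<in>S_proj lam p. S_proj lam (F p))" by (rule SUP_cong[OF refl *])
  also have "\<dots> = S_proj lam (F p)" using ne by (simp only: UN_constant if_False)
  finally show ?thesis .
qed

lemma S_alg_ops:
  fixes lam :: "'k::field_char_0"
  shows "carrier (S_alg lam) = range (S_proj lam)"
    "S_proj lam p \<otimes>\<^bsub>S_alg lam\<^esub> S_proj lam q = S_proj lam (p * q)"
    "S_proj lam p \<oplus>\<^bsub>S_alg lam\<^esub> S_proj lam q = S_proj lam (p + q)"
    "\<one>\<^bsub>S_alg lam\<^esub> = S_proj lam 1" "\<zero>\<^bsub>S_alg lam\<^esub> = S_proj lam 0"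
    "c \<odot>\<^bsub>S_alg lam\<^esub> S_proj lam p = S_proj lam (cnst3 c * p)"
proof -
  interpret I: ideal "S_ideal lam" poly3 by (rule ideal_S_ideal)
  have ext: "S_alg lam = ring.extend (poly3 Quot S_ideal lam)
      (module.fields (\<lambda>c. induced poly3 (S_ideal lam) (\<lambda>p. cnst3 c * p)))"
    by (simp add: S_alg_def quotient_algebra_def)
  show "carrier (S_alg lam) = range (S_proj lam)"
    by (auto simp: ext ring.extend_def module.fields_def FactRing_def A_RCOSETS_def' S_proj_def)
  show "S_proj lam p \<otimes>\<^bsub>S_alg lam\<^esub> S_proj lam q = S_proj lam (p * q)"
    using I.rcoset_mult_add[of p q]
    by (simp add: ext ring.extend_def module.fields_def FactRing_def S_proj_def)
  show "S_proj lam p \<oplus>\<^bsub>S_alg lam\<^esub> S_proj lam q = S_proj lam (p + q)"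
    using I.a_rcos_sum[of p q]
    by (simp add: ext ring.extend_def module.fields_def FactRing_def S_proj_def)
  show "\<one>\<^bsub>S_alg lam\<^esub> = S_proj lam 1"
    by (simp add: ext ring.extend_def module.fields_def FactRing_def S_proj_def)
  show "\<zero>\<^bsub>S_alg lam\<^esub> = S_proj lam 0"
    by (auto simp: ext ring.extend_def module.fields_def FactRing_def S_proj_eq S_ideal_eq)
  have "c \<odot>\<^bsub>S_alg lam\<^esub> S_proj lam p = induced poly3 (S_ideal lam) (\<lambda>p. cnst3 c * p) (S_proj lam p)"
    by (simp add: ext ring.extend_def module.fields_def FactRing_def)
  also have "\<dots> = S_proj lam (cnst3 c * p)" by (rule induced_S_proj) (simp only: h3.hom_mult)
  finally show "c \<odot>\<^bsub>S_alg lam\<^esub> S_proj lam p = S_proj lam (cnst3 c * p)" .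
qed

section \<open>The derivations on the polynomial rings\<close>

lemma map_poly_derivation:
  fixes F :: "'a::comm_ring_1 \<Rightarrow> 'a"
  assumes "\<And>x y. F (x + y) = F x + F y" "\<And>x y. F (x * y) = F x * y + x * F y"
  shows "map_poly F (p + q) = map_poly F p + map_poly F q"
    "map_poly F (p * q) = map_poly F p * q + p * map_poly F q"
proof -
  have z: "F 0 = 0" using assms(1)[of 0 0] by (metis add.right_neutral add_left_cancel)
  have s: "F (sum g I) = (\<Sum>i\<in>I. F (g i))" for g and I :: "nat set"
    by (induction I rule: infinite_finite_induct) (simp_all add: z assms(1))
  show "map_poly F (p + q) = map_poly F p + map_poly F q"
    by (rule poly_eqI) (simp add: coeff_map_poly z assms)
  show "map_poly F (p * q) = map_poly F p * q + p * map_poly F q"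
    by (rule poly_eqI) (simp add: coeff_map_poly z assms coeff_mult s sum.distrib)
qed

lemma pderiv_derivation: "pderiv (p + q) = pderiv p + pderiv q" "pderiv (p * q) = pderiv p * q + p * pderiv q"
  by (simp_all add: pderiv_add pderiv_mult algebra_simps)

text \<open>Partial derivatives in the inner variables, with one layer of \<open>map_poly\<close>
  for each variable passed over.\<close>

lemmas map_pderiv_derivation = map_poly_derivation[OF pderiv_derivation]
lemmas map_map_pderiv_derivation = map_poly_derivation[OF map_pderiv_derivation]

lemma D3_derivation: "D3 (p + q) = D3 p + D3 q" "D3 (p * q) = D3 p * q + p * D3 q" "D3 (cnst3 c) = 0"
  and U3_derivation: "U3 (p + q) = U3 p + U3 q" "U3 (p * q) = U3 p * q + p * U3 q" "U3 (cnst3 c) = 0"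
  unfolding D3_def U3_def map_pderiv_derivation map_map_pderiv_derivation pderiv_derivation
  by (simp_all add: algebra_simps cnst3_def Polynomial.map_poly_pCons)

lemma D2_derivation: "D2 (p + q) = D2 p + D2 q" "D2 (p * q) = D2 p * q + p * D2 q" "D2 (cnst2 c) = 0"
  and U2_derivation: "U2 (p + q) = U2 p + U2 q" "U2 (p * q) = U2 p * q + p * U2 q" "U2 (cnst2 c) = 0"
  unfolding D2_def U2_def map_pderiv_derivation pderiv_derivation
  by (simp_all add: algebra_simps cnst2_def Polynomial.map_poly_pCons)

lemma map_pderiv_1 [simp]: "map_poly pderiv 1 = 0"
  by (rule poly_eqI) (simp add: coeff_map_poly)

lemma map_map_pderiv_1 [simp]: "map_poly (map_poly pderiv) 1 = 0"
  by (rule poly_eqI) (simp add: coeff_map_poly)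

lemma D3_gens [simp]: "D3 x0 = 0" "D3 x1 = x0" "D3 x2 = x1"
  and U3_gens [simp]: "U3 x0 = 2 * x1" "U3 x1 = 2 * x2" "U3 x2 = 0"
  by (simp_all add: D3_def U3_def x0_def x1_def x2_def Polynomial.map_poly_pCons pderiv_pCons numeral_poly)

lemma D2_gens [simp]: "D2 var_y = 0" "D2 var_z = var_y"
  and U2_gens [simp]: "U2 var_y = var_z" "U2 var_z = 0"
  by (simp_all add: D2_def U2_def var_y_def var_z_def Polynomial.map_poly_pCons pderiv_pCons)

lemma derivation_power:
  fixes F :: "'a::comm_ring_1 \<Rightarrow> 'a"
  assumes "\<And>x y. F (x + y) = F x + F y" "\<And>x y. F (x * y) = F x * y + x * F y"
  shows "F (x ^ n) = of_nat n * x ^ (n - 1) * F x"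
proof (induction n)
  case 0
  have "F 1 = 0" using assms(2)[of 1 1] by (metis add.right_neutral add_left_cancel mult_1_left mult_1_right)
  then show ?case by simp
next
  case (Suc n)
  then show ?case by (cases n) (simp_all add: assms(2) algebra_simps)
qed

lemma D3_quadric: "D3 (quadric lam) = 0" and U3_quadric: "U3 (quadric lam) = 0"
proof -
  \<comment> \<open>Written with sums, products and constants, to which the derivation rules apply.
    The quadric is an invariant of the action, so the ideal it generates is stable.\<close>
  have q: "quadric lam = x0 * x2 + x0 * x2 + cnst3 (-1) * (x1 * x1) + cnst3 (- lam)"
    by (simp add: quadric_def power2_eq_square cnst3.hom_uminus algebra_simps)
  show "D3 (quadric lam) = 0" "U3 (quadric lam) = 0"
    unfolding q D3_derivation U3_derivation by (simp_all add: cnst3.hom_uminus algebra_simps)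
qed

lemma h3_ker_stable:
  assumes "h3 (lam :: 'k::field_char_0) p = 0"
  shows "h3 lam (D3 p) = 0" "h3 lam (U3 p) = 0"
proof -
  obtain g where "p = quadric lam * g" using assms by (auto simp: h3_eq_0_iff elim: dvdE)
  then show "h3 lam (D3 p) = 0" "h3 lam (U3 p) = 0"
    by (simp_all add: D3_derivation U3_derivation D3_quadric U3_quadric h3.hom_mult h3_quadric)
qed

lemma derivations_0 [simp]: "D2 0 = 0" "U2 0 = 0" "D3 0 = 0" "U3 0 = 0"
  by (simp_all add: D2_def U2_def D3_def U3_def)

section \<open>Spans of monomials\<close>

lemma poly_in_additive:
  fixes p :: "'a::comm_ring_1 poly"
  assumes "0 \<in> X" "\<And>p q. p \<in> X \<Longrightarrow> q \<in> X \<Longrightarrow> p + q \<in> X"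
    "\<And>i. coeff p i \<noteq> 0 \<Longrightarrow> monom (coeff p i) i \<in> X"
  shows "p \<in> X"
proof -
  have "monom (coeff p i) i \<in> X" for i using assms(1,3) by (cases "coeff p i = 0") auto
  then have "(\<Sum>i\<in>I. monom (coeff p i) i) \<in> X" for I
    using assms(1,2) by (induction I rule: infinite_finite_induct) auto
  then show ?thesis using poly_as_sum_of_monoms[of p] by metis
qed

lemma monom2_eq: "monom (monom c i) j = cnst2 c * (var_y ^ i * var_z ^ j)"
proof -
  have z: "var_z ^ j = monom 1 j" by (simp add: var_z_def monom_altdef)
  have y: "var_y ^ i = [:monom 1 i:]" by (simp add: var_y_def monom_altdef poly_const_pow)
  show ?thesis unfolding y z by (simp add: cnst2_def smult_monom)
qed

lemma monom3_eq: "monom (monom (monom c i) j) l = cnst3 c * (x0 ^ i * x1 ^ j * x2 ^ l)"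
proof -
  have 2: "x2 ^ l = monom 1 l" by (simp add: x2_def monom_altdef)
  have 1: "x1 ^ j = [:monom 1 j:]" by (simp add: x1_def monom_altdef poly_const_pow)
  have 0: "x0 ^ i = [:[:monom 1 i:]:]" by (simp add: x0_def monom_altdef poly_const_pow)
  show ?thesis unfolding 0 1 2 by (simp add: cnst3_def smult_monom)
qed

lemma poly2_in_additive:
  fixes p :: "'k::field poly poly"
  assumes X: "0 \<in> X" "\<And>p q. p \<in> X \<Longrightarrow> q \<in> X \<Longrightarrow> p + q \<in> X"
    and m: "\<And>i j. coeff (coeff p j) i \<noteq> 0 \<Longrightarrow> cnst2 (coeff (coeff p j) i) * (var_y ^ i * var_z ^ j) \<in> X"
  shows "p \<in> X"
proof (rule poly_in_additive[OF X])
  fix j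
  have "coeff p j \<in> {q. monom q j \<in> X}"
    by (rule poly_in_additive) (use X m in \<open>auto simp: monom2_eq simp flip: add_monom\<close>)
  then show "monom (coeff p j) j \<in> X" by simp
qed

lemma poly3_in_additive:
  fixes p :: "'k::field poly poly poly"
  assumes X: "0 \<in> X" "\<And>p q. p \<in> X \<Longrightarrow> q \<in> X \<Longrightarrow> p + q \<in> X"
    and m: "\<And>i j l. coeff (coeff (coeff p l) j) i \<noteq> 0 \<Longrightarrow>
      cnst3 (coeff (coeff (coeff p l) j) i) * (x0 ^ i * x1 ^ j * x2 ^ l) \<in> X"
  shows "p \<in> X"
proof (rule poly_in_additive[OF X])
  fix l
  have "coeff p l \<in> {q. monom q l \<in> X}"
  proof (rule poly_in_additive)
    fix j
    have "coeff (coeff p l) j \<in> {q. monom (monom q j) l \<in> X}"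
      by (rule poly_in_additive) (use X m in \<open>auto simp: monom3_eq simp flip: add_monom\<close>)
    then show "monom (coeff (coeff p l) j) j \<in> {q. monom q l \<in> X}" by simp
  qed (use X in \<open>auto simp flip: add_monom\<close>)
  then show "monom (coeff p l) l \<in> X" by simp
qed

lemma forms2_monomial: "i + j = d \<Longrightarrow> cnst2 c * (var_y ^ i * var_z ^ j) \<in> forms2 d"
  by (auto simp: forms2_def simp flip: monom2_eq split: if_splits)

lemma forms3_monomial: "i + j + l = d \<Longrightarrow> cnst3 c * (x0 ^ i * x1 ^ j * x2 ^ l) \<in> forms3 d"
  by (auto simp: forms3_def simp flip: monom3_eq split: if_splits)

lemma forms2_subset_additive:
  assumes "0 \<in> X" "\<And>p q. p \<in> X \<Longrightarrow> q \<in> X \<Longrightarrow> p + q \<in> X"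
    "\<And>c i j. i + j = d \<Longrightarrow> cnst2 (c::'k::field) * (var_y ^ i * var_z ^ j) \<in> X"
  shows "forms2 d \<subseteq> X"
proof
  fix p :: "'k poly poly" assume p: "p \<in> forms2 d"
  show "p \<in> X"
    by (rule poly2_in_additive[of X, OF assms(1,2)], assumption+, rule assms(3)) (use p in \<open>auto simp: forms2_def\<close>)
qed

lemma forms3_subset_additive:
  assumes "0 \<in> X" "\<And>p q. p \<in> X \<Longrightarrow> q \<in> X \<Longrightarrow> p + q \<in> X"
    "\<And>c i j l. i + j + l = d \<Longrightarrow> cnst3 (c::'k::field) * (x0 ^ i * x1 ^ j * x2 ^ l) \<in> X"
  shows "forms3 d \<subseteq> X"
proof
  fix p :: "'k poly poly poly" assume p: "p \<in> forms3 d"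
  show "p \<in> X"
    by (rule poly3_in_additive[of X, OF assms(1,2)], assumption+, rule assms(3)) (use p in \<open>auto simp: forms3_def\<close>)
qed

lemma generated_subalgebra_poly2: "generated_subalgebra poly2 S = ring_gen (range cnst2 \<union> S)"
proof -
  have sc: "scalars poly2 = range cnst2" by (auto simp: scalars_def poly2_def cnst2_def)
  show ?thesis unfolding generated_subalgebra_def sc by (simp add: poly2_def generate_ring_alg_of)
qed

lemma generated_subalgebra_poly3: "generated_subalgebra poly3 S = ring_gen (range cnst3 \<union> S)"
proof -
  have sc: "scalars poly3 = range cnst3" by (auto simp: scalars_def)
  show ?thesis unfolding generated_subalgebra_def sc by (simp add: poly3_def generate_ring_alg_of)
qed

section \<open>Stability of forms and the isomorphisms with the models\<close>

lemma D2_monomial: "D2 (cnst2 c * (var_y ^ i * var_z ^ j)) = cnst2 (c * of_nat j) * (var_y ^ Suc i * var_z ^ (j - 1))"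
  and U2_monomial: "U2 (cnst2 c * (var_y ^ i * var_z ^ j)) = cnst2 (c * of_nat i) * (var_y ^ (i - 1) * var_z ^ Suc j)"
  by (simp_all add: D2_derivation U2_derivation derivation_power[OF D2_derivation(1,2)]
      derivation_power[OF U2_derivation(1,2)] cnst2.hom_mult cnst2.hom_of_nat algebra_simps)

lemma forms2_stable:
  assumes "p \<in> forms2 d"
  shows "D2 p \<in> ring_gen (range cnst2 \<union> forms2 d)" "U2 p \<in> ring_gen (range cnst2 \<union> forms2 d)"
proof -
  let ?M = "ring_gen (range cnst2 \<union> forms2 d) :: 'a poly poly set"
  note MD = is_subringD[OF ring_gen_subring[of "range cnst2 \<union> (forms2 d :: 'a poly poly set)"]]
  have F: "forms2 d \<subseteq> ?M" using ring_gen_incl[of "range cnst2 \<union> (forms2 d :: 'a poly poly set)"] by auto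
  have "forms2 d \<subseteq> {p. D2 p \<in> ?M \<and> U2 p \<in> ?M}"
  proof (rule forms2_subset_additive)
    show "0 \<in> {p. D2 p \<in> ?M \<and> U2 p \<in> ?M}" using MD(2) by simp
    show "p + q \<in> {p. D2 p \<in> ?M \<and> U2 p \<in> ?M}"
      if "p \<in> {p. D2 p \<in> ?M \<and> U2 p \<in> ?M}" "q \<in> {p. D2 p \<in> ?M \<and> U2 p \<in> ?M}" for p q
      using that MD(3) by (simp add: D2_derivation U2_derivation)
    fix c :: 'a and i j :: nat assume ij: "i + j = d"
    have "D2 (cnst2 c * (var_y ^ i * var_z ^ j)) \<in> ?M"
    \<comment> \<open>For \<open>j = 0\<close> the exponent \<open>j - 1\<close> is truncated and
      the degree would be wrong, but then the coefficient \<open>c * of_nat j\<close>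
      vanishes.\<close>
    proof (cases j)
      case 0 then show ?thesis unfolding D2_monomial using MD(2) by simp
    next
      case (Suc j')
      then show ?thesis using ij F unfolding D2_monomial by (intro subsetD[OF F] forms2_monomial) simp
    qed
    moreover have "U2 (cnst2 c * (var_y ^ i * var_z ^ j)) \<in> ?M"
    proof (cases i)
      case 0 then show ?thesis unfolding U2_monomial using MD(2) by simp
    next
      case (Suc i')
      then show ?thesis using ij F unfolding U2_monomial by (intro subsetD[OF F] forms2_monomial) simp
    qed
    ultimately show "cnst2 c * (var_y ^ i * var_z ^ j) \<in> {p. D2 p \<in> ?M \<and> U2 p \<in> ?M}" by simp
  qed
  then show "D2 p \<in> ?M" "U2 p \<in> ?M" using assms by auto
qed

text \<open>With \<open>n = d\<close> the embedding sends \<open>w\<close> and \<open>x\<close> to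
  the forms \<open>y ^ d\<close> and \<open>y ^ (d - 1) * z\<close>, for which the equation for
  \<open>U x\<close> holds without the \<open>nu\<close> term.\<close>

lemma (in sl2_normal_form) iso_kF:
  assumes "nu = 0"
  shows "equivariantly_isomorphic (alg_of scale, D, U) (kF d, D2, U2)"
proof -
  interpret sl2_embedding scale D U d w x nu e d
    by unfold_locales (rule d)
  let ?F = "forms2 d :: 'k poly poly set"
  have "var_y ^ d \<in> ?F" using forms2_monomial[of d 0 d 1] by simp
  then have yF: "var_y ^ d \<in> ring_gen (range cnst2 \<union> ?F)" using ring_gen_incl by blast
  obtain m where m: "d = Suc m" using d by (cases d) auto
  interpret sl2_model scale D U d w x nu e d D2 U2 to_fract cnst2 "var_y ^ d" "var_y ^ (d - 1) * var_z" ?F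
  proof unfold_locales
    show "to_fract (D2 (var_y ^ d)) = 0" by (simp add: derivation_power[OF D2_derivation(1,2)])
    show "to_fract (D2 (var_y ^ (d - 1) * var_z)) = alpha"
      unfolding alpha_def by (simp add: derivation_power[OF D2_derivation(1,2)] D2_derivation m mult.commute)
    show "to_fract (U2 (var_y ^ d)) = of_nat d * beta"
      unfolding beta_def by (simp add: derivation_power[OF U2_derivation(1,2)] hom_distribs)
    have Ux: "U2 (var_y ^ (d - 1) * var_z :: 'k poly poly) = of_nat m * (var_y ^ (m - 1) * var_z\<^sup>2)"
      using U2_monomial[of "1::'k" "d - 1" 1] m by (simp add: cnst2.hom_of_nat numeral_2_eq_2)
    have "var_y ^ d * U2 (var_y ^ (d - 1) * var_z :: 'k poly poly) = of_nat m * (var_y ^ (d - 1) * var_z)\<^sup>2"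
      unfolding Ux by (cases m) (simp_all add: m power2_eq_square algebra_simps)
    then have "to_fract (var_y ^ d * U2 (var_y ^ (d - 1) * var_z :: 'k poly poly)) = to_fract (of_nat m * (var_y ^ (d - 1) * var_z)\<^sup>2)"
      by (rule arg_cong)
    then show "alpha * to_fract (U2 (var_y ^ (d - 1) * var_z)) = of_int (int d - 1) * beta\<^sup>2 + kappa nu * alpha ^ e"
      unfolding alpha_def beta_def by (simp add: assms kappa_def m hom_distribs)
  qed (use yF forms2_stable in \<open>auto simp: kappa_def alpha_def beta_def D2_derivation U2_derivation
      to_fract_eq_0_iff intro: to_fract_hom.comm_ring_hom_axioms comm_ring_hom_cnst2
      D2_derivation(2) U2_derivation(2)\<close>)
  \<comment> \<open>Down the string: \<open>U\<close> turns \<open>y ^ (d - j) * z ^ j\<close> into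
    \<open>d - j\<close> times the next monomial, and this number is nonzero in \<open>k\<close> for
    \<open>j < d\<close>.\<close>
  have mono: "to_fract (var_y ^ (d - j) * var_z ^ j) \<in> range Psi" if "j \<le> d" for j
    using that
  proof (induction j)
    case 0
    then show ?case using range_Psi_wM by simp
  next
    case (Suc j)
    have eq: "U2 (var_y ^ (d - j) * var_z ^ j :: 'k poly poly) = cnst2 (of_nat (d - j)) * (var_y ^ (d - Suc j) * var_z ^ Suc j)"
      using U2_monomial[of 1 "d - j" j] by simp
    have "to_fract (U2 (var_y ^ (d - j) * var_z ^ j :: 'k poly poly)) \<in> range Psi"
      using Suc.prems by (intro range_Psi_UM Suc.IH) simp
    then have "to_fract (cnst2 (of_nat (d - j)) * (var_y ^ (d - Suc j) * var_z ^ Suc j)) \<in> range Psi"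
      by (simp only: eq)
    moreover have "of_nat (d - j) \<noteq> (0::'k)" using Suc.prems by (simp del: of_nat_diff)
    ultimately show ?case by (rule range_Psi_divide[rotated])
  qed
  have "?F \<subseteq> {p. to_fract p \<in> range Psi}"
  proof (rule forms2_subset_additive)
    show "0 \<in> {p. to_fract p \<in> range Psi}" using range_Psi_closed(4)[of 0] by simp
    show "p + q \<in> {p. to_fract p \<in> range Psi}"
      if "p \<in> {p. to_fract p \<in> range Psi}" "q \<in> {p. to_fract p \<in> range Psi}" for p q
      using range_Psi_closed(1)[of p q] that by simp
    fix c :: 'k and i j assume "i + j = d"
    then have "j \<le> d" "i = d - j" by auto
    then show "cnst2 c * (var_y ^ i * var_z ^ j) \<in> {p. to_fract p \<in> range Psi}"
      using range_Psi_closed(2)[OF range_Psi_closed(4) mono] by simp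
  qed
  then have Gim: "to_fract g \<in> range Psi" if "g \<in> ?F" for g using that by auto
  show ?thesis
  proof (rule equivariant_iso[where pr = "\<lambda>p. p", OF Gim])
    show "carrier (kF d) = (\<lambda>p. p) ` M" by (simp add: kF_def generated_subalgebra_poly2)
  qed (simp_all add: kF_def poly2_def cnst2_def)
qed

lemma h3_numeral [simp]: "h3 lam (numeral n) = numeral n"
  by (metis h3.hom_of_nat of_nat_numeral)

lemma h3_stable:
  fixes lam :: "'k::field_char_0"
  assumes "h3 lam p = h3 lam q"
  shows "h3 lam (D3 p) = h3 lam (D3 q)" "h3 lam (U3 p) = h3 lam (U3 q)"
proof -
  have "D3 (p - q + q) = D3 (p - q) + D3 q" "U3 (p - q + q) = U3 (p - q) + U3 q"
    by (rule D3_derivation(1) U3_derivation(1))+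
  then have "h3 lam (D3 p) = h3 lam (D3 (p - q)) + h3 lam (D3 q)"
    "h3 lam (U3 p) = h3 lam (U3 (p - q)) + h3 lam (U3 q)" by (simp_all add: h3.hom_add)
  moreover have "h3 lam (p - q) = 0" using assms by (simp add: h3.hom_minus)
  ultimately show "h3 lam (D3 p) = h3 lam (D3 q)" "h3 lam (U3 p) = h3 lam (U3 q)"
    using h3_ker_stable[of lam "p - q"] by simp_all
qed

lemma S_D_proj: "S_D lam (S_proj lam p) = S_proj (lam :: 'k::field_char_0) (D3 p)"
  and S_U_proj: "S_U lam (S_proj lam p) = S_proj lam (U3 p)"
  unfolding S_D_def S_U_def by (rule induced_S_proj, erule h3_stable)+

lemma ring_gen_x: "ring_gen (range cnst3 \<union> {x0, x1, x2}) = (UNIV :: 'k::field poly poly poly set)"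
proof -
  let ?M = "ring_gen (range cnst3 \<union> {x0, x1, x2}) :: 'k poly poly poly set"
  have sub: "is_subring ?M" by simp
  have M: "cnst3 c \<in> ?M" "x0 \<in> ?M" "x1 \<in> ?M" "x2 \<in> ?M" for c
    using ring_gen_incl[of "range cnst3 \<union> {x0, x1, x2}"] by auto
  have "p \<in> ?M" for p
  proof (rule poly3_in_additive)
    show "0 \<in> ?M" by (rule is_subringD(2)[OF sub])
    show "p + q \<in> ?M" if "p \<in> ?M" "q \<in> ?M" for p q by (rule is_subringD(3)[OF sub that])
    show "cnst3 (coeff (coeff (coeff p l) j) i) * (x0 ^ i * x1 ^ j * x2 ^ l) \<in> ?M" for i j l
      by (intro is_subringD(4)[OF sub] is_subring_power[OF sub] M)
  qed
  then show ?thesis by auto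
qed

lemma two_cnst3: "2 = cnst3 2"
  using numeral_cnst3[of "Num.Bit0 Num.One"] by simp

lemma h3_relation':
  fixes lam :: "'k::field_char_0"
  shows "h3 lam (cnst3 2 * (x0 * x2)) = h3 lam (x1 * x1 + cnst3 lam)"
proof -
  have "cnst3 2 * (x0 * x2) - (x1 * x1 + cnst3 lam) = quadric lam"
    by (simp add: quadric_def power2_eq_square two_cnst3[symmetric] algebra_simps)
  then have "h3 lam (cnst3 2 * (x0 * x2)) - h3 lam (x1 * x1 + cnst3 lam) = 0"
    by (simp only: h3.hom_minus[symmetric] h3_quadric)
  then show ?thesis by simp
qed

text \<open>With \<open>n = 1\<close>, \<open>w\<close> and \<open>x\<close> correspond to
  \<open>x0\<close> and \<open>x1\<close>. As \<open>U x1 = 2 * x2\<close>, the equation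
  \<open>w * U x = x ^ 2 + nu\<close> is the equation of the quadric, so \<open>nu\<close> is its
  parameter.\<close>

lemma (in sl2_normal_form) iso_S:
  assumes "d = 2" "e = 0"
  shows "equivariantly_isomorphic (alg_of scale, D, U) (S_alg nu, S_D nu, S_U nu)"
proof -
  interpret sl2_embedding scale D U d w x nu e 1
    by unfold_locales simp
  let ?G = "{x0, x1, x2} :: 'k poly poly poly set"
  interpret sl2_model scale D U d w x nu e 1 D3 U3 "h3 nu" cnst3 x0 x1 ?G
  proof unfold_locales
    have "h3 nu x0 * h3 nu (2 * x2) = h3 nu (cnst3 2 * (x0 * x2))"
      by (simp only: two_cnst3 h3.hom_mult mult.left_commute)
    also have "\<dots> = h3 nu x1 * h3 nu x1 + h3 nu (cnst3 nu)"
      using h3_relation'[of nu] by (simp only: h3.hom_add h3.hom_mult)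
    finally show "alpha * h3 nu (U3 x1) = of_int (int d - 1) * beta\<^sup>2 + kappa nu * alpha ^ e"
      using assms unfolding alpha_def beta_def by (simp add: power2_eq_square del: h3_gens(4))
    show "h3 nu (U3 x0) = of_nat d * beta"
      using assms(1) unfolding beta_def by (simp add: h3.hom_mult)
    show "h3 nu x0 = alpha" "h3 nu x1 = beta" "h3 nu (D3 x1) = alpha"
      unfolding alpha_def beta_def by simp_all
  qed (unfold ring_gen_x, auto simp: D3_derivation U3_derivation h3_ker_stable
      comm_ring_hom_h3 comm_ring_hom_cnst3)
  \<comment> \<open>\<open>x1\<close> and \<open>x2\<close> are the halves of \<open>U x0\<close>
    and \<open>U x1\<close>.\<close>
  have "h3 nu x0 \<in> range Psi" by (rule range_Psi_wM)
  moreover from range_Psi_UM[OF this] have "h3 nu x1 \<in> range Psi"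
    by (intro range_Psi_divide[of 2 x1]) (simp_all add: two_cnst3)
  moreover from range_Psi_UM[OF this] have "h3 nu x2 \<in> range Psi"
    by (intro range_Psi_divide[of 2 x2]) (simp_all add: two_cnst3 del: h3_gens)
  ultimately have Gim: "h3 nu g \<in> range Psi" if "g \<in> ?G" for g using that by blast
  show ?thesis
    by (rule equivariant_iso[where pr = "S_proj nu", OF Gim])
      (simp_all only: S_proj_eq_iff S_alg_ops ring_gen_x S_D_proj S_U_proj)
qed

lemma forms3_2_subset_additive:
  assumes "0 \<in> X" "\<And>p q. p \<in> X \<Longrightarrow> q \<in> X \<Longrightarrow> p + q \<in> X"
    "\<And>c m. m \<in> {x0 * x0, x0 * x1, x0 * x2, x1 * x1, x1 * x2, x2 * x2} \<Longrightarrow> cnst3 (c::'k::field) * m \<in> X"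
  shows "forms3 2 \<subseteq> X"
proof (rule forms3_subset_additive[OF assms(1,2)])
  fix c :: 'k and i j l :: nat assume "i + j + l = 2"
  then have "(i = 2 \<and> j = 0 \<and> l = 0) \<or> (i = 1 \<and> j = 1 \<and> l = 0) \<or> (i = 1 \<and> j = 0 \<and> l = 1)
    \<or> (i = 0 \<and> j = 2 \<and> l = 0) \<or> (i = 0 \<and> j = 1 \<and> l = 1) \<or> (i = 0 \<and> j = 0 \<and> l = 2)" by presburger
  then have "x0 ^ i * x1 ^ j * x2 ^ l \<in> {x0 * x0, x0 * x1, x0 * x2, x1 * x1, x1 * x2, x2 * (x2 :: 'k poly poly poly)}"
    by (auto simp: power2_eq_square)
  then show "cnst3 c * (x0 ^ i * x1 ^ j * x2 ^ l) \<in> X" by (rule assms(3))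
qed

lemma forms3_2_monomials: "{x0 * x0, x0 * x1, x0 * x2, x1 * x1, x1 * x2, x2 * x2} \<subseteq> (forms3 2 :: 'k::field poly poly poly set)"
  using forms3_monomial[of 2 0 0 2 "1::'k"] forms3_monomial[of 1 1 0 2 "1::'k"] forms3_monomial[of 1 0 1 2 "1::'k"]
    forms3_monomial[of 0 2 0 2 "1::'k"] forms3_monomial[of 0 1 1 2 "1::'k"] forms3_monomial[of 0 0 2 2 "1::'k"]
  by (simp add: power2_eq_square)

lemma forms3_stable:
  assumes "p \<in> forms3 2"
  shows "D3 p \<in> ring_gen (range cnst3 \<union> forms3 2)" "U3 p \<in> ring_gen (range cnst3 \<union> forms3 2)"
proof -
  define M where "M = (ring_gen (range cnst3 \<union> forms3 2) :: 'a poly poly poly set)"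
  have sub: "is_subring M" by (simp add: M_def)
  note MD = is_subringD[OF sub]
  have mono: "x0 * x0 \<in> M" "x0 * x1 \<in> M" "x0 * x2 \<in> M" "x1 * x1 \<in> M" "x1 * x2 \<in> M" "x2 * x2 \<in> M" "cnst3 c \<in> M" for c
    using forms3_2_monomials[where 'k = 'a] ring_gen_incl[of "range cnst3 \<union> forms3 2 :: 'a poly poly poly set"]
    unfolding M_def by auto
  have num: "numeral n * m \<in> M" if "m \<in> M" for m n
    unfolding numeral_cnst3[of n] using mono(7) that by (rule MD(4))
  have "forms3 2 \<subseteq> {p. D3 p \<in> M \<and> U3 p \<in> M}"
  proof (rule forms3_2_subset_additive)
    show "0 \<in> {p. D3 p \<in> M \<and> U3 p \<in> M}" using MD(2) by simp
    show "p + q \<in> {p. D3 p \<in> M \<and> U3 p \<in> M}"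
      if "p \<in> {p. D3 p \<in> M \<and> U3 p \<in> M}" "q \<in> {p. D3 p \<in> M \<and> U3 p \<in> M}" for p q
      using that MD(3) by (simp add: D3_derivation U3_derivation)
    fix c :: 'a and m :: "'a poly poly poly"
    assume "m \<in> {x0 * x0, x0 * x1, x0 * x2, x1 * x1, x1 * x2, x2 * x2}"
    then have "D3 m \<in> M \<and> U3 m \<in> M"
      using mono MD(2) by (auto simp: D3_derivation U3_derivation mult.commute[of x1 x0] mult.commute[of x2 x0]
          mult.commute[of x2 x1] mult.assoc mult.left_commute[of _ 2] intro!: MD(3) num)
    then show "cnst3 c * m \<in> {p. D3 p \<in> M \<and> U3 p \<in> M}"
      using MD(4) mono(7) by (simp add: D3_derivation U3_derivation)
  qed
  then show "D3 p \<in> ring_gen (range cnst3 \<union> forms3 2)" "U3 p \<in> ring_gen (range cnst3 \<union> forms3 2)"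
    using assms unfolding M_def by auto
qed

text \<open>With \<open>n = 2\<close>, \<open>w\<close> and \<open>x\<close> correspond to
  \<open>x0 * x0\<close> and \<open>x0 * x1\<close>. On the quadric
  \<open>U (x0 * x1) = 2 * x1 ^ 2 + 2 * x0 * x2 = 3 * x1 ^ 2 + nu\<close>; multiplied by
  \<open>x0 ^ 2\<close> this is the normal form for \<open>d = 4\<close> and
  \<open>e = 1\<close>.\<close>

lemma (in sl2_normal_form) iso_Q:
  assumes "d = 4" "e = 1"
  shows "equivariantly_isomorphic (alg_of scale, D, U) (Q_alg nu, S_D nu, S_U nu)"
proof -
  interpret sl2_embedding scale D U d w x nu e 2
    by unfold_locales simp
  let ?G = "forms3 2 :: 'k poly poly poly set"
  have x0G: "x0 * x0 \<in> ?G" using forms3_2_monomials by blast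
  then have x0M: "x0 * x0 \<in> ring_gen (range cnst3 \<union> ?G)" using ring_gen_incl by blast
  interpret sl2_model scale D U d w x nu e 2 D3 U3 "h3 nu" cnst3 "x0 * x0" "x0 * x1" ?G
  proof unfold_locales
    have a: "alpha = h3 nu x0 * h3 nu x0" and b: "beta = h3 nu x0 * h3 nu x1"
      by (simp_all add: alpha_def beta_def power2_eq_square hom_distribs)
    have "x0 * x0 * U3 (x0 * x1) = cnst3 (2::'k) * (x0 * x1 * (x0 * x1)) + x0 * x0 * (cnst3 2 * (x0 * x2))"
      by (simp add: U3_derivation two_cnst3[symmetric] algebra_simps)
    then have "h3 nu (x0 * x0 * U3 (x0 * x1))
        = h3 nu (cnst3 2 * (x0 * x1 * (x0 * x1))) + h3 nu (x0 * x0) * h3 nu (cnst3 2 * (x0 * x2))"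
      by (simp only: h3.hom_add h3.hom_mult)
    also have "\<dots> = h3 nu (cnst3 2 * (x0 * x1 * (x0 * x1)) + x0 * x0 * (x1 * x1 + cnst3 nu))"
      by (simp only: h3.hom_add h3.hom_mult h3_relation'[of nu, unfolded h3.hom_add h3.hom_mult])
    also have "\<dots> = h3 nu (cnst3 3 * (x0 * x1 * (x0 * x1)) + cnst3 nu * (x0 * x0))"
      by (rule arg_cong[of _ _ "h3 nu"]) (simp add: numeral_cnst3[symmetric] algebra_simps)
    finally show "alpha * h3 nu (U3 (x0 * x1)) = of_int (int d - 1) * beta\<^sup>2 + kappa nu * alpha ^ e"
      using assms by (simp add: a b power2_eq_square h3.hom_add h3.hom_mult numeral_cnst3[symmetric] del: h3_gens(1,2,4))
    show "h3 nu (x0 * x0) = alpha" "h3 nu (x0 * x1) = beta" by (simp_all only: a b h3.hom_mult)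
    show "h3 nu (D3 (x0 * x0)) = 0" "h3 nu (D3 (x0 * x1)) = alpha"
      by (simp_all add: D3_derivation h3.hom_mult a)
    show "h3 nu (U3 (x0 * x0)) = of_nat d * beta"
      using assms(1) by (simp add: U3_derivation h3.hom_mult h3.hom_add b)
    show "x0 * x0 \<in> ring_gen (range cnst3 \<union> ?G)" by (rule x0M)
  qed (auto simp: D3_derivation U3_derivation h3_ker_stable forms3_stable
      comm_ring_hom_h3 comm_ring_hom_cnst3)
  let ?R = "{p. h3 nu p \<in> range Psi}"
  have div: "p \<in> ?R" if "cnst3 c * p \<in> ?R" "c \<noteq> 0" for c p using range_Psi_divide[OF that(2)] that(1) by simp
  have UR: "U3 p \<in> ?R" if "p \<in> ?R" for p using range_Psi_UM that by simp
  have add: "p + q \<in> ?R" if "p \<in> ?R" "q \<in> ?R" for p q using range_Psi_closed(1) that by simp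
  have cst: "cnst3 c \<in> ?R" for c using range_Psi_closed(4) by simp
  have mul: "p * q \<in> ?R" if "p \<in> ?R" "q \<in> ?R" for p q using range_Psi_closed(2) that by simp
  have 1: "x0 * x0 \<in> ?R" using range_Psi_wM by simp
  have "U3 (x0 * x0) = cnst3 (4::'k) * (x0 * x1)" by (simp add: U3_derivation numeral_cnst3[symmetric])
  then have 2: "x0 * x1 \<in> ?R" using UR[OF 1] by - (rule div[of 4], auto)
  \<comment> \<open>The string from \<open>x0 * x0\<close> has one vector in each of five weights,
    but there are six monomials; the quadric relation separates \<open>x1 * x1\<close> from
    \<open>x0 * x2\<close> in weight 0.\<close>
  have "h3 nu (cnst3 3 * (x1 * x1)) = h3 nu (U3 (x0 * x1) + cnst3 (- nu))"
  proof -
    have "cnst3 3 * (x1 * x1) = cnst3 2 * (x1 * x1) + x1 * x1 + cnst3 nu - cnst3 nu"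
      by (simp add: numeral_cnst3[symmetric])
    then have "h3 nu (cnst3 3 * (x1 * x1)) = h3 nu (cnst3 2 * (x1 * x1)) + h3 nu (x1 * x1 + cnst3 nu) - h3 nu (cnst3 nu)"
      by (simp only: h3.hom_add h3.hom_minus add.assoc)
    also have "\<dots> = h3 nu (cnst3 2 * (x1 * x1) + cnst3 2 * (x0 * x2) - cnst3 nu)"
      by (simp only: h3_relation'[symmetric] h3.hom_add[of _ "cnst3 2 * (x1 * x1)"] h3.hom_minus)
    also have "cnst3 2 * (x1 * x1) + cnst3 2 * (x0 * x2) - cnst3 nu = U3 (x0 * x1) + cnst3 (- nu)"
      by (simp add: U3_derivation numeral_cnst3[symmetric] cnst3.hom_uminus algebra_simps)
    finally show ?thesis .
  qed
  then have "cnst3 3 * (x1 * x1) \<in> ?R" using add[OF UR[OF 2] cst[of "- nu"]] by simp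
  then have 3: "x1 * x1 \<in> ?R" by (rule div) simp
  have "cnst3 2 * (x0 * x2) \<in> ?R" using add[OF 3 cst[of nu]] h3_relation'[of nu] by simp
  then have 4: "x0 * x2 \<in> ?R" by (rule div) simp
  have "U3 (x1 * x1) = cnst3 (4::'k) * (x1 * x2)" by (simp add: U3_derivation numeral_cnst3[symmetric])
  then have 5: "x1 * x2 \<in> ?R" using UR[OF 3] by - (rule div[of 4], auto)
  have "U3 (x1 * x2) = cnst3 (2::'k) * (x2 * x2)" by (simp add: U3_derivation numeral_cnst3[symmetric])
  then have 6: "x2 * x2 \<in> ?R" using UR[OF 5] by - (rule div[of 2], auto)
  have "?G \<subseteq> ?R"
  proof (rule forms3_2_subset_additive)
    show "0 \<in> ?R" using cst[of 0] by simp
    show "p + q \<in> ?R" if "p \<in> ?R" "q \<in> ?R" for p q using that by (rule add)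
    fix c :: 'k and m :: "'k poly poly poly"
    assume "m \<in> {x0 * x0, x0 * x1, x0 * x2, x1 * x1, x1 * x2, x2 * x2}"
    then have "m \<in> ?R" using 1 2 3 4 5 6 by blast
    then show "cnst3 c * m \<in> ?R" by (rule mul[OF cst])
  qed
  then have Gim: "h3 nu g \<in> range Psi" if "g \<in> ?G" for g using that by auto
  show ?thesis
  proof (rule equivariant_iso[where pr = "S_proj nu", OF Gim])
    show "carrier (Q_alg nu) = S_proj nu ` M" by (simp add: Q_alg_def generated_subalgebra_poly3)
  qed (simp_all add: Q_alg_def S_proj_eq_iff S_alg_ops S_D_proj S_U_proj)
qed

theorem sl2_surface_classification:
  fixes scale :: "'k::field_char_0 \<Rightarrow> 'b::idom \<Rightarrow> 'b"
  assumes "affine_domain (alg_of scale)" "normal_domain TYPE('b)" "krull_dim (alg_of scale) = 2"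
    "Units (alg_of scale) = {scale c 1 |c. c \<noteq> 0}" "fundamental_pair scale D U" "nontrivial_pair D U"
  shows "(\<exists>d\<ge>1. equivariantly_isomorphic (alg_of scale, D, U) (kF d, D2, U2)) \<or>
    (\<exists>lam. lam \<noteq> 0 \<and>
      (equivariantly_isomorphic (alg_of scale, D, U) (S_alg lam, S_D lam, S_U lam) \<or>
       equivariantly_isomorphic (alg_of scale, D, U) (Q_alg lam, S_D lam, S_U lam)))"
proof -
  interpret sl2_surface scale D U
    by (intro sl2_surface.intro sl2_algebra.intro sl2_surface_axioms.intro assms)
      (use assms(1) in \<open>simp add: affine_domain_def\<close>)
  obtain d w x nu e where nf: "sl2_normal_form scale D U d w x nu e"
    and cases: "nu = 0 \<or> d = 2 \<and> e = 0 \<or> d = 4 \<and> e = 1" using normal_form by blast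
  interpret sl2_normal_form scale D U d w x nu e by (rule nf)
  show ?thesis using iso_kF iso_S iso_Q d cases by (cases "nu = 0") auto
qed

section \<open>Factoriality\<close>

text \<open>An irreducible element is associated to a prime occurring in its factorization and is
  therefore prime; uniqueness then follows from the primeness of irreducibles.\<close>

lemma (in comm_monoid_cancel) factorial_monoid_if_prime_factors:
  assumes ex: "\<And>a. a \<in> carrier G \<Longrightarrow> \<exists>u fs. u \<in> Units G \<and> set fs \<subseteq> carrier G \<and>
    (\<forall>p\<in>set fs. Divisibility.prime G p) \<and> a = u \<otimes> foldr (\<otimes>) fs \<one>"
  shows "factorial_monoid G"
proof -
  have fold: "foldr (\<otimes>) fs \<one> \<in> carrier G" if "set fs \<subseteq> carrier G" for fs
    using that by (induction fs) auto
  interpret primeness_condition_monoid G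
  proof
    fix a assume a: "a \<in> carrier G" "Divisibility.irreducible G a"
    obtain u fs where u: "u \<in> Units G" "set fs \<subseteq> carrier G" "\<forall>p\<in>set fs. Divisibility.prime G p"
      "a = u \<otimes> foldr (\<otimes>) fs \<one>" using ex[OF a(1)] by blast
    have uc: "u \<in> carrier G" using u(1) by (rule Units_closed)
    obtain p ps where fs: "fs = p # ps"
    proof (cases fs)
      case Nil
      then have "a \<in> Units G" using u(1,4) uc by simp
      then show ?thesis using a(2) by (auto simp: Divisibility.irreducible_def)
    qed
    have p: "p \<in> carrier G" "Divisibility.prime G p" and ps: "foldr (\<otimes>) ps \<one> \<in> carrier G"
      using u(2,3) fold[of ps] by (auto simp: fs)
    have apq: "a = p \<otimes> (u \<otimes> foldr (\<otimes>) ps \<one>)" using u(4) uc p(1) ps by (simp add: fs m_lcomm)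
    then have pa: "p divides a" using uc ps by (auto simp: factor_def)
    have "p \<notin> Units G" using p(2) by (simp add: Divisibility.prime_def)
    then have "a divides p" using a(2) p(1) pa by (auto simp: Divisibility.irreducible_def properfactor_def)
    show "Divisibility.prime G a" unfolding Divisibility.prime_def
    proof (intro conjI ballI impI)
      show "a \<notin> Units G" using a(2) by (simp add: Divisibility.irreducible_def)
      fix b c assume bc: "b \<in> carrier G" "c \<in> carrier G" "a divides b \<otimes> c"
      then have "p divides b \<otimes> c" using pa p(1) divides_trans by blast
      then have "p divides b \<or> p divides c" using p(2) bc by (auto simp: Divisibility.prime_def)
      then show "a divides b \<or> a divides c" using \<open>a divides p\<close> a(1) divides_trans by blast
    qed
  qed
  show ?thesis
  proof (rule factorial_monoidI)
    fix a assume a: "a \<in> carrier G" "a \<notin> Units G"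
    obtain u fs where u: "u \<in> Units G" "set fs \<subseteq> carrier G" "\<forall>p\<in>set fs. Divisibility.prime G p"
      "a = u \<otimes> foldr (\<otimes>) fs \<one>" using ex[OF a(1)] by blast
    have "foldr (\<otimes>) fs \<one> \<sim> a"
      using u(1,4) fold[OF u(2)] m_comm[of u "foldr (\<otimes>) fs \<one>"] Units_closed[OF u(1)]
      by (intro associated_sym[OF associatedI2[of u]]) auto
    then have "wfactors G fs a"
      using u(2,3) prime_irreducible by (auto intro!: wfactorsI)
    then show "\<exists>fs. set fs \<subseteq> carrier G \<and> wfactors G fs a" using u(2) by blast
  next
    fix a fs fs' assume "a \<in> carrier G" "set fs \<subseteq> carrier G" "set fs' \<subseteq> carrier G"
      "wfactors G fs a" "wfactors G fs' a"
    then show "essentially_equal G fs fs'" by (intro wfactors_unique)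
  qed
qed

text \<open>Divisibility with quotient in the subring \<open>A\<close>; the \<open>dvd\<close> of
  the ambient type would admit quotients outside \<open>A\<close>.\<close>

definition sdvd :: "'a::comm_ring_1 set \<Rightarrow> 'a \<Rightarrow> 'a \<Rightarrow> bool" where
  "sdvd A a b \<longleftrightarrow> (\<exists>c\<in>A. b = a * c)"

definition sprime :: "'a::comm_ring_1 set \<Rightarrow> 'a \<Rightarrow> bool" where
  "sprime A p \<longleftrightarrow> p \<in> A \<and> p \<noteq> 0 \<and> \<not> sdvd A p 1 \<and>
     (\<forall>a\<in>A. \<forall>b\<in>A. sdvd A p (a * b) \<longrightarrow> sdvd A p a \<or> sdvd A p b)"

inductive_set prime_products :: "'a::comm_ring_1 set \<Rightarrow> 'a set" for A where
  unit: "u \<in> A \<Longrightarrow> sdvd A u 1 \<Longrightarrow> u \<in> prime_products A"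
| mult: "sprime A p \<Longrightarrow> a \<in> prime_products A \<Longrightarrow> p * a \<in> prime_products A"

text \<open>Elements of \<open>T\<close> are values \<open>pr p\<close>, and equality of such values
  is equality of \<open>h p\<close>. So divisibility in \<open>T\<close> can be computed in the
  image of \<open>M\<close> under \<open>h\<close>, a subring of a domain.\<close>

locale concrete_ring =
  fixes T :: "('c, 'r) ring_scheme" and pr :: "'m::comm_ring_1 \<Rightarrow> 'c" and h :: "'m \<Rightarrow> 'f::idom" and M :: "'m set"
  assumes hom: "comm_ring_hom h" and M: "is_subring M" and pr: "\<And>p q. pr p = pr q \<longleftrightarrow> h p = h q"
    and T: "carrier T = pr ` M" "\<And>p q. pr p \<otimes>\<^bsub>T\<^esub> pr q = pr (p * q)" "\<And>p q. pr p \<oplus>\<^bsub>T\<^esub> pr q = pr (p + q)"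
      "\<one>\<^bsub>T\<^esub> = pr 1" "\<zero>\<^bsub>T\<^esub> = pr 0"
begin

sublocale h: comm_ring_hom h by (rule hom)

lemmas MD = is_subringD[OF M]

lemma domain_T: "domain T"
proof (intro domain.intro domain_axioms.intro cringI abelian_groupI comm_monoidI)
  fix x assume "x \<in> carrier T"
  then obtain p where p: "x = pr p" "p \<in> M" by (auto simp: T)
  have "pr (- p) \<oplus>\<^bsub>T\<^esub> x = \<zero>\<^bsub>T\<^esub>" by (simp add: p T)
  then show "\<exists>y\<in>carrier T. y \<oplus>\<^bsub>T\<^esub> x = \<zero>\<^bsub>T\<^esub>" using MD(5)[OF p(2)] by (auto simp: T(1))
next
  show "\<one>\<^bsub>T\<^esub> \<noteq> \<zero>\<^bsub>T\<^esub>" by (simp add: T pr)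
  show "\<And>a b. a \<otimes>\<^bsub>T\<^esub> b = \<zero>\<^bsub>T\<^esub> \<Longrightarrow> a \<in> carrier T \<Longrightarrow> b \<in> carrier T \<Longrightarrow> a = \<zero>\<^bsub>T\<^esub> \<or> b = \<zero>\<^bsub>T\<^esub>"
    by (auto simp: T pr h.hom_mult)
qed (auto simp: T pr h.hom_mult h.hom_add algebra_simps intro!: imageI MD)

sublocale T: domain T by (rule domain_T)

abbreviation A where "A \<equiv> h ` M"

lemma carrier_iff: "x \<in> carrier (mult_of T) \<longleftrightarrow> (\<exists>p\<in>M. x = pr p \<and> h p \<noteq> 0)"
  by (auto simp: T pr)

lemma factor_iff:
  assumes "p \<in> M" "q \<in> M" "h q \<noteq> 0"
  shows "pr p divides\<^bsub>mult_of T\<^esub> pr q \<longleftrightarrow> sdvd A (h p) (h q)"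
proof -
  have "pr p divides\<^bsub>mult_of T\<^esub> pr q \<longleftrightarrow> (\<exists>r\<in>M. h r \<noteq> 0 \<and> h q = h p * h r)"
    unfolding factor_def Bex_def carrier_iff by (auto simp: T pr h.hom_mult)
  also have "\<dots> \<longleftrightarrow> sdvd A (h p) (h q)" using assms(3) by (auto simp: sdvd_def)
  finally show ?thesis .
qed

lemma Units_iff:
  assumes "p \<in> M"
  shows "pr p \<in> Units (mult_of T) \<longleftrightarrow> sdvd A (h p) 1"
proof
  assume "pr p \<in> Units (mult_of T)"
  then obtain x where "x \<in> carrier (mult_of T)" "pr p \<otimes>\<^bsub>T\<^esub> x = \<one>\<^bsub>T\<^esub>" by (auto simp: Units_def)
  then obtain r where "r \<in> M" "h p * h r = 1" by (auto simp: T pr h.hom_mult)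
  then show "sdvd A (h p) 1" by (auto simp: sdvd_def intro!: bexI[of _ r])
next
  assume "sdvd A (h p) 1"
  then obtain r where r: "r \<in> M" "h p * h r = 1" by (auto simp: sdvd_def)
  then have "h p \<noteq> 0" "h r \<noteq> 0" by auto
  then show "pr p \<in> Units (mult_of T)"
    using r assms unfolding Units_def by (auto simp: T pr h.hom_mult mult.commute intro!: bexI[of _ "pr r"])
qed

lemma Units_iff': "p \<in> M \<Longrightarrow> pr p \<in> Units T \<longleftrightarrow> sdvd A (h p) 1"
  using Units_iff by simp

lemma prime_if_sprime:
  assumes "p \<in> M" "sprime A (h p)"
  shows "Divisibility.prime (mult_of T) (pr p)"
  unfolding Divisibility.prime_def
proof (intro conjI ballI impI)
  show "pr p \<notin> Units (mult_of T)" using assms by (simp add: Units_iff' sprime_def)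
  fix a b assume "a \<in> carrier (mult_of T)" "b \<in> carrier (mult_of T)"
    and d: "pr p divides\<^bsub>mult_of T\<^esub> a \<otimes>\<^bsub>mult_of T\<^esub> b"
  then obtain q r where q: "a = pr q" "q \<in> M" "h q \<noteq> 0" "b = pr r" "r \<in> M" "h r \<noteq> 0"
    unfolding carrier_iff by blast
  then have "sdvd A (h p) (h q * h r)"
    using d factor_iff[OF assms(1) MD(4)[OF q(2,5)]] by (simp add: T h.hom_mult)
  then have "sdvd A (h p) (h q) \<or> sdvd A (h p) (h r)" using assms(2) q by (auto simp: sprime_def)
  then show "pr p divides\<^bsub>mult_of T\<^esub> a \<or> pr p divides\<^bsub>mult_of T\<^esub> b"
    using q assms(1) by (simp add: factor_iff)
qed

lemma factorial_if_prime_products: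
  assumes "A - {0} \<subseteq> prime_products A"
  shows "factorial_domain T"
proof -
  \<comment> \<open>The factorization is asserted for every preimage of \<open>a\<close> in
    \<open>M\<close>, since the induction runs over the image of \<open>M\<close>, where preimages
    are not visible.\<close>
  have ex: "\<exists>u fs. u \<in> Units (mult_of T) \<and> set fs \<subseteq> carrier (mult_of T) \<and>
      (\<forall>p\<in>set fs. Divisibility.prime (mult_of T) p) \<and>
      (\<forall>p\<in>M. h p = a \<longrightarrow> pr p = u \<otimes>\<^bsub>mult_of T\<^esub> foldr (\<otimes>\<^bsub>mult_of T\<^esub>) fs \<one>\<^bsub>mult_of T\<^esub>)"
    if "a \<in> prime_products A" for a
    using that
  proof induction
    case (unit u)
    then obtain p where p: "p \<in> M" "u = h p" by auto
    then have "pr p \<in> Units (mult_of T)" using unit by (simp add: Units_iff')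
    then show ?case by (intro exI[of _ "pr p"] exI[of _ "[]"]) (auto simp: T pr p)
  next
    case (mult q a)
    then obtain u fs where u: "u \<in> Units (mult_of T)" "set fs \<subseteq> carrier (mult_of T)"
      "\<forall>p\<in>set fs. Divisibility.prime (mult_of T) p"
      "\<And>p. p \<in> M \<Longrightarrow> h p = a \<Longrightarrow> pr p = u \<otimes>\<^bsub>mult_of T\<^esub> foldr (\<otimes>\<^bsub>mult_of T\<^esub>) fs \<one>\<^bsub>mult_of T\<^esub>" by blast
    obtain p where p: "p \<in> M" "q = h p" using mult.hyps(1) by (auto simp: sprime_def)
    have "a \<in> A"
      using mult.hyps(2)
    proof induction
      case (mult p' a')
      then show ?case by (auto simp: sprime_def simp flip: h.hom_mult intro: MD)
    qed
    then obtain r where r: "r \<in> M" "a = h r" by auto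
    have pc: "pr p \<in> carrier (mult_of T)" using p mult.hyps(1) unfolding carrier_iff sprime_def by blast
    have uc: "u \<in> carrier (mult_of T)" using u(1) by (rule T.mult_of.Units_closed)
    have fc: "foldr (\<otimes>\<^bsub>mult_of T\<^esub>) fs \<one>\<^bsub>mult_of T\<^esub> \<in> carrier (mult_of T)"
      using u(2) T.mult_of.m_closed T.mult_of.one_closed by (induction fs) auto
    have "pr s = u \<otimes>\<^bsub>mult_of T\<^esub> foldr (\<otimes>\<^bsub>mult_of T\<^esub>) (pr p # fs) \<one>\<^bsub>mult_of T\<^esub>" if "s \<in> M" "h s = q * a" for s
    proof -
      have "pr s = pr (p * r)" using that p r by (simp add: pr h.hom_mult)
      also have "\<dots> = pr p \<otimes>\<^bsub>T\<^esub> pr r" by (simp add: T)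
      also have "pr r = u \<otimes>\<^bsub>T\<^esub> foldr (\<otimes>\<^bsub>T\<^esub>) fs \<one>\<^bsub>T\<^esub>" using u(4)[OF r(1)] r(2) by simp
      also have "pr p \<otimes>\<^bsub>T\<^esub> (u \<otimes>\<^bsub>T\<^esub> foldr (\<otimes>\<^bsub>T\<^esub>) fs \<one>\<^bsub>T\<^esub>) = u \<otimes>\<^bsub>T\<^esub> (pr p \<otimes>\<^bsub>T\<^esub> foldr (\<otimes>\<^bsub>T\<^esub>) fs \<one>\<^bsub>T\<^esub>)"
        using pc uc fc by (intro T.m_lcomm) auto
      finally show ?thesis by simp
    qed
    then show ?case using u(1-3) pc prime_if_sprime[OF p(1)] mult.hyps(1) p(2)
      by (intro exI[of _ u] exI[of _ "pr p # fs"]) auto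
  qed
  have "factorial_monoid (mult_of T)"
  proof (rule comm_monoid_cancel.factorial_monoid_if_prime_factors)
    show "comm_monoid_cancel (mult_of T)" by (rule T.mult_of.comm_monoid_cancel_axioms)
    fix a assume "a \<in> carrier (mult_of T)"
    then obtain p where p: "p \<in> M" "a = pr p" "h p \<noteq> 0" unfolding carrier_iff by blast
    then have "h p \<in> prime_products A" using assms by auto
    from ex[OF this] p show "\<exists>u fs. u \<in> Units (mult_of T) \<and> set fs \<subseteq> carrier (mult_of T) \<and>
      (\<forall>p\<in>set fs. Divisibility.prime (mult_of T) p) \<and> a = u \<otimes>\<^bsub>mult_of T\<^esub> foldr (\<otimes>\<^bsub>mult_of T\<^esub>) fs \<one>\<^bsub>mult_of T\<^esub>"
      by blast
  qed
  then show ?thesis using domain_T by (simp add: factorial_domain_def)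
qed

lemma not_factorial_if_irreducible_not_prime:
  assumes a: "a \<in> A" "a \<noteq> 0" "\<not> sdvd A a 1"
    and irr: "\<And>r s. r \<in> A \<Longrightarrow> s \<in> A \<Longrightarrow> a = r * s \<Longrightarrow> sdvd A r 1 \<or> sdvd A s 1"
    and bc: "b \<in> A" "c \<in> A" "b \<noteq> 0" "c \<noteq> 0" "sdvd A a (b * c)" "\<not> sdvd A a b" "\<not> sdvd A a c"
  shows "\<not> factorial_domain T"
proof
  assume "factorial_domain T"
  then interpret factorial_monoid "mult_of T" by (simp add: factorial_domain_def)
  obtain p where p: "p \<in> M" "a = h p" using a by auto
  obtain q r where q: "q \<in> M" "b = h q" "r \<in> M" "c = h r" using bc by auto
  have pc: "pr p \<in> carrier (mult_of T)" using p a unfolding carrier_iff by blast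
  have "Divisibility.irreducible (mult_of T) (pr p)" unfolding Divisibility.irreducible_def
  proof (intro conjI ballI impI)
    show "pr p \<notin> Units (mult_of T)" using a p by (simp add: Units_iff')
    fix x assume "x \<in> carrier (mult_of T)" and pf: "Divisibility.properfactor (mult_of T) x (pr p)"
    then obtain s where s: "s \<in> M" "x = pr s" "h s \<noteq> 0" unfolding carrier_iff by blast
    have "sdvd A (h s) (h p)" "\<not> sdvd A (h p) (h s)"
      using pf p(1) a p(2) s by (auto simp: Divisibility.properfactor_def factor_iff)
    then obtain t where t: "t \<in> A" "h p = h s * t" by (auto simp: sdvd_def)
    then have "sdvd A (h s) 1 \<or> sdvd A t 1" using irr[of "h s" t] s(1) p(2) by auto
    then show "x \<in> Units (mult_of T)"
    proof
      assume "sdvd A t 1"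
      then obtain v where "v \<in> A" "1 = t * v" by (auto simp: sdvd_def)
      then have "h s = h p * v" using t(2) by (simp add: mult.assoc)
      then show ?thesis using \<open>v \<in> A\<close> \<open>\<not> sdvd A (h p) (h s)\<close> by (auto simp: sdvd_def)
    qed (use s in \<open>simp add: Units_iff'\<close>)
  qed
  then have pp: "Divisibility.prime (mult_of T) (pr p)"
    using primeness_condition_monoid.irreducible_prime[OF primeness_condition pc] by blast
  have "pr q \<in> carrier (mult_of T)" "pr r \<in> carrier (mult_of T)" using q bc unfolding carrier_iff by blast+
  moreover have "pr p divides\<^bsub>mult_of T\<^esub> pr q \<otimes>\<^bsub>mult_of T\<^esub> pr r"
    using factor_iff[OF p(1) MD(4)[OF q(1,3)]] bc p q by (simp add: T h.hom_mult)
  ultimately have "pr p divides\<^bsub>mult_of T\<^esub> pr q \<or> pr p divides\<^bsub>mult_of T\<^esub> pr r"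
    using pp by (auto simp: Divisibility.prime_def)
  then show False using p q bc by (simp add: factor_iff)
qed

end

section \<open>Products of primes in a subring\<close>

lemma prime_products_mult:
  assumes A: "is_subring A" and "a \<in> prime_products A" "b \<in> prime_products A"
  shows "a * b \<in> prime_products A"
  using assms(2)
proof induction
  case (unit u)
  then obtain v where v: "v \<in> A" "1 = u * v" by (auto simp: sdvd_def)
  show ?case using assms(3)
  proof induction
    case (unit u')
    then obtain v' where v': "v' \<in> A" "1 = u' * v'" by (auto simp: sdvd_def)
    have "1 = (u * u') * (v * v')" using v(2) v'(2) by (metis mult.assoc mult.commute mult.left_commute mult_1_left)
    then have "sdvd A (u * u') 1" using is_subringD(4)[OF A v(1) v'(1)] by (auto simp: sdvd_def)
    then show ?case using is_subringD(4)[OF A \<open>u \<in> A\<close> unit(1)] by (intro prime_products.unit)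
  next
    case (mult p a)
    then show ?case using prime_products.mult[of A p "u * a"] by (simp add: mult.left_commute)
  qed
next
  case (mult p a)
  then show ?case using prime_products.mult[of A p "a * b"] by (simp add: mult.assoc)
qed

text \<open>In \<open>p * a = t * s\<close> the prime \<open>t\<close> divides \<open>a\<close>,
  which is settled by induction, or it divides \<open>p\<close>. In the latter case the primes
  \<open>t\<close> and \<open>p\<close> differ by a unit, which is absorbed into
  \<open>a\<close>.\<close>

lemma prime_products_cancel:
  fixes A :: "'a::idom set"
  assumes A: "is_subring A" and t: "sprime A t" and s: "s \<in> A" "t * s \<in> prime_products A"
  shows "s \<in> prime_products A"
proof -
  have "\<forall>s\<in>A. a = t * s \<longrightarrow> s \<in> prime_products A" if "a \<in> prime_products A" for a
    using that
  proof induction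
    case (unit u)
    show ?case
    proof (intro ballI impI)
      fix s assume s: "s \<in> A" "u = t * s"
      obtain v where "v \<in> A" "1 = u * v" using unit by (auto simp: sdvd_def)
      then have "1 = t * (s * v)" "s * v \<in> A" using s is_subringD(4)[OF A] by (auto simp: mult.assoc)
      then have "sdvd A t 1" by (auto simp: sdvd_def)
      then show "s \<in> prime_products A" using t by (simp add: sprime_def)
    qed
  next
    case (mult p a)
    have pA: "p \<in> A" "p \<noteq> 0" using mult.hyps(1) by (auto simp: sprime_def)
    have aA: "a \<in> A" using mult.hyps(2)
      by induction (auto simp: sprime_def intro: is_subringD(4)[OF A])
    show ?case
    proof (intro ballI impI)
      fix s assume s: "s \<in> A" "p * a = t * s"
      then have "sdvd A t (p * a)" by (auto simp: sdvd_def)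
      then consider "sdvd A t a" | "sdvd A t p" using t pA aA by (auto simp: sprime_def)
      then show "s \<in> prime_products A"
      proof cases
        case 1
        then obtain s' where s': "s' \<in> A" "a = t * s'" by (auto simp: sdvd_def)
        then have "t * (p * s') = t * s" using s(2) by (simp add: mult.left_commute)
        then have "s = p * s'" using t by (auto simp: sprime_def)
        then show ?thesis using mult.IH s' mult.hyps(1) by (auto intro: prime_products.mult)
      next
        case 2
        then obtain c where c: "c \<in> A" "p = t * c" by (auto simp: sdvd_def)
        have tA: "t \<in> A" "t \<noteq> 0" "\<not> sdvd A t 1" using t by (auto simp: sprime_def)
        have "sdvd A p (t * c)" using c(2) is_subringD(1)[OF A] by (auto simp: sdvd_def intro!: bexI[of _ 1])
        then have "sdvd A p t \<or> sdvd A p c" using mult.hyps(1) tA(1) c(1) by (auto simp: sprime_def)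
        moreover have "\<not> sdvd A p c"
        proof
          assume "sdvd A p c"
          then obtain f where f: "f \<in> A" "c = p * f" by (auto simp: sdvd_def)
          then have "p * 1 = p * (t * f)" using c(2) by (simp add: mult.left_commute)
          then have "1 = t * f" using pA(2) by (simp only: mult_cancel_left) simp
          then show False using tA(3) f(1) by (auto simp: sdvd_def)
        qed
        ultimately obtain f where f: "f \<in> A" "t = p * f" by (auto simp: sdvd_def)
        then have "p * 1 = p * (c * f)" using c(2) by (simp add: mult.assoc mult.commute mult.left_commute)
        then have "1 = c * f" using pA(2) by (simp only: mult_cancel_left) simp
        then have "c \<in> prime_products A" using c(1) f(1) by (auto simp: sdvd_def intro!: prime_products.unit)
        moreover have "t * (c * a) = t * s" using s(2) c(2) by (simp add: mult.assoc)
        then have "s = c * a" using tA(2) by simp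
        ultimately show ?thesis using prime_products_mult[OF A _ mult.hyps(2)] by simp
      qed
    qed
  qed
  then show ?thesis using s by blast
qed

section \<open>Factorizations in k[y, z]\<close>

lemma ufd_prime_induct:
  fixes r :: "'a::ufd"
  assumes "r \<noteq> 0" "\<And>u. u dvd 1 \<Longrightarrow> P u" "\<And>p a. prime_elem p \<Longrightarrow> P a \<Longrightarrow> P (p * a)"
  shows "P r"
proof (cases "r dvd 1")
  case False
  then obtain F where F: "mset_factors F r" using mset_factors_exist assms(1) by blast
  have pr: "\<forall>f. f \<in># F \<longrightarrow> prime_elem f" using mset_factorsD[OF F] by auto
  have "P (prod_mset F)" using pr
  proof (induction F)
    case empty
    then show ?case using assms(2) by simp
  next
    case (add f F)
    then show ?case using assms(3) by simp
  qed
  then show ?thesis using mset_factorsD[OF F] by auto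
qed (rule assms(2))

lemma prime_power_factors:
  fixes y :: "'a::idom"
  assumes "prime_elem y"
  shows "a * b = y ^ n \<Longrightarrow> \<exists>i u v. i \<le> n \<and> u * v = 1 \<and> a = u * y ^ i \<and> b = v * y ^ (n - i)"
proof (induction n arbitrary: a b)
  case 0
  then show ?case by (intro exI[of _ 0] exI[of _ a] exI[of _ b]) simp
next
  case (Suc n)
  have y0: "y \<noteq> 0" using assms by auto
  have "y dvd a * b" using Suc.prems by simp
  then consider "y dvd a" | "y dvd b" using assms by (auto simp: prime_elem_dvd_mult_iff)
  then show ?case
  proof cases
    case 1
    then obtain a' where a': "a = y * a'" by (auto elim: dvdE)
    then have "y * (a' * b) = y * y ^ n" using Suc.prems by (simp add: mult.assoc)
    then have "a' * b = y ^ n" using y0 by simp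
    then obtain i u v where "i \<le> n" "u * v = 1" "a' = u * y ^ i" "b = v * y ^ (n - i)" using Suc.IH by blast
    then show ?thesis using a' by (intro exI[of _ "Suc i"] exI[of _ u] exI[of _ v]) (simp add: mult.left_commute)
  next
    case 2
    then obtain b' where b': "b = y * b'" by (auto elim: dvdE)
    then have "y * (a * b') = y * y ^ n" using Suc.prems by (simp add: mult.left_commute)
    then have "a * b' = y ^ n" using y0 by simp
    then obtain i u v where "i \<le> n" "u * v = 1" "a = u * y ^ i" "b' = v * y ^ (n - i)" using Suc.IH by blast
    then show ?thesis using b'
      by (intro exI[of _ i] exI[of _ u] exI[of _ v]) (simp add: Suc_diff_le mult.left_commute)
  qed
qed

lemma unit_poly2: "u dvd 1 \<Longrightarrow> \<exists>c. c \<noteq> 0 \<and> u = cnst2 (c :: 'k::field)"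
  by (auto simp: is_unit_poly_iff cnst2_def dvd_field_iff elim!: degree_eq_zeroE)

lemma unit_pair_poly2:
  assumes "u * v = (1 :: 'k::field poly poly)"
  shows "\<exists>c. c \<noteq> 0 \<and> u = cnst2 c \<and> v = cnst2 (1 / c)"
proof -
  have "u dvd 1" using assms by (metis dvd_triv_left)
  then obtain c where c: "c \<noteq> 0" "u = cnst2 c" using unit_poly2 by blast
  have "u * cnst2 (1 / c) = 1" using c by (simp flip: cnst2.hom_mult)
  then have "u * v = u * cnst2 (1 / c)" using assms by simp
  then have "v = cnst2 (1 / c)" using assms by (metis mult_cancel_left mult_zero_left zero_neq_one)
  then show ?thesis using c by blast
qed

lemma prime_var_y: "prime_elem (var_y :: 'k::field poly poly)"
  unfolding var_y_def by (intro lift_prime_elem_poly prime_elem_linear_field_poly) simp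

section \<open>Arithmetic of S_lam: substitutions, denominators, divisibility by x0\<close>

definition subst3 :: "'k poly poly poly \<Rightarrow> 'k poly poly poly \<Rightarrow> 'k poly poly poly \<Rightarrow>
    'k::field poly poly poly \<Rightarrow> 'k poly poly poly" where
  "subst3 a b c p = poly (map_poly (\<lambda>q. poly (map_poly (\<lambda>r. poly (map_poly cnst3 r) a) q) b) p) c"

lemma comm_ring_hom_subst3: "comm_ring_hom (subst3 a b c)"
  unfolding subst3_def[abs_def] by (intro comm_ring_hom_eval comm_ring_hom_cnst3)

interpretation subst3: comm_ring_hom "subst3 a b c" for a b c
  by (rule comm_ring_hom_subst3)

lemma eval_const_var:
  assumes "comm_ring_hom h"
  shows "poly (map_poly h [:k:]) a = h k" "poly (map_poly h [:0, 1:]) a = a"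
proof -
  interpret comm_ring_hom h by (rule assms)
  show "poly (map_poly h [:k:]) a = h k" "poly (map_poly h [:0, 1:]) a = a"
    by (simp_all add: Polynomial.map_poly_pCons)
qed

lemma subst3_gens [simp]:
  "subst3 a b c x0 = a" "subst3 a b c x1 = b" "subst3 a b c x2 = c" "subst3 a b c (cnst3 k) = cnst3 k"
proof -
  note h = comm_ring_hom_cnst3 comm_ring_hom_eval[OF comm_ring_hom_cnst3]
    comm_ring_hom_eval[OF comm_ring_hom_eval[OF comm_ring_hom_cnst3]]
  show "subst3 a b c x0 = a" "subst3 a b c x1 = b" "subst3 a b c x2 = c" "subst3 a b c (cnst3 k) = cnst3 k"
    unfolding subst3_def x0_def x1_def x2_def cnst3_def[of k]
    by (simp_all only: eval_const_var[OF h(1)] eval_const_var[OF h(2)] eval_const_var[OF h(3)] cnst3_def)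
qed

lemma poly3_hom_eqI:
  fixes F G :: "'k::field poly poly poly \<Rightarrow> 'r::comm_ring_1"
  assumes "comm_ring_hom F" "comm_ring_hom G" "\<And>c. F (cnst3 c) = G (cnst3 c)"
    "F x0 = G x0" "F x1 = G x1" "F x2 = G x2"
  shows "F p = G p"
proof -
  interpret F: comm_ring_hom F by (rule assms)
  interpret G: comm_ring_hom G by (rule assms)
  have "ring_gen (range cnst3 \<union> {x0, x1, x2}) \<subseteq> {p. F p = G p}"
    using assms by (intro ring_gen_least)
      (auto simp: is_subring_def F.hom_add G.hom_add F.hom_mult G.hom_mult F.hom_uminus G.hom_uminus)
  then show ?thesis unfolding ring_gen_x by auto
qed

text \<open>A substitution that fixes the quadric acts on the surface. It is applied to the exchange
  of \<open>x0\<close> and \<open>x2\<close> and to the change of all signs.\<close>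

lemma h3_subst:
  fixes p :: "'k::field_char_0 poly poly poly"
  assumes "subst3 a b c (quadric lam) = quadric lam" "h3 lam p = h3 lam q"
  shows "h3 lam (subst3 a b c p) = h3 lam (subst3 a b c q)"
proof -
  have "quadric lam dvd p - q" using assms(2) by (simp add: h3_eq_0_iff[symmetric] h3.hom_minus)
  then obtain g where "p - q = quadric lam * g" by (auto elim: dvdE)
  then have "subst3 a b c (p - q) = quadric lam * subst3 a b c g" using assms(1) by (simp add: subst3.hom_mult)
  then have "h3 lam (subst3 a b c (p - q)) = 0" by (simp add: h3.hom_mult h3_quadric)
  then show ?thesis by (simp add: subst3.hom_minus h3.hom_minus)
qed

lemma subst3_quadric:
  "subst3 x2 x1 x0 (quadric lam) = quadric lam" "subst3 (- x0) (- x1) (- x2) (quadric lam) = quadric lam"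
  by (simp_all add: quadric_def subst3.hom_minus subst3.hom_mult subst3.hom_power two_cnst3 mult.assoc mult.commute[of x2 x0])

text \<open>The quotient ring with \<open>x0\<close> inverted is \<open>k[y, 1/y, z]\<close>; the
  powers of 2 that come from the pseudo-division are scalars and are moved into
  \<open>r\<close>.\<close>

lemma clear_denominators:
  fixes p :: "'k::field_char_0 poly poly poly"
  shows "\<exists>N r. to_fract var_y ^ N * h3 lam p = to_fract r"
proof -
  obtain N q r where N: "[:2 * var_y:] ^ N * p = quadric lam * q + [:r:]"
    using pseudo_division_quadric by blast
  have "h3 lam ([:2 * var_y:] ^ N * p) = to_fract r"
    unfolding N by (simp only: h3.hom_add h3.hom_mult h3_quadric h3_const) simp
  moreover have "[:2 * var_y:] ^ N = cnst3 (2 ^ N :: 'k) * x0 ^ N"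
  proof -
    have "[:2 * var_y:] = cnst3 2 * (x0 :: 'k poly poly poly)"
      by (simp add: x_eq cnst2_def numeral_poly var_y_def)
    then show ?thesis by (simp add: power_mult_distrib cnst3.hom_power)
  qed
  ultimately have e1: "kappa (2 ^ N) * (to_fract var_y ^ N * h3 lam p) = to_fract r"
    by (simp only: h3.hom_mult h3.hom_power h3_gens mult.assoc)
  have e2: "kappa (1 / 2 ^ N) * kappa (2 ^ N) = (1 :: 'k poly poly fract)"
    by (simp add: kappa_def flip: to_fract_hom.hom_mult cnst2.hom_mult)
  have "to_fract var_y ^ N * h3 lam p = kappa (1 / 2 ^ N) * (kappa (2 ^ N) * (to_fract var_y ^ N * h3 lam p))"
    unfolding mult.assoc[symmetric] e2 by simp
  also have "\<dots> = to_fract (cnst2 (1 / 2 ^ N) * r)" unfolding e1 unfolding kappa_def by (simp only: to_fract_hom.hom_mult)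
  finally show ?thesis by blast
qed

text \<open>Reduction modulo \<open>x0\<close>. The quadric becomes \<open>- (x1 ^ 2 + lam)\<close>,
  so divisibility by \<open>x0\<close> on the surface is divisibility by \<open>x1 ^ 2 + lam\<close>
  in \<open>k[x1, x2]\<close>.\<close>

definition at0 :: "'k::field poly poly poly \<Rightarrow> 'k poly poly" where
  "at0 = map_poly (map_poly (\<lambda>c. poly c 0))"

lemma comm_ring_hom_at0: "comm_ring_hom (at0 :: 'k::field poly poly poly \<Rightarrow> _)"
proof -
  interpret e: comm_ring_hom "\<lambda>c :: 'k poly. poly c 0" by unfold_locales simp_all
  interpret m: map_poly_comm_ring_hom "\<lambda>c :: 'k poly. poly c 0" ..
  interpret mm: map_poly_comm_ring_hom "map_poly (\<lambda>c :: 'k poly. poly c 0)" ..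
  show ?thesis unfolding at0_def by (rule mm.comm_ring_hom_axioms)
qed

interpretation at0: comm_ring_hom at0
  by (rule comm_ring_hom_at0)

lemma coeff_at0: "coeff (coeff (at0 p) l) j = poly (coeff (coeff p l) j) 0"
  by (simp add: at0_def coeff_map_poly)

lemma at0_gens [simp]: "at0 x0 = 0" "at0 x1 = [:[:0, 1:]:]" "at0 (cnst3 c) = [:[:c:]:]"
  by (rule poly_eqI, rule poly_eqI, simp add: coeff_at0 x0_def x1_def cnst3_def coeff_pCons split: nat.splits)+

lemma at0_quadric: "at0 (quadric lam) = - [:[:lam, 0, 1:]:]"
  by (simp add: quadric_def at0.hom_minus at0.hom_mult at0.hom_power power2_eq_square)

lemma at0_eq_0: "at0 p = 0 \<Longrightarrow> x0 dvd p"
proof -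
  assume "at0 p = 0"
  then have "poly (coeff (coeff p l) j) 0 = 0" for l j using coeff_at0[of p l j] by simp
  then have "[:0, 1:] dvd coeff (coeff p l) j" for l j
    using poly_eq_0_iff_dvd[of "coeff (coeff p l) j" 0] by simp
  then show "x0 dvd p" unfolding x0_def const_poly_dvd_iff by blast
qed

lemma at0_surj: "\<exists>p. at0 p = r"
  by (rule exI[of _ "map_poly (map_poly (\<lambda>c. [:c:])) r"], rule poly_eqI, rule poly_eqI)
    (simp add: coeff_at0 coeff_map_poly)

lemma y_dvd_iff:
  fixes p :: "'k::field_char_0 poly poly poly"
  shows "sdvd (range (h3 lam)) (to_fract var_y) (h3 lam p) \<longleftrightarrow> [:[:lam, 0, 1:]:] dvd at0 p"
proof
  assume "sdvd (range (h3 lam)) (to_fract var_y) (h3 lam p)"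
  then obtain q where "h3 lam p = h3 lam (x0 * q)" by (auto simp: sdvd_def h3.hom_mult)
  then have "quadric lam dvd p - x0 * q" by (simp add: h3_eq_0_iff[symmetric] h3.hom_minus)
  then obtain g where "p - x0 * q = quadric lam * g" by (auto elim: dvdE)
  then have "p = quadric lam * g + x0 * q" by (simp add: algebra_simps)
  then have "at0 p = - [:[:lam, 0, 1:]:] * at0 g"
    by (simp only: at0.hom_add at0.hom_mult at0_gens at0_quadric mult_zero_left add_0_right)
  then show "[:[:lam, 0, 1:]:] dvd at0 p" by (metis dvd_minus_iff dvd_triv_left mult_minus_left)
next
  assume "[:[:lam, 0, 1:]:] dvd at0 p"
  then obtain r where r: "at0 p = [:[:lam, 0, 1:]:] * r" by (auto elim: dvdE)
  obtain g where g: "at0 g = r" using at0_surj by blast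
  have "at0 (p + quadric lam * g) = 0"
    unfolding at0.hom_add at0.hom_mult at0_quadric r g by (simp only: mult_minus_left add.right_inverse)
  then obtain q where "p + quadric lam * g = x0 * q" using at0_eq_0 by (auto elim: dvdE)
  then have "h3 lam (p + quadric lam * g) = to_fract var_y * h3 lam q" by (simp add: h3.hom_mult)
  then show "sdvd (range (h3 lam)) (to_fract var_y) (h3 lam p)"
    by (auto simp: sdvd_def h3.hom_add h3.hom_mult h3_quadric)
qed

lemma small_not_dvd:
  assumes "q \<noteq> 0" "degree q < 2"
  shows "\<not> [:[:lam :: 'k::field, 0, 1:]:] dvd [:q:]"
proof
  assume "[:[:lam, 0, 1:]:] dvd [:q:]"
  then have "[:lam, 0, 1:] dvd coeff [:q:] 0" unfolding const_poly_dvd_iff by blast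
  then have "degree [:lam, 0, 1:] \<le> degree q" using assms(1) by (intro dvd_imp_degree_le) auto
  then show False using assms(2) by simp
qed

lemma y_not_unit: "\<not> sdvd (range (h3 lam)) (to_fract var_y) (1 :: 'k::field_char_0 poly poly fract)"
  using y_dvd_iff[of lam 1] small_not_dvd[of 1 lam] by simp

lemma subring_S: "is_subring (range (h3 lam))"
  unfolding is_subring_def
proof (intro conjI ballI)
  show "1 \<in> range (h3 lam)" by (metis h3.hom_one rangeI)
  fix a b assume "a \<in> range (h3 lam)" "b \<in> range (h3 lam)"
  then show "a + b \<in> range (h3 lam)" "a * b \<in> range (h3 lam)" "- a \<in> range (h3 lam)"
    by (auto simp flip: h3.hom_add h3.hom_mult h3.hom_uminus)
qed

text \<open>In \<open>k[y, 1/y, z]\<close> the factors of \<open>y ^ k\<close> are scalars times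
  powers of \<open>y\<close>, possibly with negative exponents. These are excluded because
  \<open>y\<close> is not a unit in the image of \<open>h3 lam\<close>.\<close>

lemma y_power_factors:
  fixes a b :: "'k::field_char_0 poly poly fract"
  assumes "a \<in> range (h3 lam)" "b \<in> range (h3 lam)" "a * b = to_fract var_y ^ k"
  shows "\<exists>i c. i \<le> k \<and> c \<noteq> 0 \<and> a = kappa c * to_fract var_y ^ i \<and> b = kappa (1 / c) * to_fract var_y ^ (k - i)"
proof -
  let ?y = "to_fract var_y :: 'k poly poly fract" and ?A = "range (h3 lam)"
  have y0: "?y \<noteq> 0" by (simp add: var_y_def)
  have yA: "?y \<in> ?A" by (metis h3_gens(1) rangeI)
  have kA: "kappa c \<in> ?A" for c by (metis h3_gens(3) rangeI)
  note AD = is_subringD[OF subring_S[of lam]]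
  have key: "m \<le> j" if "a \<in> ?A" "c \<noteq> 0" "?y ^ m * a = kappa c * ?y ^ j" for a c m j
  proof (rule ccontr)
    assume "\<not> m \<le> j"
    then obtain l where l: "m = j + Suc l" by (metis add_Suc_right less_imp_Suc_add not_le)
    have "?y ^ j * (?y ^ Suc l * a) = ?y ^ j * kappa c" using that(3) by (simp add: l power_add mult.assoc mult.commute)
    then have "?y * (?y ^ l * a) = kappa c" using y0 by (simp add: mult.assoc)
    then have "?y * (?y ^ l * a * kappa (1 / c)) = kappa c * kappa (1 / c)" by (simp add: mult.assoc[symmetric])
    also have "\<dots> = 1" using that(2) by (simp add: kappa_def flip: to_fract_hom.hom_mult cnst2.hom_mult)
    finally have "1 = ?y * (?y ^ l * a * kappa (1 / c))" by simp
    moreover have "?y ^ l * a * kappa (1 / c) \<in> ?A"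
      using that(1) yA kA by (intro AD is_subring_power[OF subring_S])
    ultimately have "sdvd ?A ?y 1" unfolding sdvd_def by blast
    then show False using y_not_unit by blast
  qed
  obtain N a1 where a1: "?y ^ N * a = to_fract a1" using assms(1) clear_denominators by blast
  obtain M b1 where b1: "?y ^ M * b = to_fract b1" using assms(2) clear_denominators by blast
  have "to_fract (a1 * b1) = (?y ^ N * a) * (?y ^ M * b)" by (simp add: a1 b1 hom_distribs)
  also have "\<dots> = ?y ^ (N + M) * (a * b)" by (simp add: power_add ac_simps)
  also have "\<dots> = to_fract (var_y ^ (N + M + k))" by (simp add: assms(3) power_add hom_distribs)
  finally have "a1 * b1 = var_y ^ (N + M + k)" by (simp only: to_fract_eq_iff)
  then obtain j u v where j: "j \<le> N + M + k" "u * v = 1" "a1 = u * var_y ^ j" "b1 = v * var_y ^ (N + M + k - j)"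
    using prime_power_factors[OF prime_var_y] by blast
  obtain c where c: "c \<noteq> 0" "u = cnst2 c" "v = cnst2 (1 / c)" using unit_pair_poly2[OF j(2)] by blast
  have a: "?y ^ N * a = kappa c * ?y ^ j" unfolding a1 j c kappa_def by (simp add: hom_distribs)
  have b: "?y ^ M * b = kappa (1 / c) * ?y ^ (N + M + k - j)" unfolding b1 j c kappa_def by (simp add: hom_distribs)
  have "N \<le> j" using key[OF assms(1) c(1) a] .
  moreover have "M \<le> N + M + k - j" using key[OF assms(2) _ b] c(1) by simp
  ultimately obtain i where i: "j = N + i" "i \<le> k" using j(1) by (auto simp: le_iff_add)
  have "?y ^ N * a = ?y ^ N * (kappa c * ?y ^ i)" using a by (simp add: i power_add mult.left_commute)
  moreover have "?y ^ M * b = ?y ^ M * (kappa (1 / c) * ?y ^ (k - i))"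
  proof -
    have "N + M + k - j = M + (k - i)" using i by simp
    then show ?thesis using b by (simp add: power_add mult.left_commute)
  qed
  ultimately have "a = kappa c * ?y ^ i" "b = kappa (1 / c) * ?y ^ (k - i)" using y0 by simp_all
  then show ?thesis using i(2) c(1) by blast
qed

lemma kappa_unit: "c \<noteq> 0 \<Longrightarrow> kappa (1 / c) \<in> A \<Longrightarrow> sdvd A (kappa c) 1"
  unfolding sdvd_def by (rule bexI[of _ "kappa (1 / c)"])
    (simp_all add: kappa_def flip: to_fract_hom.hom_mult cnst2.hom_mult)

section \<open>Rings that are not factorial: S_lam with -lam a square, and Q_lam\<close>

lemma concrete_S: "concrete_ring (S_alg (lam :: 'k::field_char_0)) (S_proj lam) (h3 lam) UNIV"
  by (intro concrete_ring.intro comm_ring_hom_h3 is_subring_UNIV S_proj_eq_iff S_alg_ops)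

text \<open>\<open>x0\<close> is irreducible and divides
  \<open>(x1 - c) * (x1 + c) = 2 * x0 * x2\<close> on the surface, but neither factor, because both
  are linear in \<open>x1\<close> modulo \<open>x0\<close>.\<close>

lemma S_not_factorial:
  assumes "c\<^sup>2 = - (lam :: 'k::field_char_0)" "lam \<noteq> 0"
  shows "\<not> factorial_domain (S_alg lam)"
proof -
  interpret concrete_ring "S_alg lam" "S_proj lam" "h3 lam" UNIV by (rule concrete_S)
  let ?b = "x1 - cnst3 c" and ?c = "x1 + cnst3 c"
  have at: "at0 ?b = [:[:- c, 1:]:]" "at0 ?c = [:[:c, 1:]:]" by (simp_all add: at0.hom_minus at0.hom_add)
  have "cnst3 c * cnst3 c = - cnst3 lam"
    using assms(1) by (simp add: power2_eq_square cnst3.hom_uminus flip: cnst3.hom_mult)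
  then have "?b * ?c = x1 * x1 + cnst3 lam" by (simp add: algebra_simps)
  then have bc: "h3 lam ?b * h3 lam ?c = to_fract var_y * h3 lam (cnst3 2 * x2)"
    using h3_relation'[of lam] by (simp only: h3.hom_mult[symmetric] h3_gens(1)[of lam, symmetric] mult.left_commute)
  show ?thesis
  proof (rule not_factorial_if_irreducible_not_prime[of "to_fract var_y" "h3 lam ?b" "h3 lam ?c"])
    show "to_fract var_y \<in> range (h3 lam)" by (metis h3_gens(1) rangeI)
    show "to_fract var_y \<noteq> (0 :: 'k poly poly fract)" by (simp add: var_y_def)
    show "\<not> sdvd (range (h3 lam)) (to_fract var_y) 1" by (rule y_not_unit)
    show "sdvd (range (h3 lam)) (to_fract var_y) (h3 lam ?b * h3 lam ?c)" unfolding bc sdvd_def by blast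
    show nb: "\<not> sdvd (range (h3 lam)) (to_fract var_y) (h3 lam ?b)"
      unfolding y_dvd_iff at by (rule small_not_dvd) simp_all
    show nc: "\<not> sdvd (range (h3 lam)) (to_fract var_y) (h3 lam ?c)"
      unfolding y_dvd_iff at by (rule small_not_dvd) simp_all
    have z: "sdvd (range (h3 lam)) (to_fract var_y) 0"
      unfolding sdvd_def by (rule bexI[of _ "h3 lam 0"], simp, rule rangeI)
    show "h3 lam ?b \<noteq> 0" using nb z by metis
    show "h3 lam ?c \<noteq> 0" using nc z by metis
    fix r s assume rs: "r \<in> range (h3 lam)" "s \<in> range (h3 lam)" "to_fract var_y = r * s"
    have "r * s = to_fract var_y ^ 1" by (simp only: rs(3)[symmetric] power_one_right)
    from y_power_factors[OF rs(1,2) this] obtain i k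
      where i: "i \<le> 1" "k \<noteq> 0" "r = kappa k * to_fract var_y ^ i" "s = kappa (1 / k) * to_fract var_y ^ (1 - i)"
      by blast
    have kA: "kappa c \<in> range (h3 lam)" for c by (metis h3_gens(3) rangeI)
    show "sdvd (range (h3 lam)) r 1 \<or> sdvd (range (h3 lam)) s 1"
    proof (cases i)
      case 0
      then show ?thesis using i kappa_unit[OF i(2) kA] by simp
    next
      case (Suc j)
      then show ?thesis using i kappa_unit[of "1 / k", OF _ kA] by simp
    qed
  qed auto
qed

lemma concrete_Q:
  "concrete_ring (Q_alg (lam :: 'k::field_char_0)) (S_proj lam) (h3 lam) (ring_gen (range cnst3 \<union> forms3 2))"
proof (intro concrete_ring.intro comm_ring_hom_h3 ring_gen_subring S_proj_eq_iff)
  show "carrier (Q_alg lam) = S_proj lam ` ring_gen (range cnst3 \<union> forms3 2)"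
    by (simp add: Q_alg_def generated_subalgebra_poly3)
qed (simp_all add: Q_alg_def S_alg_ops)

lemma Q_not_factorial: "\<not> factorial_domain (Q_alg (lam :: 'k::field_char_0))"
proof -
  let ?M = "ring_gen (range cnst3 \<union> forms3 2) :: 'k poly poly poly set"
  let ?A = "h3 lam ` ?M" and ?y = "to_fract var_y :: 'k poly poly fract"
  interpret concrete_ring "Q_alg lam" "S_proj lam" "h3 lam" ?M by (rule concrete_Q)
  have mono: "x0 * x0 \<in> ?M" "x0 * x1 \<in> ?M" "x1 * x1 \<in> ?M" "cnst3 c \<in> ?M" for c
    using forms3_2_monomials[where 'k = 'k] ring_gen_incl[of "range cnst3 \<union> (forms3 2 :: 'k poly poly poly set)"] by auto
  have y0: "?y \<noteq> 0" by (simp add: var_y_def)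
  have sub: "?A \<subseteq> range (h3 lam)" by auto
  have sd: "sdvd (range (h3 lam)) a b" if "sdvd ?A a b" for a b using that by (auto simp: sdvd_def)
  have kA: "kappa c \<in> ?A" for c using mono(4)[of c] by (metis h3_gens(3) imageI)
  \<comment> \<open>The change of signs fixes everything generated by quadratic forms, whereas it
    negates \<open>x0\<close>.\<close>
  let ?tau = "subst3 (- x0) (- x1) (- x2) :: 'k poly poly poly \<Rightarrow> _"
  have even: "?tau p = p" if "p \<in> ?M" for p
  proof -
    have "?M \<subseteq> {p. ?tau p = p}"
    proof (rule ring_gen_least)
      show "is_subring {p. ?tau p = p}"
        by (auto simp: is_subring_def subst3.hom_add subst3.hom_mult subst3.hom_uminus)
      have "forms3 2 \<subseteq> {p. ?tau p = p}"
        by (rule forms3_2_subset_additive) (auto simp: subst3.hom_add subst3.hom_mult)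
      then show "range cnst3 \<union> forms3 2 \<subseteq> {p. ?tau p = p}" by auto
    qed
    then show ?thesis using that by auto
  qed
  show ?thesis
  proof (rule not_factorial_if_irreducible_not_prime[of "?y * ?y" "h3 lam (x0 * x1)" "h3 lam (x0 * x1)"])
    show "?y * ?y \<in> ?A" using mono(1) by (metis h3.hom_mult h3_gens(1) imageI)
    show "?y * ?y \<noteq> 0" using y0 by simp
    show "\<not> sdvd ?A (?y * ?y) 1"
    proof
      assume "sdvd ?A (?y * ?y) 1"
      then obtain p where "1 = ?y * (?y * h3 lam p)" by (auto simp: sdvd_def mult.assoc)
      then have "1 = ?y * h3 lam (x0 * p)" by (simp add: h3.hom_mult)
      then have "sdvd (range (h3 lam)) ?y 1" unfolding sdvd_def by blast
      then show False using y_not_unit by blast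
    qed
    show "h3 lam (x0 * x1) \<in> ?A" "h3 lam (x0 * x1) \<in> ?A" using mono(2) by auto
    show "h3 lam (x0 * x1) \<noteq> 0" "h3 lam (x0 * x1) \<noteq> 0" using y0 by (simp_all add: h3.hom_mult var_z_def)
    have "h3 lam (x0 * x1) * h3 lam (x0 * x1) = ?y * ?y * h3 lam (x1 * x1)"
      by (simp add: h3.hom_mult ac_simps)
    then show "sdvd ?A (?y * ?y) (h3 lam (x0 * x1) * h3 lam (x0 * x1))" using mono(3) unfolding sdvd_def by blast
    have nd: "\<not> sdvd ?A (?y * ?y) (h3 lam (x0 * x1))"
    proof
      assume "sdvd ?A (?y * ?y) (h3 lam (x0 * x1))"
      then obtain p where "?y * h3 lam x1 = ?y * (?y * h3 lam p)" by (auto simp: sdvd_def h3.hom_mult mult.assoc)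
      then have "h3 lam x1 = ?y * h3 lam p" using y0 by (simp only: mult_cancel_left) simp
      then have "sdvd (range (h3 lam)) ?y (h3 lam x1)" unfolding sdvd_def by blast
      then show False unfolding y_dvd_iff using small_not_dvd[of "[:0, 1:]" lam] by simp
    qed
    show "\<not> sdvd ?A (?y * ?y) (h3 lam (x0 * x1))" "\<not> sdvd ?A (?y * ?y) (h3 lam (x0 * x1))" by (rule nd)+
    fix r s assume rs: "r \<in> ?A" "s \<in> ?A" "?y * ?y = r * s"
    have "r * s = ?y ^ 2" by (simp only: rs(3)[symmetric] power2_eq_square)
    from y_power_factors[OF subsetD[OF sub rs(1)] subsetD[OF sub rs(2)] this] obtain i k
      where i: "i \<le> 2" "k \<noteq> 0" "r = kappa k * ?y ^ i" "s = kappa (1 / k) * ?y ^ (2 - i)" by blast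
    \<comment> \<open>A factor that is a nonzero scalar times \<open>x0\<close> would be both fixed
      and negated by the change of signs.\<close>
    have "i \<noteq> 1"
    proof
      assume "i = 1"
      obtain p where p: "p \<in> ?M" "r = h3 lam p" using rs(1) by auto
      have "h3 lam p = h3 lam (cnst3 k * x0)" using p(2) i(3) \<open>i = 1\<close> by (simp add: h3.hom_mult)
      from h3_subst[OF subst3_quadric(2) this] have "h3 lam (cnst3 k * x0) = h3 lam (- (cnst3 k * x0))"
        using even[OF p(1)] \<open>h3 lam p = h3 lam (cnst3 k * x0)\<close> by (simp add: subst3.hom_mult)
      then have "kappa k * ?y + kappa k * ?y = 0" by (simp add: h3.hom_uminus h3.hom_mult)
      then have "to_fract (cnst2 k * var_y + cnst2 k * var_y) = 0" by (simp add: kappa_def hom_distribs)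
      then have "var_y = (0 :: 'k poly poly) \<or> cnst2 k = 0" by (simp add: to_fract_eq_0_iff flip: to_fract_hom.hom_add)
      then show False using i(2) by (simp add: cnst2_def var_y_def)
    qed
    then have "i = 0 \<or> i = 2" using i(1) by auto
    then show "sdvd ?A r 1 \<or> sdvd ?A s 1"
      using i kappa_unit[OF i(2) kA] kappa_unit[of "1 / k", OF _ kA] by auto
  qed
qed

section \<open>Factoriality of S_lam when -lam is not a square\<close>

lemma prime_z2_plus_lam:
  assumes "\<not> (\<exists>c. c\<^sup>2 = - (lam :: 'k::field))"
  shows "prime_elem [:lam, 0, 1:]"
proof -
  let ?g = "[:lam, 0, 1:]"
  have unit: "a dvd 1" if "a \<noteq> 0" "degree a = 0" for a :: "'k poly"
    using that by (auto simp: is_unit_poly_iff dvd_field_iff elim!: degree_eq_zeroE)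
  have "irreducible ?g"
  proof (rule irreducibleI)
    show "?g \<noteq> 0" by simp
    show "\<not> ?g dvd 1"
    proof
      assume "?g dvd 1"
      then have "degree ?g \<le> degree (1 :: 'k poly)" by (rule dvd_imp_degree_le) simp
      then show False by simp
    qed
    fix a b assume ab: "?g = a * b"
    have nz: "a \<noteq> 0" "b \<noteq> 0"
    proof -
      have "a * b \<noteq> 0" by (simp only: ab[symmetric]) simp
      then show "a \<noteq> 0" "b \<noteq> 0" by auto
    qed
    have deg: "degree a + degree b = 2"
      using degree_mult_eq[OF nz] by (simp only: ab[symmetric]) simp
    show "a dvd 1 \<or> b dvd 1"
    proof (rule ccontr)
      assume "\<not> (a dvd 1 \<or> b dvd 1)"
      then have "degree a \<noteq> 0" "degree b \<noteq> 0" using unit nz by auto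
      then have "degree a = 1" using deg by simp
      then have "a = [:coeff a 0, coeff a 1:]"
        by (intro poly_eqI) (auto simp: coeff_pCons coeff_eq_0 split: nat.splits)
      moreover have "coeff a 1 \<noteq> 0" using \<open>degree a = 1\<close> nz(1) by (metis leading_coeff_0_iff)
      ultimately obtain c0 c1 where a: "a = [:c0, c1:]" "c1 \<noteq> 0" by blast
      have "poly ?g (- c0 / c1) = 0" unfolding ab a by (simp add: a(2))
      then have "(- c0 / c1)\<^sup>2 = - lam" by (simp add: power2_eq_square eq_neg_iff_add_eq_0 add.commute)
      then show False using assms by blast
    qed
  qed
  then show ?thesis by simp
qed

lemma swap_swap: "subst3 x2 x1 x0 (subst3 x2 x1 x0 p) = p"
proof -
  interpret s2: comm_ring_hom "\<lambda>p. subst3 x2 x1 x0 (subst3 x2 x1 x0 p)"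
    by unfold_locales (simp_all add: subst3.hom_add subst3.hom_mult)
  interpret id: comm_ring_hom "\<lambda>p :: 'a poly poly poly. p" by unfold_locales simp_all
  show ?thesis
    by (rule poly3_hom_eqI[where F = "\<lambda>p. subst3 x2 x1 x0 (subst3 x2 x1 x0 p)" and G = "\<lambda>p. p"])
      (simp_all add: s2.comm_ring_hom_axioms id.comm_ring_hom_axioms)
qed

text \<open>The automorphism exchanging \<open>x0\<close> and \<open>x2\<close> turns divisibility by \<open>x0 ^ n\<close> into divisibility by \<open>x2 ^ n\<close>, which has
  degree \<open>2 * n\<close> in \<open>z\<close>.\<close>

lemma y_powers_separated:
  fixes lam :: "'k::field_char_0"
  assumes "s \<in> range (h3 lam)" "s \<noteq> 0"
  shows "\<exists>n. \<not> sdvd (range (h3 lam)) (to_fract var_y ^ n) s"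
proof (rule ccontr)
  assume "\<not> ?thesis"
  then have all: "sdvd (range (h3 lam)) (to_fract var_y ^ n) s" for n by blast
  obtain p where p: "s = h3 lam p" using assms(1) by auto
  let ?s = "subst3 x2 x1 x0 :: 'k poly poly poly \<Rightarrow> 'k poly poly poly"
  have sp: "h3 lam (?s p) \<noteq> 0"
  proof
    assume "h3 lam (?s p) = 0"
    then have "h3 lam (?s p) = h3 lam 0" by simp
    from h3_subst[OF subst3_quadric(1) this] have "h3 lam p = 0" by (simp add: swap_swap)
    then show False using assms(2) p by simp
  qed
  obtain N r where r: "to_fract var_y ^ N * h3 lam (?s p) = to_fract r" using clear_denominators by blast
  have r0: "r \<noteq> 0"
  proof
    assume "r = 0"
    then have "to_fract var_y ^ N * h3 lam (?s p) = 0" using r by simp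
    then show False using sp by (simp add: var_y_def)
  qed
  \<comment> \<open>Large enough that \<open>2 * n\<close> exceeds the degree of \<open>r\<close> in
    \<open>z\<close>; the powers of \<open>var_y\<close> and \<open>2 * var_y\<close> used as
    denominators have degree 0 in \<open>z\<close>.\<close>
  define n where "n = Suc (degree r)"
  obtain q where q: "h3 lam p = h3 lam (x0 ^ n * q)"
    using all[of n] unfolding sdvd_def p by (auto simp: h3.hom_mult h3.hom_power)
  obtain M r' where r': "to_fract var_y ^ M * h3 lam (?s q) = to_fract r'" using clear_denominators by blast
  let ?Y = "2 * var_y :: 'k poly poly" and ?Z = "var_z\<^sup>2 + cnst2 lam :: 'k poly poly"
  have "h3 lam (?s p) = h3 lam x2 ^ n * h3 lam (?s q)"
    using h3_subst[OF subst3_quadric(1) q]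
    by (simp add: subst3.hom_mult subst3.hom_power h3.hom_mult h3.hom_power del: h3_gens(4))
  then have "to_fract ?Y ^ n * h3 lam (?s p) = (to_fract ?Y * h3 lam x2) ^ n * h3 lam (?s q)"
    by (simp only: power_mult_distrib mult.assoc)
  then have "to_fract ?Y ^ n * h3 lam (?s p) = to_fract ?Z ^ n * h3 lam (?s q)"
    unfolding h3_relation .
  moreover have "(a * c) * (b * e) = (b * d) * (a * f)" if "c * e = d * f"
    for a b c d e f :: "'k poly poly fract"
  proof -
    have "(a * c) * (b * e) = (a * b) * (c * e)" by (simp only: ac_simps)
    also have "\<dots> = (b * d) * (a * f)" unfolding that by (simp only: ac_simps)
    finally show ?thesis .
  qed
  ultimately have "(to_fract var_y ^ M * to_fract ?Y ^ n) * (to_fract var_y ^ N * h3 lam (?s p))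
      = (to_fract var_y ^ N * to_fract ?Z ^ n) * (to_fract var_y ^ M * h3 lam (?s q))"
    by blast
  then have "to_fract (var_y ^ M * ?Y ^ n * r) = to_fract (var_y ^ N * ?Z ^ n * r')"
    unfolding r r' by (simp only: to_fract_hom.hom_mult to_fract_hom.hom_power)
  then have eq: "var_y ^ M * ?Y ^ n * r = var_y ^ N * ?Z ^ n * r'" by (simp only: to_fract_eq_iff)
  have y: "var_y ^ i \<noteq> (0 :: 'k poly poly)" "degree (var_y ^ i :: 'k poly poly) = 0" for i
    by (simp_all add: var_y_def poly_const_pow)
  have Y: "?Y ^ n \<noteq> 0" "degree (?Y ^ n) = 0" using two_y_nz[where 'k = 'k] by (simp_all add: two_y poly_const_pow)
  have dZ: "degree ?Z = 2"
  proof -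
    have "?Z = [:[:lam:], 0, 1:]" by (simp add: var_z_def cnst2_def power2_eq_square)
    then show ?thesis by simp
  qed
  have z0: "?Z \<noteq> 0"
  proof
    assume "?Z = 0"
    then have "degree ?Z = 0" by (simp only: degree_0)
    then show False using dZ by simp
  qed
  have Z: "?Z ^ n \<noteq> 0" "degree (?Z ^ n) = 2 * n"
    using z0 degree_power_eq[OF z0, of n] dZ by (simp_all only: power_eq_0_iff mult.commute not_False_eq_True simp_thms)
  have "var_y ^ M * ?Y ^ n * r \<noteq> 0" using y(1) Y(1) r0 by (simp only: mult_eq_0_iff simp_thms)
  then have "r' \<noteq> 0" unfolding eq by auto
  have "degree (var_y ^ M * ?Y ^ n * r) = degree r"
    using y[of M] Y r0 by (simp only: degree_mult_eq mult_eq_0_iff simp_thms add_0_left)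
  moreover have "degree (var_y ^ N * ?Z ^ n * r') = 2 * n + degree r'"
    using y[of N] Z \<open>r' \<noteq> 0\<close> by (simp only: degree_mult_eq mult_eq_0_iff simp_thms add_0_left)
  ultimately have "degree r = 2 * n + degree r'" unfolding eq by simp
  then show False by (simp add: n_def)
qed

text \<open>Three facts make up the criterion: \<open>y\<close> is prime, because
  \<open>x1 ^ 2 + lam\<close> is; a prime of \<open>k[y, z]\<close> not dividing \<open>y\<close>
  becomes prime in the larger ring once its factors \<open>y\<close> are removed; and every element
  is brought into \<open>k[y, z]\<close> by a power of \<open>y\<close>, which is cancelled
  afterwards.\<close>

lemma S_prime_products:
  fixes lam :: "'k::field_char_0"
  assumes "\<not> (\<exists>c. c\<^sup>2 = - lam)"
  shows "range (h3 lam) - {0} \<subseteq> prime_products (range (h3 lam))"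
proof -
  let ?A = "range (h3 lam)" and ?y = "to_fract var_y :: 'k poly poly fract"
  note A = subring_S[of lam] note AD = is_subringD[OF A]
  have fA: "to_fract r \<in> ?A" for r by (metis h3_const rangeI)
  have y0: "?y \<noteq> 0" by (simp add: var_y_def)
  have ydvd: "sdvd ?A ?y (h3 lam p) \<longleftrightarrow> [:[:lam, 0, 1:]:] dvd at0 p" for p by (rule y_dvd_iff)
  have prime_g: "prime_elem [:[:lam, 0, 1:]:]" by (intro lift_prime_elem_poly prime_z2_plus_lam assms)
  have yp: "sprime ?A ?y" unfolding sprime_def
  proof (intro conjI ballI impI)
    show "?y \<in> ?A" by (rule fA)
    show "?y \<noteq> 0" by (rule y0)
    show "\<not> sdvd ?A ?y 1" by (rule y_not_unit)
    fix a b assume "a \<in> ?A" "b \<in> ?A" and d: "sdvd ?A ?y (a * b)"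
    then obtain p q where pq: "a = h3 lam p" "b = h3 lam q" by auto
    then have "sdvd ?A ?y (h3 lam (p * q))" using d by (simp only: h3.hom_mult)
    then show "sdvd ?A ?y a \<or> sdvd ?A ?y b"
      unfolding ydvd pq at0.hom_mult prime_elem_dvd_mult_iff[OF prime_g] .
  qed
  have yPP: "?y ^ n * a \<in> prime_products ?A" if "a \<in> prime_products ?A" for n a
    using that by (induction n) (auto simp: mult.assoc intro: prime_products.mult yp)
  have kPP: "kappa c \<in> prime_products ?A" if "c \<noteq> 0" for c
    using kappa_unit[OF that] by (intro prime_products.unit) (metis h3_gens(3) rangeI)+
  \<comment> \<open>As \<open>y\<close> is prime and does not divide \<open>q'\<close>, all factors
    \<open>y\<close> on the left of \<open>y ^ N * a = q' * r\<close> divide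
    \<open>r\<close>.\<close>
  have cancel: "sdvd ?A q' a" if q': "q' \<in> ?A" "\<not> sdvd ?A ?y q'" and "a \<in> ?A" "r \<in> ?A" "?y ^ N * a = q' * r" for q' a r N
    using that(4,5)
  proof (induction N arbitrary: r)
    case 0
    then show ?case by (auto simp: sdvd_def)
  next
    case (Suc N)
    have e: "q' * r = ?y * (?y ^ N * a)" using Suc.prems(2) by (simp add: mult.assoc)
    moreover have "?y ^ N * a \<in> ?A" using that(3) fA by (intro AD is_subring_power[OF A])
    ultimately have "sdvd ?A ?y (q' * r)" unfolding sdvd_def by blast
    then have "sdvd ?A ?y r" using yp q' Suc.prems(1) unfolding sprime_def by blast
    then obtain r' where r': "r' \<in> ?A" "r = ?y * r'" unfolding sdvd_def by blast
    then have "q' * r = ?y * (q' * r')" by (simp only: mult.left_commute)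
    then have "?y * (?y ^ N * a) = ?y * (q' * r')" by (rule trans[OF e[symmetric]])
    then have "?y ^ N * a = q' * r'" using y0 by (metis mult_cancel_left)
    then show ?case using Suc.IH r'(1) by blast
  qed
  have primePP: "to_fract q \<in> prime_products ?A" if q: "prime_elem q" "\<not> q dvd var_y" for q :: "'k poly poly"
  proof -
    have q0: "to_fract q \<noteq> 0" using q(1) by auto
    have ndvd: "\<not> q dvd var_y ^ n" for n using prime_elem_dvd_power[OF q(1)] q(2) by (rule contrapos_nn[rotated])
    \<comment> \<open>The first power of \<open>y\<close> that does not divide \<open>q\<close>; it
      exists by \<open>y_powers_separated\<close>. A prime of \<open>k[y, z]\<close> can acquire a
      factor \<open>y\<close>: on the surface, \<open>z ^ 2 + lam = 2 * y * x2\<close>.\<close>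
    define n0 where "n0 = (LEAST n. \<not> sdvd ?A (?y ^ n) (to_fract q))"
    have n0: "\<not> sdvd ?A (?y ^ n0) (to_fract q)"
      unfolding n0_def by (rule LeastI_ex) (rule y_powers_separated[OF fA q0])
    have n1: "sdvd ?A (?y ^ m) (to_fract q)" if "m < n0" for m
      using not_less_Least[OF that[unfolded n0_def]] by (rule notnotD)
    have "sdvd ?A (?y ^ 0) (to_fract q)" using fA[of q] unfolding sdvd_def by (intro bexI[of _ "to_fract q"]) simp_all
    then obtain e where e: "n0 = Suc e" using n0 by (cases n0) simp_all
    have "sdvd ?A (?y ^ e) (to_fract q)" by (rule n1) (simp add: e)
    then obtain q' where q': "q' \<in> ?A" "to_fract q = ?y ^ e * q'" unfolding sdvd_def by (elim bexE)
    have nd: "\<not> sdvd ?A ?y q'"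
    proof
      assume "sdvd ?A ?y q'"
      then obtain f where "f \<in> ?A" "q' = ?y * f" unfolding sdvd_def by blast
      then have "f \<in> ?A" "to_fract q = ?y ^ n0 * f" using q'(2) e by (simp_all add: mult.assoc mult.left_commute)
      then show False using n0 unfolding sdvd_def by blast
    qed
    have "sprime ?A q'" unfolding sprime_def
    proof (intro conjI ballI impI)
      show "q' \<in> ?A" by (rule q'(1))
      show "q' \<noteq> 0" using q'(2) q0 by auto
      show "\<not> sdvd ?A q' 1"
      proof
        assume "sdvd ?A q' 1"
        then obtain v where v: "v \<in> ?A" "1 = q' * v" unfolding sdvd_def by blast
        obtain M v1 where v1: "?y ^ M * v = to_fract v1" using v(1) clear_denominators by blast
        have "to_fract (q * v1) = ?y ^ e * ?y ^ M * (q' * v)"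
          unfolding to_fract_hom.hom_mult q'(2) v1[symmetric] by (simp only: ac_simps)
        also have "\<dots> = to_fract (var_y ^ (e + M))" by (simp add: v(2)[symmetric] power_add hom_distribs)
        finally have "q * v1 = var_y ^ (e + M)" by (simp only: to_fract_eq_iff)
        then show False using ndvd[of "e + M"] by (metis dvd_triv_left)
      qed
      fix a b assume ab: "a \<in> ?A" "b \<in> ?A" "sdvd ?A q' (a * b)"
      then obtain c where c: "c \<in> ?A" "a * b = q' * c" unfolding sdvd_def by blast
      obtain Na a1 where a1: "?y ^ Na * a = to_fract a1" using ab(1) clear_denominators by blast
      obtain Nb b1 where b1: "?y ^ Nb * b = to_fract b1" using ab(2) clear_denominators by blast
      obtain Nc c1 where c1: "?y ^ Nc * c = to_fract c1" using c(1) clear_denominators by blast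
      \<comment> \<open>The equation \<open>a * b = q' * c\<close> is moved into
        \<open>k[y, z]\<close>, where \<open>q\<close> divides \<open>a1\<close> or
        \<open>b1\<close>; \<open>cancel\<close> carries this divisibility back.\<close>
      have "to_fract (q * c1 * var_y ^ (Na + Nb)) = ?y ^ (Na + Nb) * ?y ^ e * ?y ^ Nc * (q' * c)"
        unfolding to_fract_hom.hom_mult to_fract_hom.hom_power q'(2) c1[symmetric] by (simp only: ac_simps)
      also have "\<dots> = to_fract (var_y ^ (e + Nc) * (a1 * b1))"
        unfolding to_fract_hom.hom_mult to_fract_hom.hom_power a1[symmetric] b1[symmetric] c(2)[symmetric] power_add
        by (simp only: ac_simps)
      finally have "q * c1 * var_y ^ (Na + Nb) = var_y ^ (e + Nc) * (a1 * b1)" by (simp only: to_fract_eq_iff)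
      then have "q dvd var_y ^ (e + Nc) * (a1 * b1)" by (metis dvd_triv_left mult.assoc)
      then have "q dvd a1 \<or> q dvd b1" using ndvd q(1) by (simp add: prime_elem_dvd_mult_iff)
      moreover have "sdvd ?A q' a" if h: "q dvd a1" "?y ^ Na * a = to_fract a1" "a \<in> ?A" for a a1 Na
      proof -
        obtain f where "a1 = q * f" using h(1) unfolding dvd_def by (elim exE)
        then have "?y ^ Na * a = q' * (?y ^ e * to_fract f)"
          unfolding h(2) by (simp add: q'(2) hom_distribs ac_simps)
        moreover have "?y ^ e * to_fract f \<in> ?A" using fA by (intro AD is_subring_power[OF A])
        ultimately show ?thesis using cancel[OF q'(1) nd h(3)] by blast
      qed
      ultimately show "sdvd ?A q' a \<or> sdvd ?A q' b" using a1 b1 ab(1,2) by blast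
    qed
    then have "q' * kappa 1 \<in> prime_products ?A" by (rule prime_products.mult) (rule kPP, simp)
    then have "q' \<in> prime_products ?A" by (simp add: kappa_def)
    then show ?thesis unfolding q'(2) by (rule yPP)
  qed
  have polyPP: "to_fract r \<in> prime_products ?A" if "r \<noteq> 0" for r :: "'k poly poly"
    using that
  proof (rule ufd_prime_induct)
    fix u :: "'k poly poly" assume "u dvd 1"
    then obtain c where "c \<noteq> 0" "u = cnst2 c" using unit_poly2 by blast
    then show "to_fract u \<in> prime_products ?A" using kPP by (simp add: kappa_def)
  next
    fix p a :: "'k poly poly" assume p: "prime_elem p" "to_fract a \<in> prime_products ?A"
    have "to_fract p \<in> prime_products ?A"
    proof (cases "p dvd var_y")
      \<comment> \<open>A prime dividing the prime \<open>var_y\<close> is an associate of it, so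
        here \<open>p\<close> is \<open>var_y\<close> times a scalar.\<close>
      case True
      then obtain v where v: "var_y = p * v" by (elim dvdE)
      have "var_y dvd p"
      proof -
        have "var_y dvd p \<or> var_y dvd v" using prime_elem_dvd_multD[OF prime_var_y, of p v] v by simp
        moreover have "\<not> var_y dvd v"
        proof
          assume "var_y dvd v"
          then obtain f where f: "v = var_y * f" by (elim dvdE)
          have "v = p * v * f" by (rule trans[OF f]) (simp only: v[symmetric])
          also have "p * v * f = v * (p * f)" by (simp only: ac_simps)
          finally have "v = 0 \<or> p * f = 1" by (simp only: mult_cancel_left1)
          moreover have "v \<noteq> 0" using v y0 by auto
          ultimately have "p * f = 1" by simp
          then have "p dvd 1" by (metis dvd_triv_left)
          then show False using p(1) by (simp add: prime_elem_def)
        qed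
        ultimately show ?thesis by blast
      qed
      then obtain u where u: "p = var_y * u" by (elim dvdE)
      then have "var_y * 1 = var_y * (u * v)" using v by (simp add: mult.assoc)
      then have "u * v = 1" using y0 by simp
      then obtain c where "c \<noteq> 0" "u = cnst2 c" using unit_pair_poly2 by blast
      then have "?y ^ 1 * kappa c \<in> prime_products ?A" by (intro yPP kPP)
      then show ?thesis using u \<open>u = cnst2 c\<close> by (simp add: kappa_def hom_distribs)
    qed (rule primePP[OF p(1)])
    then show "to_fract (p * a) \<in> prime_products ?A"
      unfolding to_fract_hom.hom_mult using p(2) by (rule prime_products_mult[OF A])
  qed
  have descend: "s \<in> prime_products ?A" if "s \<in> ?A" "?y ^ N * s \<in> prime_products ?A" for s N
    using that
  proof (induction N)
    case (Suc N)
    have "?y ^ N * s \<in> ?A" using Suc.prems(1) fA by (intro AD is_subring_power[OF A])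
    moreover have "?y * (?y ^ N * s) \<in> prime_products ?A" using Suc.prems(2) by (simp add: mult.assoc)
    ultimately have "?y ^ N * s \<in> prime_products ?A" by (rule prime_products_cancel[OF A yp])
    then show ?case using Suc by blast
  qed simp
  show ?thesis
  proof
    fix s assume s: "s \<in> ?A - {0}"
    then obtain N r where r: "?y ^ N * s = to_fract r" using clear_denominators by blast
    then have "to_fract r \<noteq> 0" using s y0 by (metis DiffE mult_eq_0_iff power_eq_0_iff singletonI)
    then have "?y ^ N * s \<in> prime_products ?A" unfolding r by (intro polyPP) auto
    then show "s \<in> prime_products ?A" using s descend by blast
  qed
qed

lemma S_factorial_iff:
  assumes "lam \<noteq> (0 :: 'k::field_char_0)"
  shows "factorial_domain (S_alg lam) \<longleftrightarrow> \<not> (\<exists>c. c\<^sup>2 = - lam)"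
proof
  assume "factorial_domain (S_alg lam)"
  then show "\<not> (\<exists>c. c\<^sup>2 = - lam)" using S_not_factorial assms by blast
next
  assume *: "\<not> (\<exists>c. c\<^sup>2 = - lam)"
  interpret concrete_ring "S_alg lam" "S_proj lam" "h3 lam" UNIV by (rule concrete_S)
  show "factorial_domain (S_alg lam)" by (rule factorial_if_prime_products[OF S_prime_products[OF *]])
qed

section \<open>Factoriality of k[F_d]\<close>

lemma concrete_kF:
  "concrete_ring (kF d :: ('k::field, 'k poly poly) module) (\<lambda>p. p) (\<lambda>p. p) (ring_gen (range cnst2 \<union> forms2 d))"
proof (rule concrete_ring.intro)
  show "comm_ring_hom (\<lambda>p :: 'k poly poly. p)" by unfold_locales simp_all
  show "is_subring (ring_gen (range cnst2 \<union> forms2 d) :: 'k poly poly set)" by simp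
qed (simp_all add: kF_def generated_subalgebra_poly2, simp_all add: poly2_def)

lemma kF_1_carrier: "ring_gen (range cnst2 \<union> forms2 1) = (UNIV :: 'k::field poly poly set)"
proof -
  let ?M = "ring_gen (range cnst2 \<union> forms2 1) :: 'k poly poly set"
  have sub: "is_subring ?M" by simp
  have M: "cnst2 c \<in> ?M" "var_y \<in> ?M" "var_z \<in> ?M" for c
    using ring_gen_incl[of "range cnst2 \<union> (forms2 1 :: 'k poly poly set)"]
      forms2_monomial[of 1 0 1 "1::'k"] forms2_monomial[of 0 1 1 "1::'k"] by auto
  have "p \<in> ?M" for p
  proof (rule poly2_in_additive)
    show "0 \<in> ?M" by (rule is_subringD(2)[OF sub])
    show "p + q \<in> ?M" if "p \<in> ?M" "q \<in> ?M" for p q by (rule is_subringD(3)[OF sub that])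
    show "cnst2 (coeff (coeff p j) i) * (var_y ^ i * var_z ^ j) \<in> ?M" for i j
      by (intro is_subringD(4)[OF sub] is_subring_power[OF sub] M)
  qed
  then show ?thesis by auto
qed

lemma kF_1_factorial: "factorial_domain (kF 1 :: ('k::field, 'k poly poly) module)"
proof -
  note C = concrete_kF[of 1, where 'k = 'k, unfolded kF_1_carrier]
  have sd: "sdvd UNIV a b \<longleftrightarrow> a dvd b" for a b :: "'k poly poly" by (auto simp: sdvd_def dvd_def)
  have "r \<in> prime_products UNIV" if "r \<noteq> 0" for r :: "'k poly poly"
    using that
  proof (rule ufd_prime_induct)
    show "u \<in> prime_products UNIV" if "u dvd 1" for u :: "'k poly poly"
      using that by (intro prime_products.unit) (simp_all add: sd)
    show "p * a \<in> prime_products UNIV" if "prime_elem p" "a \<in> prime_products UNIV" for p a :: "'k poly poly"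
    proof (rule prime_products.mult[OF _ that(2)])
      show "sprime UNIV p"
        using that(1) unfolding prime_elem_def sprime_def sd by (elim conjE) (intro conjI ballI impI; blast)
    qed
  qed
  then show ?thesis by (intro concrete_ring.factorial_if_prime_products[OF C]) auto
qed

lemma kF_1_iso: "alg_iso (kF 1) (poly2 :: ('k::field, 'k poly poly) module) \<noteq> {}"
proof -
  have "carrier (kF 1 :: ('k, 'k poly poly) module) = UNIV"
    by (simp add: kF_def generated_subalgebra_poly2 kF_1_carrier[unfolded One_nat_def])
  then have "kF 1 = (poly2 :: ('k, 'k poly poly) module)" by (simp add: kF_def poly2_def alg_of_def)
  then have "(\<lambda>p. p) \<in> alg_iso (kF 1) (poly2 :: ('k, 'k poly poly) module)"
    by (auto simp: alg_iso_def ring_iso_def Ring.ring_hom_def bij_betw_def)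
  then show ?thesis by blast
qed

text \<open>Polynomials whose monomials all have degree divisible by \<open>d\<close> form a
  subring. This keeps the powers \<open>y ^ i\<close> with \<open>0 < i < d\<close> out of
  \<open>kF d\<close>.\<close>

lemma kF_degrees:
  assumes "p \<in> ring_gen (range cnst2 \<union> forms2 d)" "coeff (coeff p j) i \<noteq> (0 :: 'k::field)"
  shows "d dvd i + j"
proof -
  let ?X = "{p :: 'k poly poly. \<forall>i j. coeff (coeff p j) i \<noteq> 0 \<longrightarrow> d dvd i + j}"
  have "ring_gen (range cnst2 \<union> forms2 d) \<subseteq> ?X"
  proof (rule ring_gen_least)
    show "range cnst2 \<union> forms2 d \<subseteq> ?X"
      by (auto simp: cnst2_def forms2_def coeff_pCons split: nat.splits if_splits)
    show "is_subring ?X" unfolding is_subring_def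
    proof (intro conjI ballI)
      show "1 \<in> ?X"
      proof (intro CollectI allI impI)
        show "d dvd i + j" if "coeff (coeff (1 :: 'k poly poly) j) i \<noteq> 0" for i j
          using that by (cases j; cases i) simp_all
      qed
      fix p assume p: "p \<in> ?X"
      then show "- p \<in> ?X" by simp
      fix q assume q: "q \<in> ?X"
      have "d dvd i + j" if "coeff (coeff p j) i + coeff (coeff q j) i \<noteq> 0" for i j
      proof -
        have "coeff (coeff p j) i \<noteq> 0 \<or> coeff (coeff q j) i \<noteq> 0" using that by auto
        then show ?thesis using p q by blast
      qed
      then show "p + q \<in> ?X" by simp
      have "d dvd i + j" if nz: "coeff (coeff (p * q) j) i \<noteq> 0" for i j
      proof -
        have "(\<Sum>l\<le>j. coeff (coeff p l * coeff q (j - l)) i) \<noteq> 0" using nz by (simp add: coeff_mult coeff_sum)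
        then obtain l where l: "l \<le> j" "coeff (coeff p l * coeff q (j - l)) i \<noteq> 0" by (auto elim: sum.not_neutral_contains_not_neutral)
        then have "(\<Sum>m\<le>i. coeff (coeff p l) m * coeff (coeff q (j - l)) (i - m)) \<noteq> 0" by (simp add: coeff_mult)
        then obtain m where m: "m \<le> i" "coeff (coeff p l) m * coeff (coeff q (j - l)) (i - m) \<noteq> 0"
          by (auto elim: sum.not_neutral_contains_not_neutral)
        then have "coeff (coeff p l) m \<noteq> 0" "coeff (coeff q (j - l)) (i - m) \<noteq> 0" by auto
        then have "d dvd m + l" "d dvd (i - m) + (j - l)" using p q by blast+
        then have "d dvd (m + l) + ((i - m) + (j - l))" by (rule dvd_add)
        then show ?thesis using l(1) m(1) by simp
      qed
      then show "p * q \<in> ?X" by simp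
    qed
  qed
  then show ?thesis using assms by blast
qed

lemma kF_not_factorial:
  assumes "d \<ge> 2"
  shows "\<not> factorial_domain (kF d :: ('k::field_char_0, 'k poly poly) module)"
proof -
  let ?M = "ring_gen (range cnst2 \<union> forms2 d) :: 'k poly poly set"
  note C = concrete_kF[of d, where 'k = 'k]
  have FM: "forms2 d \<subseteq> ?M" "cnst2 c \<in> ?M" for c
    using ring_gen_incl[of "range cnst2 \<union> (forms2 d :: 'k poly poly set)"] by auto
  have mono: "var_y ^ i * var_z ^ j \<in> ?M" if "i + j = d" for i j
    using forms2_monomial[OF that, of "1::'k"] FM by auto
  have y0: "var_y \<noteq> (0 :: 'k poly poly)" by (simp add: var_y_def)
  have cu: "sdvd ?M (cnst2 c) 1" if "c \<noteq> 0" for c :: 'k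
    unfolding sdvd_def by (rule bexI[of _ "cnst2 (1 / c)"]) (use that FM in \<open>simp_all flip: cnst2.hom_mult\<close>)
  obtain m where m: "d = Suc (Suc m)" using assms by (metis add_2_eq_Suc le_Suc_ex)
  let ?b = "var_y ^ Suc m * var_z :: 'k poly poly"
  show ?thesis
  proof (rule concrete_ring.not_factorial_if_irreducible_not_prime[OF C, of "var_y ^ d" ?b ?b])
    show "var_y ^ d \<in> (\<lambda>p. p) ` ?M" using mono[of d 0] by simp
    show "var_y ^ d \<noteq> (0 :: 'k poly poly)" using y0 by simp
    show "\<not> sdvd ((\<lambda>p. p) ` ?M) (var_y ^ d) 1"
    proof
      assume "sdvd ((\<lambda>p. p) ` ?M) (var_y ^ d) 1"
      then have "var_y ^ d dvd (1 :: 'k poly poly)" by (auto simp: sdvd_def dvd_def)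
      then have "var_y dvd (1 :: 'k poly poly)" using m by (metis dvd_trans dvd_triv_left power_Suc)
      then show False using prime_var_y[where 'k = 'k] by (simp add: prime_elem_def)
    qed
    show "?b \<in> (\<lambda>p. p) ` ?M" "?b \<in> (\<lambda>p. p) ` ?M" using mono[of "Suc m" 1] m by simp_all
    show "?b \<noteq> 0" "?b \<noteq> 0" using y0 by (simp_all add: var_z_def)
    have "?b * ?b = var_y ^ d * (var_y ^ m * var_z ^ 2)" by (simp add: m power2_eq_square algebra_simps)
    then show "sdvd ((\<lambda>p. p) ` ?M) (var_y ^ d) (?b * ?b)"
      using mono[of m 2] m unfolding sdvd_def by (intro bexI[of _ "var_y ^ m * var_z ^ 2"]) auto
    have nd: "\<not> sdvd ((\<lambda>p. p) ` ?M) (var_y ^ d) ?b"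
    proof
      assume "sdvd ((\<lambda>p. p) ` ?M) (var_y ^ d) ?b"
      then obtain f where "?b = var_y ^ d * f" by (auto simp: sdvd_def)
      then have "var_y ^ Suc m * var_z = var_y ^ Suc m * (var_y * f)" by (simp add: m mult.assoc mult.left_commute)
      then have "var_z = var_y * f" using y0 by (metis mult_cancel_left power_not_zero)
      then have "coeff var_z 1 = coeff (var_y * f) 1" by simp
      then have "(1 :: 'k poly) = [:0, 1:] * coeff f 1" by (simp add: var_z_def var_y_def)
      then have "poly (1 :: 'k poly) 0 = poly ([:0, 1:] * coeff f 1) 0" by (rule arg_cong)
      then show False by simp
    qed
    show "\<not> sdvd ((\<lambda>p. p) ` ?M) (var_y ^ d) ?b" "\<not> sdvd ((\<lambda>p. p) ` ?M) (var_y ^ d) ?b" by (rule nd)+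
    fix r s :: "'k poly poly" assume rs: "r \<in> (\<lambda>p. p) ` ?M" "s \<in> (\<lambda>p. p) ` ?M" "var_y ^ d = r * s"
    obtain i u v where i: "i \<le> d" "u * v = 1" "r = u * var_y ^ i" "s = v * var_y ^ (d - i)"
      using prime_power_factors[OF prime_var_y rs(3)[symmetric]] by blast
    obtain c where c: "c \<noteq> 0" "u = cnst2 c" "v = cnst2 (1 / c)" using unit_pair_poly2[OF i(2)] by blast
    \<comment> \<open>In \<open>k[y, z]\<close> a factor of \<open>y ^ d\<close> is a scalar times
      \<open>y ^ i\<close>; membership in \<open>kF d\<close> leaves \<open>i = 0\<close> or
      \<open>i = d\<close>, and one of the two factors is a scalar.\<close>
    have "r = monom (monom c i) 0" using i(3) c(2) by (simp add: monom2_eq)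
    then have "d dvd i + 0" using kF_degrees[of r d 0 i] rs(1) c(1) by simp
    then have "i = 0 \<or> i = d" using i(1) by (auto dest: dvd_imp_le)
    then show "sdvd ((\<lambda>p. p) ` ?M) r 1 \<or> sdvd ((\<lambda>p. p) ` ?M) s 1"
      using i(3,4) c cu[OF c(1)] cu[of "1 / c"] by auto
  qed
qed

theorem theorem4p5:
  fixes scale :: "'k::field_char_0 \<Rightarrow> 'b::idom \<Rightarrow> 'b"
    and D U :: "'b \<Rightarrow> 'b"
  shows
    "(affine_domain (alg_of scale) \<and> normal_domain TYPE('b) \<and>
        krull_dim (alg_of scale) = 2 \<and>
        Units (alg_of scale) = {scale c 1 |c. c \<noteq> 0} \<and>
        fundamental_pair scale D U \<and> nontrivial_pair D U
      \<longrightarrow>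
        (\<exists>d\<ge>1. equivariantly_isomorphic (alg_of scale, D, U) (kF d, D2, U2)) \<or>
        (\<exists>lam. lam \<noteq> 0 \<and>
           (equivariantly_isomorphic (alg_of scale, D, U) (S_alg lam, S_D lam, S_U lam) \<or>
            equivariantly_isomorphic (alg_of scale, D, U) (Q_alg lam, S_D lam, S_U lam)))) \<and>
     (\<forall>d\<ge>1. factorial_domain (kF d :: ('k, 'k poly poly) module) \<longleftrightarrow> d = 1) \<and>
     alg_iso (kF 1) (poly2 :: ('k, 'k poly poly) module) \<noteq> {} \<and>
     (\<forall>lam::'k. lam \<noteq> 0 \<longrightarrow>
        (factorial_domain (S_alg lam) \<longleftrightarrow> \<not> (\<exists>c. c\<^sup>2 = - lam))) \<and>
     (\<forall>lam::'k. lam \<noteq> 0 \<longrightarrow> \<not> factorial_domain (Q_alg lam))"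
proof (intro conjI allI impI)
  show "factorial_domain (kF d :: ('k, 'k poly poly) module) \<longleftrightarrow> d = 1" if "d \<ge> 1" for d
    using that kF_1_factorial kF_not_factorial[of d, where 'k = 'k] by (cases "d = 1") auto
qed (use sl2_surface_classification[of scale D U] in blast,
    rule kF_1_iso, erule S_factorial_iff, rule Q_not_factorial)

end
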